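(* Let $\mathcal{T}$ be an embedded $3$-dimensional torus in a $6$-dimensional exact symplectic manifold $(M,\omega=d\alpha)$. Then the following is impossible: $\ker\omega_{|T\mathcal{T}}$ defines a $1$-dimensional bundle in the tangent space of $\mathcal{T}$ (i.e. $\dim\ker\omega_{|T_x\mathcal{T}}=1$ for every $x\in\mathcal{T}$) and the corresponding characteristic leaves define a locally trivial fibration in circles of $\mathcal{T}$.
   Context: For $x\in\mathcal{T}$, $\ker\omega_{|T_x\mathcal{T}}=\{u\in T_x\mathcal{T}:\ \omega(u,v)=0\ \ \forall v\in T_x\mathcal{T}\}$. When this kernel has constant dimension $1$, the characteristic leaves are the leaves of the $1$-dimensional foliation of $\mathcal{T}$ tangent to the line field $x\mapsto\ker\omega_{|T_x\mathcal{T}}$. They define a locally trivial fibration in circles if they are the fibers of a locally trivial fiber bundle with total space $\mathcal{T}$ and fiber a circle. *)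

theory Defs
  imports "HOL-Analysis.Analysis"
begin

section \<open>Smooth maps between open subsets of Euclidean spaces\<close>

text \<open>Meant for open sets \<open>S\<close> only.\<close>

primrec Ck_on :: "nat \<Rightarrow> 'a::euclidean_space set \<Rightarrow> ('a \<Rightarrow> 'b::real_normed_vector) \<Rightarrow> bool" where
  "Ck_on 0 S f \<longleftrightarrow> continuous_on S f"
| "Ck_on (Suc k) S f \<longleftrightarrow>
     f differentiable_on S \<and> (\<forall>v. Ck_on k S (\<lambda>x. frechet_derivative f (at x) v))"

definition smooth_on :: "'a::euclidean_space set \<Rightarrow> ('a \<Rightarrow> 'b::real_normed_vector) \<Rightarrow> bool" where
  "smooth_on S f \<longleftrightarrow> (\<forall>k. Ck_on k S f)"


section \<open>Smooth manifolds and smooth embeddings\<close>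

text \<open>
  A chart is a pair of its domain and its coordinate map; the coordinate map is only relevant on
  the domain. Atlases need not be maximal.
\<close>

type_synonym ('m, 'e) chart = "'m set \<times> ('m \<Rightarrow> 'e)"

abbreviation cdom :: "('m, 'e) chart \<Rightarrow> 'm set" where
  "cdom c \<equiv> fst c"

abbreviation cmap :: "('m, 'e) chart \<Rightarrow> 'm \<Rightarrow> 'e" where
  "cmap c \<equiv> snd c"

abbreviation cimg :: "('m, 'e) chart \<Rightarrow> 'e set" where
  "cimg c \<equiv> cmap c ` cdom c"

text \<open>The expression of a map in a chart \<open>c\<close> of the source and a chart \<open>d\<close> of the target;
  \<open>in_charts c d id\<close> is a coordinate change.\<close>

definition in_charts :: "('m, 'e) chart \<Rightarrow> ('n, 'f) chart \<Rightarrow> ('m \<Rightarrow> 'n) \<Rightarrow> 'e \<Rightarrow> 'f" where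
  "in_charts c d f = cmap d \<circ> f \<circ> inv_into (cdom c) (cmap c)"

definition smooth_manifold :: "'m topology \<Rightarrow> ('m, 'e::euclidean_space) chart set \<Rightarrow> bool" where
  "smooth_manifold M A \<longleftrightarrow>
     Hausdorff_space M \<and> second_countable M \<and>
     (\<Union>c\<in>A. cdom c) = topspace M \<and>
     (\<forall>c\<in>A. openin M (cdom c) \<and> open (cimg c) \<and>
        homeomorphic_map (subtopology M (cdom c)) (top_of_set (cimg c)) (cmap c)) \<and>
     (\<forall>c\<in>A. \<forall>d\<in>A. smooth_on (cmap c ` (cdom c \<inter> cdom d)) (in_charts c d id))"

definition smooth_map ::
  "'m topology \<Rightarrow> ('m, 'e::euclidean_space) chart set \<Rightarrow>
   'n topology \<Rightarrow> ('n, 'f::euclidean_space) chart set \<Rightarrow> ('m \<Rightarrow> 'n) \<Rightarrow> bool" where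
  "smooth_map M A N B f \<longleftrightarrow>
     continuous_map M N f \<and>
     (\<forall>c\<in>A. \<forall>d\<in>B. smooth_on (cmap c ` {x \<in> cdom c. f x \<in> cdom d}) (in_charts c d f))"

definition smooth_immersion ::
  "'m topology \<Rightarrow> ('m, 'e::euclidean_space) chart set \<Rightarrow>
   'n topology \<Rightarrow> ('n, 'f::euclidean_space) chart set \<Rightarrow> ('m \<Rightarrow> 'n) \<Rightarrow> bool" where
  "smooth_immersion M A N B f \<longleftrightarrow>
     smooth_map M A N B f \<and>
     (\<forall>c\<in>A. \<forall>d\<in>B. \<forall>x\<in>cdom c. f x \<in> cdom d \<longrightarrow>
        inj (frechet_derivative (in_charts c d f) (at (cmap c x))))"

definition smooth_embedding ::
  "'m topology \<Rightarrow> ('m, 'e::euclidean_space) chart set \<Rightarrow>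
   'n topology \<Rightarrow> ('n, 'f::euclidean_space) chart set \<Rightarrow> ('m \<Rightarrow> 'n) \<Rightarrow> bool" where
  "smooth_embedding M A N B f \<longleftrightarrow> smooth_immersion M A N B f \<and> embedding_map M N f"


section \<open>Tori\<close>

text \<open>
  The torus is the product of unit circles. Its charts are the local inverses of the covering
  \<open>t \<mapsto> (exp (2 \<pi> i t\<^sub>1), \<dots>, exp (2 \<pi> i t\<^sub>n))\<close>.
\<close>

definition torus :: "(complex ^ 'n) topology" where
  "torus = top_of_set {z. \<forall>i. z $ i \<in> sphere 0 1}"

definition torus_cover :: "real ^ 'n \<Rightarrow> complex ^ 'n" where
  "torus_cover t = (\<chi> i. cis (2 * pi * t $ i))"

definition torus_atlas :: "(complex ^ 'n, real ^ 'n) chart set" where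
  "torus_atlas =
     {(torus_cover ` V, inv_into V torus_cover) | V. open V \<and> inj_on torus_cover V}"

definition embedded_3_torus ::
  "'m topology \<Rightarrow> ('m, 'e::euclidean_space) chart set \<Rightarrow> 'm set \<Rightarrow> bool" where
  "embedded_3_torus M A S \<longleftrightarrow>
     (\<exists>j :: complex ^ 3 \<Rightarrow> 'm.
        smooth_embedding torus torus_atlas M A j \<and> j ` topspace torus = S)"


section \<open>Differential forms and symplectic forms\<close>

text \<open>
  A form is given by its coordinate expressions: \<open>\<alpha> c y v\<close> is the value, in the chart \<open>c\<close>, at the
  point with coordinates \<open>y\<close>, on the tangent vector with components \<open>v\<close>. The expressions in two
  charts are related by pull-back along the coordinate change.
\<close>

type_synonym ('m, 'e) form1 = "('m, 'e) chart \<Rightarrow> 'e \<Rightarrow> 'e \<Rightarrow> real"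
type_synonym ('m, 'e) form2 = "('m, 'e) chart \<Rightarrow> 'e \<Rightarrow> 'e \<Rightarrow> 'e \<Rightarrow> real"

definition one_form :: "('m, 'e::euclidean_space) chart set \<Rightarrow> ('m, 'e) form1 \<Rightarrow> bool" where
  "one_form A \<alpha> \<longleftrightarrow>
     (\<forall>c\<in>A. (\<forall>y\<in>cimg c. linear (\<alpha> c y)) \<and> (\<forall>v. smooth_on (cimg c) (\<lambda>y. \<alpha> c y v))) \<and>
     (\<forall>c\<in>A. \<forall>d\<in>A. \<forall>x \<in> cdom c \<inter> cdom d. \<forall>v.
        \<alpha> c (cmap c x) v =
        \<alpha> d (cmap d x) (frechet_derivative (in_charts c d id) (at (cmap c x)) v))"

definition two_form :: "('m, 'e::euclidean_space) chart set \<Rightarrow> ('m, 'e) form2 \<Rightarrow> bool" where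
  "two_form A \<omega> \<longleftrightarrow>
     (\<forall>c\<in>A. (\<forall>y\<in>cimg c. bilinear (\<omega> c y) \<and> (\<forall>u v. \<omega> c y u v = - \<omega> c y v u)) \<and>
        (\<forall>u v. smooth_on (cimg c) (\<lambda>y. \<omega> c y u v))) \<and>
     (\<forall>c\<in>A. \<forall>d\<in>A. \<forall>x \<in> cdom c \<inter> cdom d. \<forall>u v.
        \<omega> c (cmap c x) u v =
        \<omega> d (cmap d x) (frechet_derivative (in_charts c d id) (at (cmap c x)) u)
                       (frechet_derivative (in_charts c d id) (at (cmap c x)) v))"

text \<open>Exterior derivatives of a 1-form and of a 2-form, evaluated on constant vector fields in a
  chart (so that the Lie bracket terms vanish).\<close>

definition ext_deriv1 :: "('m, 'e::euclidean_space) form1 \<Rightarrow> ('m, 'e) form2" where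
  "ext_deriv1 \<alpha> c y u v =
     frechet_derivative (\<lambda>z. \<alpha> c z v) (at y) u - frechet_derivative (\<lambda>z. \<alpha> c z u) (at y) v"

definition ext_deriv2 ::
  "('m, 'e::euclidean_space) form2 \<Rightarrow> ('m, 'e) chart \<Rightarrow> 'e \<Rightarrow> 'e \<Rightarrow> 'e \<Rightarrow> 'e \<Rightarrow> real" where
  "ext_deriv2 \<omega> c y u v w =
     frechet_derivative (\<lambda>z. \<omega> c z v w) (at y) u
     - frechet_derivative (\<lambda>z. \<omega> c z u w) (at y) v
     + frechet_derivative (\<lambda>z. \<omega> c z u v) (at y) w"

definition symplectic_form :: "('m, 'e::euclidean_space) chart set \<Rightarrow> ('m, 'e) form2 \<Rightarrow> bool" where
  "symplectic_form A \<omega> \<longleftrightarrow>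
     two_form A \<omega> \<and>
     (\<forall>c\<in>A. \<forall>y\<in>cimg c. \<forall>u v w. ext_deriv2 \<omega> c y u v w = 0) \<and>
     (\<forall>c\<in>A. \<forall>y\<in>cimg c. \<forall>u. (\<forall>v. \<omega> c y u v = 0) \<longrightarrow> u = 0)"

definition primitive_of :: "('m, 'e::euclidean_space) chart set \<Rightarrow> ('m, 'e) form2 \<Rightarrow> ('m, 'e) form1 \<Rightarrow> bool" where
  "primitive_of A \<omega> \<alpha> \<longleftrightarrow>
     one_form A \<alpha> \<and> (\<forall>c\<in>A. \<forall>y\<in>cimg c. \<forall>u v. \<omega> c y u v = ext_deriv1 \<alpha> c y u v)"


section \<open>Tangent spaces of a submanifold and the characteristic foliation\<close>

definition velocity :: "('m, 'e::euclidean_space) chart \<Rightarrow> (real \<Rightarrow> 'm) \<Rightarrow> real \<Rightarrow> 'e" where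
  "velocity c \<gamma> t = vector_derivative (cmap c \<circ> \<gamma>) (at t)"

definition C1_curve_in ::
  "'m topology \<Rightarrow> ('m, 'e::euclidean_space) chart set \<Rightarrow> 'm set \<Rightarrow> (real \<Rightarrow> 'm) \<Rightarrow> bool" where
  "C1_curve_in M A S \<gamma> \<longleftrightarrow>
     continuous_map euclideanreal M \<gamma> \<and> range \<gamma> \<subseteq> S \<and>
     (\<forall>c\<in>A. (cmap c \<circ> \<gamma>) C1_differentiable_on {t. \<gamma> t \<in> cdom c})"

text \<open>
  \<open>tangent_space M A S c x\<close> is the tangent space at \<open>x\<close> of the submanifold \<open>S\<close> of \<open>M\<close>, that is, the
  set of velocities at \<open>x\<close> of the curves contained in \<open>S\<close>, expressed in a chart \<open>c\<close> around \<open>x\<close>.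
  Curves defined on the whole line suffice, by reparametrization.
\<close>

definition tangent_space ::
  "'m topology \<Rightarrow> ('m, 'e::euclidean_space) chart set \<Rightarrow> 'm set \<Rightarrow> ('m, 'e) chart \<Rightarrow> 'm \<Rightarrow> 'e set" where
  "tangent_space M A S c x = {velocity c \<gamma> 0 | \<gamma>. C1_curve_in M A S \<gamma> \<and> \<gamma> 0 = x}"

text \<open>The kernel of \<open>\<omega>\<close> restricted to the tangent space of \<open>S\<close> at \<open>x\<close>, again in a chart \<open>c\<close>
  around \<open>x\<close>.\<close>

definition char_kernel ::
  "'m topology \<Rightarrow> ('m, 'e::euclidean_space) chart set \<Rightarrow> ('m, 'e) form2 \<Rightarrow> 'm set \<Rightarrow>
   ('m, 'e) chart \<Rightarrow> 'm \<Rightarrow> 'e set" where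
  "char_kernel M A \<omega> S c x =
     {u \<in> tangent_space M A S c x. \<forall>v \<in> tangent_space M A S c x. \<omega> c (cmap c x) u v = 0}"

definition char_kernel_line_field ::
  "'m topology \<Rightarrow> ('m, 'e::euclidean_space) chart set \<Rightarrow> ('m, 'e) form2 \<Rightarrow> 'm set \<Rightarrow> bool" where
  "char_kernel_line_field M A \<omega> S \<longleftrightarrow>
     (\<forall>x\<in>S. \<forall>c\<in>A. x \<in> cdom c \<longrightarrow> dim (char_kernel M A \<omega> S c x) = 1)"

definition char_curve ::
  "'m topology \<Rightarrow> ('m, 'e::euclidean_space) chart set \<Rightarrow> ('m, 'e) form2 \<Rightarrow> 'm set \<Rightarrow>
   (real \<Rightarrow> 'm) \<Rightarrow> bool" where
  "char_curve M A \<omega> S \<gamma> \<longleftrightarrow>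
     C1_curve_in M A S \<gamma> \<and>
     (\<forall>t. \<forall>c\<in>A. \<gamma> t \<in> cdom c \<longrightarrow> velocity c \<gamma> t \<in> char_kernel M A \<omega> S c (\<gamma> t))"

text \<open>The leaf through \<open>x\<close> of the foliation tangent to a line field consists of the points that can
  be joined to \<open>x\<close> by a curve tangent to that line field.\<close>

definition char_leaf ::
  "'m topology \<Rightarrow> ('m, 'e::euclidean_space) chart set \<Rightarrow> ('m, 'e) form2 \<Rightarrow> 'm set \<Rightarrow> 'm \<Rightarrow> 'm set" where
  "char_leaf M A \<omega> S x = {\<gamma> 1 | \<gamma>. char_curve M A \<omega> S \<gamma> \<and> \<gamma> 0 = x}"


section \<open>Circle fibrations\<close>

text \<open>Only continuity is required: the base is any topological space and the local
  trivializations are homeomorphisms.\<close>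

definition circle_bundle :: "'m topology \<Rightarrow> 'b topology \<Rightarrow> ('m \<Rightarrow> 'b) \<Rightarrow> bool" where
  "circle_bundle X B p \<longleftrightarrow>
     continuous_map X B p \<and>
     (\<forall>b \<in> topspace B. \<exists>U h. openin B U \<and> b \<in> U \<and>
        homeomorphic_map (prod_topology (subtopology B U) (top_of_set (sphere (0::complex) 1)))
          (subtopology X {x \<in> topspace X. p x \<in> U}) h \<and>
        (\<forall>y\<in>U. \<forall>z\<in>sphere 0 1. p (h (y, z)) = y))"

definition bundle_fibers :: "'m topology \<Rightarrow> 'b topology \<Rightarrow> ('m \<Rightarrow> 'b) \<Rightarrow> 'm set set" where
  "bundle_fibers X B p = {{x \<in> topspace X. p x = b} | b. b \<in> topspace B}"

end

theory Submission
  imports Defs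
begin

text \<open>
  Pull the primitive of \<open>\<omega>\<close> back to the universal cover of the torus: this gives a periodic 1-form
  \<open>\<beta>\<close> on \<open>\<real>\<^sup>3\<close>, and the characteristic leaves are the orbits of \<open>X = curl \<beta>\<close>, a nowhere zero
  divergence-free field of mean zero. A fibration by circles bounds the periods of the orbits in the
  torus, so that every orbit in \<open>\<real>\<^sup>3\<close> has a rotation vector \<open>h / \<tau>\<close>, where \<open>h\<close> is the integral
  displacement after time \<open>\<tau>\<close>. The rotation vector depends continuously on the orbit, so it vanishes
  everywhere or nowhere, and in the second case its direction is constant, being a rational
  direction. The second case contradicts that \<open>X\<close> has mean zero and preserves volume. In the first
  case all orbits in \<open>\<real>\<^sup>3\<close> are closed and of bounded size; the coordinatewise suprema over the orbits
  then define a Lipschitz map that is constant on orbits, hence has a null image, but that stays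
  close to the identity, hence is onto.
\<close>

section \<open>Flows of Lipschitz vector fields\<close>

text \<open>Smooth dependence of the flow on its starting point is never established; only Lipschitz
  dependence and the error of one Euler step are. This shapes both cases. Volume preservation enters
  through the Euler map \<open>x + s *\<^sub>R X x\<close>: its Jacobian is
  \<open>1 + O(s^2)\<close> because the divergence vanishes, so it changes the integral of a bounded
  periodic function by \<open>O(s^2)\<close>, while a drifting coordinate gains an amount of order
  \<open>s\<close> per step. In the case of closed orbits the return time is an arbitrary choice,
  possibly discontinuous, because the bundle is merely topological. Suprema over whole orbits are
  insensitive to that choice, and being Lipschitz is all that is asked of a map to send null sets to
  null sets. Exactness enters through the mean value: \<open>\<alpha>\<close> is defined on all of
  \<open>M\<close>, so \<open>\<beta>\<close> is periodic, and the components of its curl are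
  differences of derivatives of periodic functions.\<close>

lemma integral_has_vector_derivative_halfline:
  fixes f :: "real \<Rightarrow> 'a::banach"
  assumes "continuous_on {0..} f" and "0 \<le> t"
  shows "((\<lambda>u. integral {0..u} f) has_vector_derivative f t) (at t within {0..})"
proof -
  have "((\<lambda>u. integral {0..u} f) has_vector_derivative f t) (at t within {0..t+1})"
    using assms by (intro integral_has_vector_derivative continuous_on_subset[OF assms(1)]) auto
  moreover have "at t within {0..} = at t within {0..t+1}"
    by (rule at_within_nhd[of t "{..<t+1}"]) auto
  ultimately show ?thesis by simp
qed

lemma continuous_on_integral_halfline:
  fixes f :: "real \<Rightarrow> 'a::banach"
  assumes "continuous_on {0..} f"
  shows "continuous_on {0..} (\<lambda>u. integral {0..u} f)"
  using integral_has_vector_derivative_halfline[OF assms]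
  by (auto intro!: has_vector_derivative_continuous simp: continuous_on_eq_continuous_within)

text \<open>Divided by the weight \<open>exp (2 * L * m)\<close>, the value stays below 1/2; this is
  the contraction constant of the Picard operator.\<close>

lemma has_integral_exp_weight:
  fixes L m :: real
  assumes "L > 0" "m \<ge> 0"
  shows "((\<lambda>s. L * exp (2 * L * s)) has_integral (exp (2 * L * m) - 1) / 2) {0..m}"
proof -
  have "((\<lambda>s. L * exp (2 * L * s)) has_integral exp (2 * L * m) / 2 - exp (2 * L * 0) / 2) {0..m}"
    using assms
    by (intro fundamental_theorem_of_calculus)
       (auto intro!: derivative_eq_intros simp: has_real_derivative_iff_has_vector_derivative[symmetric])
  then show ?thesis by (simp add: diff_divide_distrib)
qed

text \<open>The weight \<open>exp (- 2 L t)\<close> makes the Picard operator a contraction on the whole half-line.\<close>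

lemma lipschitz_ode_exists:
  fixes X :: "'a::euclidean_space \<Rightarrow> 'a"
  assumes lip: "L-lipschitz_on UNIV X" and bd: "\<And>x. norm (X x) \<le> B"
  shows "\<exists>u. u 0 = x \<and> (\<forall>t\<ge>0. (u has_vector_derivative X (u t)) (at t within {0..}))"
proof -
  \<comment> \<open>The weight needs a positive rate, also for a constant field with
    \<open>L = 0\<close>.\<close>
  define K where "K = max L 1"
  have K: "K > 0" and lipK: "K-lipschitz_on UNIV X"
    using lip by (auto simp: K_def intro: lipschitz_on_mono)
  have contX: "continuous_on S X" for S
    using lipschitz_on_continuous_on[OF lip] continuous_on_subset by blast
  have B0: "B \<ge> 0" using bd[of 0] norm_ge_zero order_trans by blast
  define I where "I v s = X (x + exp (2 * K * s) *\<^sub>R apply_bcontfun v s)" for v :: "real \<Rightarrow>\<^sub>C 'a" and s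
  have contI: "continuous_on S (I v)" for S v
    unfolding I_def by (intro continuous_intros continuous_on_compose2[OF contX]) auto
  \<comment> \<open>The unknown \<open>v\<close> stands for \<open>exp (- 2 K t) (u t - x)\<close>,
    and \<open>P\<close> is the Picard operator in this variable. Bounded continuous functions live
    on the whole line, so negative times are given the value at 0.\<close>
  define P where "P v t = (let m = max 0 t in exp (- (2 * K * m)) *\<^sub>R integral {0..m} (I v))"
    for v :: "real \<Rightarrow>\<^sub>C 'a" and t
  have contP: "continuous_on UNIV (P v)" for v
    unfolding P_def Let_def
    by (intro continuous_intros continuous_on_compose2[OF continuous_on_integral_halfline[OF contI]]) auto
  have bdP: "norm (P v t) \<le> B / (2 * K)" for v t
  proof -
    define m where "m = max 0 t"
    have "norm (integral {0..m} (I v)) \<le> integral {0..m} (\<lambda>s. B)"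
      by (intro integral_norm_bound_integral integrable_continuous_real contI) (auto simp: I_def bd)
    then have "norm (integral {0..m} (I v)) \<le> B * m" by (simp add: m_def mult.commute)
    moreover have "2 * K * m \<le> exp (2 * K * m)" using exp_ge_add_one_self[of "2*K*m"] by linarith
    ultimately have "2 * K * norm (integral {0..m} (I v)) \<le> B * exp (2 * K * m)"
      using K B0 by (smt (verit) mult.assoc mult.left_commute mult_left_mono)
    then have "norm (integral {0..m} (I v)) \<le> B / (2*K) * exp (2 * K * m)"
      using K by (simp add: field_simps)
    moreover have "norm (P v t) = norm (integral {0..m} (I v)) / exp (2 * K * m)"
      by (simp add: P_def Let_def m_def exp_minus divide_inverse mult.commute)
    ultimately show ?thesis
      by (simp add: pos_divide_le_eq)
  qed
  have Pb: "P v \<in> bcontfun" for v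
    by (rule bcontfun_normI[OF contP bdP])
  define Q where "Q v = Bcontfun (P v)" for v
  have Q: "apply_bcontfun (Q v) t = P v t" for v t
    using Pb by (simp add: Q_def Bcontfun_inverse)
  have "dist (Q v) (Q w) \<le> (1/2) * dist v w" for v w
  proof (rule dist_bound)
    fix t :: real
    define m where "m = max 0 t"
    define d where "d = dist v w"
    have m0: "m \<ge> 0" by (simp add: m_def)
    have pw: "norm (I v s - I w s) \<le> (K * exp (2 * K * s)) * d" for s
    proof -
      have "norm (I v s - I w s) \<le> K * dist (x + exp (2 * K * s) *\<^sub>R apply_bcontfun v s) (x + exp (2 * K * s) *\<^sub>R apply_bcontfun w s)"
        unfolding I_def dist_norm[symmetric] by (rule lipschitz_onD[OF lipK]) auto
      also have "\<dots> = K * (exp (2 * K * s) * dist (apply_bcontfun v s) (apply_bcontfun w s))"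
        by (simp add: dist_norm scaleR_diff_right[symmetric])
      also have "\<dots> \<le> K * (exp (2 * K * s) * d)"
        using K dist_bounded[of v s w] by (simp add: d_def)
      finally show ?thesis by (simp add: mult.assoc)
    qed
    have hi: "((\<lambda>s. (K * exp (2 * K * s)) * d) has_integral (exp (2 * K * m) - 1) / 2 * d) {0..m}"
      by (rule has_integral_mult_left[OF has_integral_exp_weight[OF K m0]])
    have "norm (integral {0..m} (\<lambda>s. I v s - I w s)) \<le> integral {0..m} (\<lambda>s. (K * exp (2 * K * s)) * d)"
      using hi by (intro integral_norm_bound_integral integrable_continuous_real continuous_intros contI pw)
    also have "\<dots> = (exp (2 * K * m) - 1) / 2 * d" using hi by (rule integral_unique)
    also have "\<dots> \<le> exp (2 * K * m) / 2 * d"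
      by (intro mult_right_mono) (auto simp: d_def)
    finally have "norm (integral {0..m} (I v) - integral {0..m} (I w)) \<le> exp (2 * K * m) / 2 * d"
      by (subst integral_diff[symmetric]) (auto intro!: integrable_continuous_real contI)
    moreover have "exp (2 * K * m) * dist (Q v t) (Q w t) = norm (integral {0..m} (I v) - integral {0..m} (I w))"
      by (simp add: Q P_def Let_def m_def dist_norm scaleR_diff_right[symmetric] exp_minus)
    ultimately have "exp (2 * K * m) * dist (Q v t) (Q w t) \<le> exp (2 * K * m) * ((1/2) * d)"
      by simp
    then show "dist (Q v t) (Q w t) \<le> (1/2) * dist v w"
      by (subst (asm) mult_le_cancel_left_pos) (auto simp: d_def)
  qed
  then obtain v where v: "Q v = v"
    using banach_fix_type[of "1/2" Q] by auto
  define u where "u t = x + integral {0..t} (I v)" for t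
  have ut: "u t = x + exp (2 * K * t) *\<^sub>R apply_bcontfun v t" if "t \<ge> 0" for t
  proof -
    have "apply_bcontfun v t = exp (- (2 * K * t)) *\<^sub>R integral {0..t} (I v)"
      using Q[of v t] that by (simp add: v P_def)
    then show ?thesis by (simp add: u_def exp_minus)
  qed
  have "(u has_vector_derivative X (u t)) (at t within {0..})" if "t \<ge> 0" for t
  proof -
    have "(u has_vector_derivative I v t) (at t within {0..})"
      unfolding u_def
      using integral_has_vector_derivative_halfline[OF contI that, of v]
      by (auto intro!: derivative_eq_intros)
    then show ?thesis using ut[OF that] by (simp add: I_def)
  qed
  moreover have "u 0 = x" by (simp add: u_def)
  ultimately show ?thesis by blast
qed

text \<open>The square of the distance, weighted by \<open>exp (- 2 L t)\<close>, is nonincreasing: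
  by Cauchy-Schwarz and the Lipschitz condition its derivative is at most 0. Squaring avoids
  differentiating the norm where it vanishes.\<close>

lemma ode_gronwall:
  fixes X :: "'a::euclidean_space \<Rightarrow> 'a"
  assumes lip: "L-lipschitz_on UNIV X"
    and u: "\<And>t. t \<ge> 0 \<Longrightarrow> (u has_vector_derivative X (u t)) (at t within {0..})"
    and v: "\<And>t. t \<ge> 0 \<Longrightarrow> (v has_vector_derivative X (v t)) (at t within {0..})"
    and t: "t \<ge> 0"
  shows "norm (u t - v t) \<le> exp (L * t) * norm (u 0 - v 0)"
proof -
  define f where "f s = exp (- (2 * L * s)) * ((u s - v s) \<bullet> (u s - v s))" for s
  define f' where "f' s = exp (- (2 * L * s)) * (2 * ((u s - v s) \<bullet> (X (u s) - X (v s))) - 2 * L * ((u s - v s) \<bullet> (u s - v s)))" for s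
  have der: "(f has_real_derivative f' s) (at s within {0..t})" if "s \<in> {0..t}" for s
  proof -
    have "((\<lambda>s. u s - v s) has_vector_derivative X (u s) - X (v s)) (at s within {0..t})"
      using that by (intro has_vector_derivative_diff has_vector_derivative_within_subset[OF u]
         has_vector_derivative_within_subset[OF v]) auto
    then have d: "((\<lambda>s. u s - v s) has_derivative (\<lambda>h. h *\<^sub>R (X (u s) - X (v s)))) (at s within {0..t})"
      by (simp add: has_vector_derivative_def)
    have e: "((\<lambda>s. exp (- (2 * L * s))) has_derivative (\<lambda>h. h * (- 2 * L * exp (- (2 * L * s))))) (at s within {0..t})"
      by (auto intro!: derivative_eq_intros)
    have "(f has_derivative (\<lambda>h. h * f' s)) (at s within {0..t})"
      unfolding f_def
      by (rule has_derivative_eq_rhs[OF has_derivative_mult[OF e has_derivative_inner[OF d d]]])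
         (auto simp: f'_def algebra_simps inner_commute fun_eq_iff)
    then show ?thesis by (simp add: has_field_derivative_def mult_commute_abs)
  qed
  have neg: "f' s \<le> 0" for s
  proof -
    have "(u s - v s) \<bullet> (X (u s) - X (v s)) \<le> norm (u s - v s) * norm (X (u s) - X (v s))"
      by (rule norm_cauchy_schwarz)
    also have "\<dots> \<le> norm (u s - v s) * (L * norm (u s - v s))"
      using lip by (intro mult_left_mono) (auto simp: lipschitz_on_def dist_norm)
    also have "\<dots> = L * ((u s - v s) \<bullet> (u s - v s))" by (simp add: dot_square_norm power2_eq_square)
    finally show ?thesis by (simp add: f'_def mult_le_0_iff)
  qed
  have "f t \<le> f 0"
  proof (rule DERIV_nonpos_imp_decreasing_open[where f=f and a=0 and b=t])
    show "\<And>x. 0 < x \<Longrightarrow> x < t \<Longrightarrow> \<exists>y. (f has_real_derivative y) (at x) \<and> y \<le> 0"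
      by (metis at_within_Icc_at atLeastAtMost_iff der less_eq_real_def neg)
    show "continuous_on {0..t} f"
      using der by (meson DERIV_continuous_on)
  qed (use t in auto)
  then have "norm (u t - v t) ^ 2 \<le> exp (2 * L * t) * norm (u 0 - v 0) ^ 2"
    by (simp add: f_def dot_square_norm exp_minus divide_simps mult.commute)
  also have "\<dots> = (exp (L * t) * norm (u 0 - v 0)) ^ 2"
    by (simp add: power_mult_distrib exp_double[symmetric] mult.assoc)
  finally show ?thesis by (rule power2_le_imp_le) simp
qed

section \<open>Semigroup property and growth estimates of a forward flow\<close>

locale forward_flow =
  fixes X :: "'a::euclidean_space \<Rightarrow> 'a" and L B :: real and \<phi> :: "real \<Rightarrow> 'a \<Rightarrow> 'a"
  assumes lip: "L-lipschitz_on UNIV X" and bd: "\<And>x. norm (X x) \<le> B"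
    and flow_0 [simp]: "\<And>x. \<phi> 0 x = x"
    and flow_deriv: "\<And>x t. t \<ge> 0 \<Longrightarrow> ((\<lambda>s. \<phi> s x) has_vector_derivative X (\<phi> t x)) (at t within {0..})"
begin

lemma B_nonneg: "B \<ge> 0"
  using bd[of 0] norm_ge_zero order_trans by blast

lemma L_nonneg: "L \<ge> 0"
  using lip by (simp add: lipschitz_on_def)

lemma continuous_on_X [continuous_intros]: "continuous_on S X"
  using lipschitz_on_continuous_on[OF lip] continuous_on_subset by blast

lemma lip_X: "norm (X x - X y) \<le> L * norm (x - y)"
  using lip by (auto simp: lipschitz_on_def dist_norm)

lemma flow_lipschitz: "t \<ge> 0 \<Longrightarrow> norm (\<phi> t x - \<phi> t y) \<le> exp (L * t) * norm (x - y)"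
  using ode_gronwall[OF lip flow_deriv flow_deriv, of t x y] by simp

lemma flow_unique:
  assumes "\<And>t. t \<ge> 0 \<Longrightarrow> (u has_vector_derivative X (u t)) (at t within {0..})" "u 0 = x" "t \<ge> 0"
  shows "u t = \<phi> t x"
  using ode_gronwall[OF lip assms(1) flow_deriv, of t x] assms(2,3) by simp

lemma flow_add:
  assumes "s \<ge> 0" "t \<ge> 0"
  shows "\<phi> (s + t) x = \<phi> s (\<phi> t x)"
proof -
  have "((\<lambda>s. \<phi> (s + t) x) has_vector_derivative X (\<phi> (s + t) x)) (at s within {0..})" if "s \<ge> 0" for s
  proof -
    have "((\<lambda>s. \<phi> s x) has_vector_derivative X (\<phi> (s + t) x)) (at (s + t) within (\<lambda>s. s + t) ` {0..})"
      using that assms by (intro has_vector_derivative_within_subset[OF flow_deriv]) auto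
    moreover have "((\<lambda>s. s + t) has_vector_derivative 1) (at s within {0..})"
      by (auto intro!: derivative_eq_intros)
    ultimately show ?thesis
      using vector_diff_chain_within[of "\<lambda>s. s + t" 1 s "{0..}" "\<lambda>s. \<phi> s x" "X (\<phi> (s + t) x)"]
      by (simp add: o_def)
  qed
  from flow_unique[of "\<lambda>s. \<phi> (s + t) x", OF this _ assms(1)] show ?thesis by simp
qed

lemma flow_translate:
  assumes "\<And>x. X (x + n) = X x" "t \<ge> 0"
  shows "\<phi> t (x + n) = \<phi> t x + n"
proof -
  have "((\<lambda>t. \<phi> t x + n) has_vector_derivative X (\<phi> t x + n)) (at t within {0..})" if "t \<ge> 0" for t
    using flow_deriv[OF that, of x] assms(1) by (auto intro!: derivative_eq_intros)
  from flow_unique[of "\<lambda>t. \<phi> t x + n", OF this _ assms(2)] show ?thesis by simp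
qed

lemma flow_deriv_within:
  "S \<subseteq> {0..} \<Longrightarrow> t \<ge> 0 \<Longrightarrow> ((\<lambda>s. \<phi> s x) has_derivative (\<lambda>h. h *\<^sub>R X (\<phi> t x))) (at t within S)"
  using has_vector_derivative_within_subset[OF flow_deriv] by (simp add: has_vector_derivative_def)

lemma flow_speed:
  assumes "s \<ge> 0" "t \<ge> 0"
  shows "norm (\<phi> t x - \<phi> s x) \<le> B * \<bar>t - s\<bar>"
proof -
  have "norm (\<phi> t x - \<phi> s x) \<le> B * norm (t - s)"
  proof (rule differentiable_bound[of "{0..}"])
    show "onorm (\<lambda>h. h *\<^sub>R X (\<phi> r x)) \<le> B" for r
      by (rule onorm_bound) (auto simp: B_nonneg bd mult_right_mono mult.commute[of "\<bar>_\<bar>"])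
  qed (use assms in \<open>auto intro: flow_deriv_within\<close>)
  then show ?thesis by simp
qed

lemma flow_dist: "t \<ge> 0 \<Longrightarrow> norm (\<phi> t x - x) \<le> B * t"
  using flow_speed[of 0 t x] by simp

text \<open>After time \<open>s\<close> the orbit has moved by at most \<open>B * s\<close>, so its
  velocity differs from the initial one by at most \<open>L * B * s\<close>; bounding this by its
  value at \<open>t\<close> and applying the mean value inequality costs only a factor 2.\<close>

lemma flow_euler:
  assumes "t \<ge> 0"
  shows "norm (\<phi> t x - x - t *\<^sub>R X x) \<le> L * B * t^2"
proof -
  define f where "f s = \<phi> s x - s *\<^sub>R X x" for s
  have "norm (f t - f 0) \<le> (L * B * t) * norm (t - 0)"
  proof (rule differentiable_bound[of "{0..t}"])
    fix s assume s: "s \<in> {0..t}"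
    show "(f has_derivative (\<lambda>h. h *\<^sub>R (X (\<phi> s x) - X x))) (at s within {0..t})"
      unfolding f_def using s
      by (auto intro!: derivative_eq_intros flow_deriv_within simp: algebra_simps)
    have "norm (X (\<phi> s x) - X x) \<le> L * (B * s)"
      using s by (intro order_trans[OF lip_X] mult_left_mono flow_dist L_nonneg) auto
    also have "\<dots> \<le> L * (B * t)"
      using s by (intro mult_left_mono L_nonneg B_nonneg) auto
    finally show "onorm (\<lambda>h. h *\<^sub>R (X (\<phi> s x) - X x)) \<le> L * B * t"
      using assms mult_right_mono[of "norm (X (\<phi> s x) - X x)" "L * B * t"]
      by (intro onorm_bound) (auto simp: L_nonneg B_nonneg mult.assoc mult.commute[of "\<bar>_\<bar>"])
  qed (use assms in auto)
  then show ?thesis using assms by (simp add: f_def power2_eq_square mult.assoc algebra_simps)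
qed

lemma continuous_on_flow:
  assumes "continuous_on S f" "continuous_on S g" "\<And>z. z \<in> S \<Longrightarrow> f z \<ge> (0::real)"
  shows "continuous_on S (\<lambda>z. \<phi> (f z) (g z))"
  unfolding continuous_on_def
proof
  fix z assume z: "z \<in> S"
  have f: "(f \<longlongrightarrow> f z) (at z within S)" and g: "(g \<longlongrightarrow> g z) (at z within S)"
    using assms z by (auto simp: continuous_on_def)
  have "((\<lambda>w. exp (L * f w) * norm (g w - g z) + B * \<bar>f w - f z\<bar>) \<longlongrightarrow> exp (L * f z) * norm (g z - g z) + B * \<bar>f z - f z\<bar>) (at z within S)"
    by (intro tendsto_intros f g)
  then have lim: "((\<lambda>w. exp (L * f w) * norm (g w - g z) + B * \<bar>f w - f z\<bar>) \<longlongrightarrow> 0) (at z within S)"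
    by simp
  have "norm (\<phi> (f w) (g w) - \<phi> (f z) (g z)) \<le> exp (L * f w) * norm (g w - g z) + B * \<bar>f w - f z\<bar>"
    if "w \<in> S" for w
  proof -
    have "norm (\<phi> (f w) (g w) - \<phi> (f z) (g z)) \<le> norm (\<phi> (f w) (g w) - \<phi> (f w) (g z)) + norm (\<phi> (f w) (g z) - \<phi> (f z) (g z))"
      by norm
    also have "\<dots> \<le> exp (L * f w) * norm (g w - g z) + B * \<bar>f w - f z\<bar>"
      using assms(3) that z by (intro add_mono flow_lipschitz flow_speed) auto
    finally show ?thesis .
  qed
  then have "((\<lambda>w. \<phi> (f w) (g w) - \<phi> (f z) (g z)) \<longlongrightarrow> 0) (at z within S)"
    by (intro Lim_null_comparison[OF _ lim]) (auto simp: eventually_at_filter)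
  then show "((\<lambda>w. \<phi> (f w) (g w)) \<longlongrightarrow> \<phi> (f z) (g z)) (at z within S)"
    by (simp add: LIM_zero_iff)
qed

end

section \<open>Periodic flows with bounded periods\<close>

definition int_vecs :: "(real ^ 'n) set" where
  "int_vecs = {n. \<forall>i. n $ i \<in> \<int>}"

lemma int_vecs_minus: "m \<in> int_vecs \<Longrightarrow> - m \<in> int_vecs"
  and int_vecs_scale: "m \<in> int_vecs \<Longrightarrow> of_nat k *\<^sub>R m \<in> int_vecs"
  by (auto simp: int_vecs_def)

lemma int_vecs_axis [simp]: "axis i 1 \<in> int_vecs"
  by (auto simp: int_vecs_def axis_def)

lemma int_vecs_small:
  assumes "n \<in> int_vecs" "norm n < 1"
  shows "n = 0"
proof -
  have "n $ i = 0" for i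
  proof -
    have "\<bar>n $ i\<bar> < 1" using component_le_norm_cart[of n i] assms(2) by linarith
    moreover have "n $ i \<in> \<int>" using assms(1) by (simp add: int_vecs_def)
    ultimately show ?thesis by (simp add: Ints_eq_abs_less1[of "n $ i" 0])
  qed
  then show ?thesis by (simp add: vec_eq_iff)
qed

lemma countable_int_vecs: "countable (int_vecs :: (real ^ 'n) set)"
  unfolding int_vecs_def by (rule countable_vector) (simp add: Ints_def)

lemma reduce_to_cube:
  fixes x :: "real ^ 'n"
  obtains n where "n \<in> int_vecs" "\<And>i. 0 \<le> (x - n) $ i" "\<And>i. (x - n) $ i < 1"
proof -
  let ?n = "(\<chi> i. of_int \<lfloor>x $ i\<rfloor>) :: real ^ 'n"
  have "?n \<in> int_vecs" by (simp add: int_vecs_def)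
  moreover have "0 \<le> (x - ?n) $ i" "(x - ?n) $ i < 1" for i
    using of_int_floor_le[of "x $ i"] floor_less_iff[of "x$i"] by (simp_all, linarith)
  ultimately show ?thesis using that by blast
qed

lemma reduce_to_cbox:
  fixes x :: "real ^ 'n"
  obtains n where "n \<in> int_vecs" "x - n \<in> cbox 0 1"
proof -
  obtain n where "n \<in> int_vecs" "\<And>i. 0 \<le> (x - n) $ i" "\<And>i. (x - n) $ i < 1"
    using reduce_to_cube by blast
  then show ?thesis
    by (intro that[of n]) (auto simp: mem_box_cart less_imp_le)
qed

definition periodic :: "(real ^ 'n \<Rightarrow> 'b) \<Rightarrow> bool" where
  "periodic f \<longleftrightarrow> (\<forall>x. \<forall>n\<in>int_vecs. f (x + n) = f x)"

lemma periodic_cbox: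
  assumes "periodic f"
  obtains y where "y \<in> cbox 0 1" "f x = f y"
proof -
  obtain n where n: "n \<in> int_vecs" "x - n \<in> cbox 0 1" using reduce_to_cbox by blast
  then have "f (x - n + n) = f (x - n)" using assms unfolding periodic_def by blast
  then show ?thesis using n that by simp
qed

lemma periodic_positive_bound:
  fixes f :: "real ^ 'n \<Rightarrow> real"
  assumes "periodic f" "continuous_on UNIV f" "\<And>x. f x > 0"
  obtains c where "c > 0" "\<And>x. c \<le> f x"
proof -
  have "cbox 0 (1::real^'n) \<noteq> {}" by (simp add: interval_ne_empty_cart)
  then obtain m where m: "\<And>y. y \<in> cbox 0 1 \<Longrightarrow> f m \<le> f y"
    using continuous_attains_inf[of "cbox 0 (1::real^'n)" f] continuous_on_subset[OF assms(2)] by auto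
  have "f m \<le> f x" for x
    using periodic_cbox[OF assms(1), of x] m by metis
  then show ?thesis using that assms(3) by blast
qed

lemma periodic_bounded:
  fixes f :: "real ^ 'n \<Rightarrow> 'b::real_normed_vector"
  assumes "periodic f" "continuous_on UNIV f"
  obtains C where "C > 0" "\<And>x. norm (f x) \<le> C"
proof -
  have "bounded (f ` cbox 0 1)"
    using assms(2) continuous_on_subset by (intro compact_imp_bounded compact_continuous_image) auto
  then obtain C where "C > 0" "\<And>y. y \<in> cbox 0 1 \<Longrightarrow> norm (f y) \<le> C"
    by (auto simp: bounded_pos)
  then show ?thesis using that periodic_cbox[OF assms(1)] by metis
qed

lemma torus_cover_eq_iff: "torus_cover x = torus_cover y \<longleftrightarrow> x - y \<in> int_vecs"
proof -
  have "cis (2 * pi * a) = cis (2 * pi * b) \<longleftrightarrow> a - b \<in> \<int>" for a b :: real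
  proof -
    have "cis (2 * pi * a) = cis (2 * pi * b) \<longleftrightarrow> (\<exists>n::int. 2 * pi * a = 2 * pi * b + 2 * pi * of_int n)"
      by (auto simp: complex_eq_iff sin_cos_eq_iff[symmetric])
    also have "\<dots> \<longleftrightarrow> (\<exists>n::int. 2 * pi * a = 2 * pi * (b + of_int n))"
      by (simp add: algebra_simps)
    also have "\<dots> \<longleftrightarrow> (\<exists>n::int. a = b + of_int n)" by simp
    also have "\<dots> \<longleftrightarrow> a - b \<in> \<int>"
      by (auto simp: Ints_def algebra_simps)
    finally show ?thesis .
  qed
  then show ?thesis by (simp add: torus_cover_def vec_eq_iff int_vecs_def)
qed

lemma continuous_on_torus_cover [continuous_intros]:
  "continuous_on S f \<Longrightarrow> continuous_on S (\<lambda>x. torus_cover (f x))"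
  unfolding torus_cover_def by (intro continuous_intros)

lemma torus_cover_add: "n \<in> int_vecs \<Longrightarrow> torus_cover (x + n) = torus_cover x"
  by (simp add: torus_cover_eq_iff)

section \<open>Return times of a nowhere zero periodic field\<close>

locale periodic_flow = forward_flow X L B \<phi>
  for X :: "real ^ 'n \<Rightarrow> real ^ 'n" and L B \<phi> +
  assumes X_periodic: "periodic X" and X_nz: "\<And>x. X x \<noteq> 0"
begin

lemma X_add: "n \<in> int_vecs \<Longrightarrow> X (x + n) = X x"
  using X_periodic by (simp add: periodic_def)

lemma flow_int: "n \<in> int_vecs \<Longrightarrow> t \<ge> 0 \<Longrightarrow> \<phi> t (x + n) = \<phi> t x + n"
  by (rule flow_translate[OF X_add])

text \<open>In a short time the displacement is shorter than 1, so an integral displacement must be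
  0; but it is close to \<open>s *\<^sub>R X x\<close>, and \<open>X\<close> is bounded away from 0
  by compactness of the torus.\<close>

lemma no_short_period:
  obtains \<epsilon> where "\<epsilon> > 0" "\<And>x s. 0 < s \<Longrightarrow> s \<le> \<epsilon> \<Longrightarrow> \<phi> s x - x \<notin> int_vecs"
proof -
  have "periodic (\<lambda>x. norm (X x))" by (simp add: periodic_def X_add)
  then obtain c where c: "c > 0" "\<And>x. c \<le> norm (X x)"
    using periodic_positive_bound[of "\<lambda>x. norm (X x)"] X_nz by (auto intro: continuous_intros)
  \<comment> \<open>The second bound keeps \<open>B * s\<close> below 1, the first keeps the Euler
    error \<open>L * B * s\<close> per unit time below the minimal speed \<open>c\<close>.\<close>
  define \<epsilon> where "\<epsilon> = min (c / (2 * (L * B + 1))) (1 / (2 * (B + 1)))"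
  have LB: "L * B \<ge> 0" using L_nonneg B_nonneg by simp
  have \<epsilon>: "\<epsilon> > 0" using c LB B_nonneg by (simp add: \<epsilon>_def add_nonneg_pos)
  have "\<phi> s x - x \<notin> int_vecs" if s: "0 < s" "s \<le> \<epsilon>" for x s
  proof
    assume n: "\<phi> s x - x \<in> int_vecs"
    have "s \<le> 1 / (2 * (B + 1))" using s by (simp add: \<epsilon>_def)
    then have "2 * (B * s) + 2 * s \<le> 1" using B_nonneg by (simp add: field_simps)
    then have "norm (\<phi> s x - x) < 1" using flow_dist[of s x] s by linarith
    with n have "\<phi> s x - x = 0" by (rule int_vecs_small)
    then have "s * norm (X x) \<le> s * (L * B * s)"
      using flow_euler[of s x] s by (simp add: power2_eq_square mult.assoc mult.left_commute)
    then have "norm (X x) \<le> L * B * s" by (rule mult_left_le_imp_le) (fact s(1))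
    moreover have "s \<le> c / (2 * (L * B + 1))" using s by (simp add: \<epsilon>_def)
    then have "2 * (L * B * s) + 2 * s \<le> c" using LB by (simp add: field_simps)
    ultimately show False using c(1) c(2)[of x] s by linarith
  qed
  then show ?thesis using that \<epsilon> by blast
qed

text \<open>Compactness turns the absence of a return after time \<open>s\<close> into a uniform
  gap. The gap is measured in the torus because a convergent fibre angle would make the images of
  the orbit there converge.\<close>

lemma flow_separation:
  assumes "\<And>x. \<phi> s x - x \<notin> int_vecs" "s \<ge> 0"
  obtains \<delta> where "\<delta> > 0" "\<And>x. dist (torus_cover (\<phi> s x)) (torus_cover x) \<ge> \<delta>"
proof (rule periodic_positive_bound[of "\<lambda>x. dist (torus_cover (\<phi> s x)) (torus_cover x)"])
  show "periodic (\<lambda>x. dist (torus_cover (\<phi> s x)) (torus_cover x))"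
    using assms by (simp add: periodic_def flow_int torus_cover_add)
  show "continuous_on UNIV (\<lambda>x. dist (torus_cover (\<phi> s x)) (torus_cover x))"
    using assms by (intro continuous_intros continuous_on_flow) auto
qed (use assms that in \<open>auto simp: torus_cover_eq_iff\<close>)

text \<open>In a local trivialization by circles, the angle along an orbit is monotone. It cannot
  converge, since the orbit does not slow down; hence it gains more than \<open>2 \<pi>\<close> in finite time, and
  so does the angle along the neighbouring orbits, which therefore close up.\<close>

lemma locally_bounded_period:
  fixes z :: "real ^ 'n \<Rightarrow> complex" and k :: "complex \<Rightarrow> complex ^ 'n"
  assumes V: "open V" "x0 \<in> V" and inv: "\<And>x t. x \<in> V \<Longrightarrow> t \<ge> 0 \<Longrightarrow> \<phi> t x \<in> V"
    and z: "continuous_on V z" "\<And>x. x \<in> V \<Longrightarrow> norm (z x) = 1"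
    and inj: "\<And>x s t. x \<in> V \<Longrightarrow> s \<ge> 0 \<Longrightarrow> t \<ge> 0 \<Longrightarrow> z (\<phi> s x) = z (\<phi> t x) \<Longrightarrow> \<phi> s x - \<phi> t x \<in> int_vecs"
    and k: "continuous_on (sphere 0 1) k" "\<And>t. t \<ge> 0 \<Longrightarrow> k (z (\<phi> t x0)) = torus_cover (\<phi> t x0)"
  obtains r K where "r > 0" "K > 0" "\<And>x. x \<in> ball x0 r \<Longrightarrow> \<exists>t\<in>{0<..K}. \<phi> t x - x \<in> int_vecs"
proof -
  obtain \<epsilon> where \<epsilon>: "\<epsilon> > 0" "\<And>x s. 0 < s \<Longrightarrow> s \<le> \<epsilon> \<Longrightarrow> \<phi> s x - x \<notin> int_vecs"
    using no_short_period by blast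
  obtain r0 where r0: "r0 > 0" "ball x0 r0 \<subseteq> V"
    using V open_contains_ball by blast
  \<comment> \<open>Times and starting points together form a convex set, so a single continuous
    logarithm serves all orbits starting in the ball, and the angle depends continuously on both
    variables.\<close>
  define D where "D = {0::real..} \<times> ball x0 r0"
  have "continuous_on D (\<lambda>p. z (\<phi> (fst p) (snd p)))"
    using r0 inv by (intro continuous_on_compose2[OF z(1)] continuous_on_flow continuous_intros) (auto simp: D_def)
  moreover have "contractible D"
    unfolding D_def by (intro convex_imp_contractible convex_Times) auto
  moreover have nz: "norm (z (\<phi> (fst p) (snd p))) = 1" if "p \<in> D" for p
    using that r0 inv by (intro z(2)) (auto simp: D_def)
  then have "z (\<phi> (fst p) (snd p)) \<noteq> 0" if "p \<in> D" for p
    using nz[OF that] by (metis norm_zero zero_neq_one)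
  ultimately obtain g where g: "continuous_on D g" "\<And>p. p \<in> D \<Longrightarrow> z (\<phi> (fst p) (snd p)) = exp (g p)"
    using continuous_logarithm_on_contractible[of D "\<lambda>p. z (\<phi> (fst p) (snd p))"] by blast
  define \<theta> where "\<theta> t x = Im (g (t, x))" for t x
  have z\<theta>: "z (\<phi> t x) = cis (\<theta> t x)" if "t \<ge> 0" "x \<in> ball x0 r0" for t x
  proof -
    have D: "(t, x) \<in> D" using that by (simp add: D_def)
    then have "norm (exp (g (t, x))) = 1" using nz[OF D] g(2)[OF D] by simp
    then have "Re (g (t, x)) = 0" by (simp add: norm_exp_eq_Re)
    then have "g (t, x) = \<i> * of_real (\<theta> t x)" by (simp add: \<theta>_def complex_eq_iff)
    then show ?thesis using g(2)[OF D] by (simp add: cis_conv_exp)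
  qed
  have cont\<theta>: "continuous_on S (\<lambda>w. \<theta> (f w) (h w))"
    if "continuous_on S f" "continuous_on S h" "\<And>w. w \<in> S \<Longrightarrow> f w \<ge> 0" "\<And>w. w \<in> S \<Longrightarrow> h w \<in> ball x0 r0"
    for S :: "'c::topological_space set" and f h
    unfolding \<theta>_def using that
    by (intro continuous_intros continuous_on_compose2[OF g(1)]) (auto simp: D_def)
  \<comment> \<open>Two consecutive steps span an interval of length \<open>\<epsilon>\<close>, on
    which the angle is injective and hence monotone. Successive intervals share a step, so the
    direction of motion is passed on from one to the next.\<close>
  define e where "e = \<epsilon> / 2"
  have e: "e > 0" using \<epsilon> by (simp add: e_def)
  define a where "a n = \<theta> (of_nat n * e) x0" for n :: nat
  have x0: "x0 \<in> ball x0 r0" using r0 by simp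
  have inj\<theta>: "inj_on (\<lambda>t. \<theta> t x0) {b..b + \<epsilon>}" if "b \<ge> 0" for b
  proof (rule linorder_inj_onI')
    fix s t assume st: "s \<in> {b..b + \<epsilon>}" "t \<in> {b..b + \<epsilon>}" "s < t"
    show "\<theta> s x0 \<noteq> \<theta> t x0"
    proof
      assume "\<theta> s x0 = \<theta> t x0"
      then have "\<phi> t x0 - \<phi> s x0 \<in> int_vecs"
        using st that V x0 by (intro inj) (auto simp: z\<theta>)
      moreover have "\<phi> t x0 = \<phi> (t - s) (\<phi> s x0)"
        using st that by (subst flow_add[symmetric]) auto
      ultimately show False using \<epsilon>(2)[of "t - s" "\<phi> s x0"] st by auto
    qed
  qed
  have step: "(a n < a (Suc n) \<and> a (Suc n) < a (Suc (Suc n))) \<or> (a (Suc (Suc n)) < a (Suc n) \<and> a (Suc n) < a n)" for n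
    unfolding a_def
  proof (rule continuous_inj_imp_mono[where f="\<lambda>t. \<theta> t x0"])
    have eq: "of_nat (Suc (Suc n)) * e = of_nat n * e + \<epsilon>" by (simp add: e_def algebra_simps)
    show "continuous_on {of_nat n * e..of_nat (Suc (Suc n)) * e} (\<lambda>t. \<theta> t x0)"
      using x0 e by (intro cont\<theta> continuous_intros) (auto intro: order_trans[rotated])
    show "inj_on (\<lambda>t. \<theta> t x0) {of_nat n * e..of_nat (Suc (Suc n)) * e}"
      unfolding eq using e by (intro inj\<theta>) auto
  qed (use e in auto)
  have "monoseq a"
  proof (cases "a 0 < a 1")
    case True
    have "a n < a (Suc n)" for n
    proof (induction n)
      case 0 then show ?case using True by simp
    next
      case (Suc n) then show ?case using step[of n] by auto
    qed
    then show ?thesis by (simp add: mono_SucI1 less_imp_le)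
  next
    case False
    have "a (Suc n) < a n" for n
    proof (induction n)
      case 0 then show ?case using False step[of 0] by auto
    next
      case (Suc n) then show ?case using step[of n] by auto
    qed
    then show ?thesis by (simp add: mono_SucI2 less_imp_le)
  qed
  obtain n where n: "\<bar>a n - a 0\<bar> > 2 * pi"
  proof (rule ccontr)
    assume "\<not> thesis"
    then have "\<bar>a n - a 0\<bar> \<le> 2 * pi" for n using that not_less by blast
    then have "Bseq (\<lambda>n. a n - a 0)" by (intro BseqI'[where K="2 * pi"]) auto
    then have "Bseq a" using Bseq_add[of "\<lambda>n. a n - a 0" "a 0"] by simp
    then obtain l where l: "a \<longlonglongrightarrow> l"
      using Bseq_monoseq_convergent[OF _ \<open>monoseq a\<close>] by (auto simp: convergent_def)
    have "(\<lambda>n. k (cis (a n))) \<longlonglongrightarrow> k (cis l)"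
      by (rule continuous_on_tendsto_compose[OF k(1)]) (auto intro!: tendsto_intros l)
    then have lim: "(\<lambda>n. torus_cover (\<phi> (of_nat n * e) x0)) \<longlonglongrightarrow> k (cis l)"
      using e x0 by (simp add: a_def z\<theta>[symmetric] k(2))
    have "(\<lambda>n. dist (torus_cover (\<phi> (of_nat (Suc n) * e) x0)) (torus_cover (\<phi> (of_nat n * e) x0))) \<longlonglongrightarrow> dist (k (cis l)) (k (cis l))"
      by (intro tendsto_dist lim LIMSEQ_Suc[OF lim])
    then have lim0: "(\<lambda>n. dist (torus_cover (\<phi> (of_nat (Suc n) * e) x0)) (torus_cover (\<phi> (of_nat n * e) x0))) \<longlonglongrightarrow> 0"
      by simp
    obtain \<delta> where \<delta>: "\<delta> > 0" "\<And>x. dist (torus_cover (\<phi> e x)) (torus_cover x) \<ge> \<delta>"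
      using flow_separation[of e] \<epsilon> e by (auto simp: e_def)
    have "dist (torus_cover (\<phi> (of_nat (Suc n) * e) x0)) (torus_cover (\<phi> (of_nat n * e) x0)) \<ge> \<delta>" for n
      using \<delta>(2)[of "\<phi> (of_nat n * e) x0"] e by (simp add: flow_add[symmetric] algebra_simps)
    then have "\<delta> \<le> 0" using LIMSEQ_le_const[OF lim0] by blast
    then show False using \<delta>(1) by simp
  qed
  define T where "T = of_nat n * e"
  have T: "T \<ge> 0" using e by (simp add: T_def)
  have T0: "T > 0" using n e by (cases n) (auto simp: T_def)
  have "continuous_on (ball x0 r0) (\<lambda>x. \<bar>\<theta> T x - \<theta> 0 x\<bar>)"
    using T by (intro continuous_intros cont\<theta>) auto
  then have "open (ball x0 r0 \<inter> (\<lambda>x. \<bar>\<theta> T x - \<theta> 0 x\<bar>) -` {2 * pi<..})"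
    by (intro continuous_open_preimage) auto
  moreover have "x0 \<in> ball x0 r0 \<inter> (\<lambda>x. \<bar>\<theta> T x - \<theta> 0 x\<bar>) -` {2 * pi<..}"
    using n x0 by (simp add: a_def T_def)
  ultimately obtain r where r: "r > 0" "ball x0 r \<subseteq> ball x0 r0 \<inter> (\<lambda>x. \<bar>\<theta> T x - \<theta> 0 x\<bar>) -` {2 * pi<..}"
    using open_contains_ball by meson
  have "\<exists>t\<in>{0<..T}. \<phi> t x - x \<in> int_vecs" if x: "x \<in> ball x0 r" for x
  proof -
    have xr: "x \<in> ball x0 r0" and gt: "\<bar>\<theta> T x - \<theta> 0 x\<bar> > 2 * pi" using r x by auto
    have "continuous_on {0..T} (\<lambda>t. \<bar>\<theta> t x - \<theta> 0 x\<bar>)"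
      using xr by (intro continuous_intros cont\<theta>) auto
    \<comment> \<open>By continuity the gain equals \<open>2 * pi\<close> exactly at some time,
      where the fibre coordinate is again the initial one.\<close>
    then obtain t where t: "0 \<le> t" "t \<le> T" "\<bar>\<theta> t x - \<theta> 0 x\<bar> = 2 * pi"
      using IVT'[of "\<lambda>t. \<bar>\<theta> t x - \<theta> 0 x\<bar>" 0 "2 * pi" T] T gt by auto
    have "t > 0" using t by (cases "t = 0") auto
    have "\<theta> t x = \<theta> 0 x + 2 * pi \<or> \<theta> t x = \<theta> 0 x - 2 * pi" using t(3) by linarith
    then have "cis (\<theta> t x) = cis (\<theta> 0 x)" by (auto simp: complex_eq_iff cos_diff sin_diff)
    then have "\<phi> t x - \<phi> 0 x \<in> int_vecs"
      using t xr r0 z\<theta>[OF t(1) xr] z\<theta>[OF order_refl xr] by (intro inj) auto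
    then show ?thesis using t \<open>t > 0\<close> by auto
  qed
  then show ?thesis using that r T0 by blast
qed

lemma globally_bounded_period:
  assumes "\<And>x0. \<exists>r>0. \<exists>K>0. \<forall>x\<in>ball x0 r. \<exists>t\<in>{0<..K}. \<phi> t x - x \<in> int_vecs"
  obtains K where "K > 0" "\<And>x. \<exists>t\<in>{0<..K}. \<phi> t x - x \<in> int_vecs"
proof -
  obtain r K where rK: "\<And>x0. r x0 > 0" "\<And>x0. K x0 > 0"
    "\<And>x0 x. x \<in> ball x0 (r x0) \<Longrightarrow> \<exists>t\<in>{0<..K x0}. \<phi> t x - x \<in> int_vecs"
    using assms by metis
  have "cbox 0 1 \<subseteq> (\<Union>x0\<in>UNIV. ball x0 (r x0))"
  proof
    show "x \<in> (\<Union>x0\<in>UNIV. ball x0 (r x0))" for x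
      using rK(1)[of x] by (intro UN_I[of x]) auto
  qed
  then obtain C where C: "finite C" "cbox 0 1 \<subseteq> (\<Union>x0\<in>C. ball x0 (r x0))"
    using compactE_image[of "cbox 0 1" UNIV "\<lambda>x0. ball x0 (r x0)"] by auto
  \<comment> \<open>A sum of positive bounds dominates each of them, so it replaces their maximum;
    the summand 1 makes positivity immediate.\<close>
  define M where "M = (\<Sum>x0\<in>C. K x0) + 1"
  have "(\<Sum>x0\<in>C. K x0) \<ge> 0" by (intro sum_nonneg less_imp_le rK(2))
  then have M: "M > 0" by (simp add: M_def)
  have KM: "K x0 \<le> M" if "x0 \<in> C" for x0
    using member_le_sum[of x0 C K] that C(1) rK(2) by (auto simp: M_def less_imp_le intro: order_trans)
  have "\<exists>t\<in>{0<..M}. \<phi> t x - x \<in> int_vecs" for x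
  proof -
    obtain n where n: "n \<in> int_vecs" "x - n \<in> cbox 0 1" using reduce_to_cbox by blast
    then obtain x0 where x0: "x0 \<in> C" "x - n \<in> ball x0 (r x0)" using C by blast
    then obtain t where t: "t \<in> {0<..K x0}" "\<phi> t (x - n) - (x - n) \<in> int_vecs" using rK(3) by blast
    have "\<phi> t (x - n + n) = \<phi> t (x - n) + n" using t by (intro flow_int n) auto
    then have "\<phi> t x - x \<in> int_vecs" using t(2) by (simp add: algebra_simps)
    then show ?thesis using t(1) KM[OF x0(1)] by force
  qed
  then show ?thesis using that M by blast
qed

section \<open>Rotation vectors when the return times are bounded\<close>

context
  fixes K :: real
  assumes K: "K > 0" and per: "\<And>x. \<exists>t\<in>{0<..K}. \<phi> t x - x \<in> int_vecs"
begin

text \<open>The return time \<open>\<tau>\<close> is a mere choice without any continuity.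
  Nevertheless \<open>\<rho>\<close> is continuous, being the uniform limit of the mean velocities
  over the times \<open>Suc n\<close>. A nonzero \<open>\<rho> x\<close> has norm at least
  \<open>1 / K\<close>, since it is an integral vector divided by a time of at most
  \<open>K\<close>.\<close>

lemma rotation_vector_cases:
  obtains (zero) "\<And>x. \<exists>t\<in>{0<..K}. \<phi> t x = x"
  | (nonzero) a C where "\<And>x T. T \<ge> 0 \<Longrightarrow> a \<bullet> (\<phi> T x - x) \<ge> T / K - C"
proof -
  obtain \<tau> where \<tau>: "\<And>x. \<tau> x \<in> {0<..K}" "\<And>x. \<phi> (\<tau> x) x - x \<in> int_vecs"
    using per by metis
  define h where "h x = \<phi> (\<tau> x) x - x" for x
  define \<rho> where "\<rho> x = h x /\<^sub>R \<tau> x" for x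
  have h: "h x \<in> int_vecs" for x using \<tau> by (simp add: h_def)
  have \<tau>0: "\<tau> x > 0" "\<tau> x \<le> K" for x using \<tau>(1)[of x] by auto
  have iter: "\<phi> (of_nat n * \<tau> x) x = x + of_nat n *\<^sub>R h x" for n x
  proof (induction n)
    case (Suc n)
    have "\<phi> (of_nat (Suc n) * \<tau> x) x = \<phi> (\<tau> x) (\<phi> (of_nat n * \<tau> x) x)"
      using \<tau>0[of x] by (subst flow_add[symmetric]) (auto simp: algebra_simps)
    also have "\<dots> = \<phi> (\<tau> x) x + of_nat n *\<^sub>R h x"
      using \<tau>0[of x] by (simp add: Suc flow_int int_vecs_scale h less_imp_le)
    also have "\<dots> = x + of_nat (Suc n) *\<^sub>R h x" by (simp add: h_def algebra_simps)
    finally show ?case .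
  qed auto
  \<comment> \<open>Complete returns contribute exactly their time multiple of
    \<open>\<rho> x\<close>. The remaining time \<open>r\<close> is at most \<open>\<tau> x\<close>;
    the displacement during \<open>r\<close> and the vector \<open>r *\<^sub>R \<rho> x\<close>
    account for \<open>B * K\<close> each.\<close>
  have asymp: "norm (\<phi> T x - x - T *\<^sub>R \<rho> x) \<le> 2 * B * K" if T: "T \<ge> 0" for T x
  proof -
    define n where "n = nat \<lfloor>T / \<tau> x\<rfloor>"
    define r where "r = T - of_nat n * \<tau> x"
    have n: "of_nat n \<le> T / \<tau> x" "T / \<tau> x < of_nat n + 1"
      using T \<tau>0[of x] by (auto simp: n_def)
    then have r: "0 \<le> r" "r \<le> \<tau> x"
      using \<tau>0[of x] by (auto simp: r_def field_simps)
    have "\<phi> T x = \<phi> r (\<phi> (of_nat n * \<tau> x) x)"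
      using r \<tau>0[of x] by (subst flow_add[symmetric]) (auto simp: r_def)
    also have "\<dots> = \<phi> r x + of_nat n *\<^sub>R h x"
      using r by (simp add: iter flow_int int_vecs_scale h)
    also have "of_nat n *\<^sub>R h x = (T - r) *\<^sub>R \<rho> x"
      using \<tau>0[of x] by (simp add: \<rho>_def r_def)
    finally have "\<phi> T x - x - T *\<^sub>R \<rho> x = (\<phi> r x - x) - r *\<^sub>R \<rho> x"
      by (simp add: algebra_simps)
    also have "norm \<dots> \<le> norm (\<phi> r x - x) + norm (r *\<^sub>R \<rho> x)" by (rule norm_triangle_ineq4)
    also have "norm (\<phi> r x - x) \<le> B * r" using r by (intro flow_dist)
    also have "B * r \<le> B * K" using r \<tau>0[of x] B_nonneg by (intro mult_left_mono) auto
    also have "norm (r *\<^sub>R \<rho> x) = (r / \<tau> x) * norm (h x)"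
      using r \<tau>0[of x] by (simp add: \<rho>_def divide_inverse)
    also have "\<dots> \<le> 1 * (B * \<tau> x)"
      using r \<tau>0[of x] flow_dist[of "\<tau> x" x] by (intro mult_mono) (auto simp: h_def)
    also have "1 * (B * \<tau> x) \<le> B * K" using \<tau>0[of x] B_nonneg by (simp add: mult_left_mono)
    finally show ?thesis by simp
  qed
  have contf: "continuous_on UNIV (\<lambda>x. (\<phi> (of_nat (Suc n)) x - x) /\<^sub>R of_nat (Suc n))" for n
    by (intro continuous_intros continuous_on_flow) auto
  have ul: "uniform_limit UNIV (\<lambda>n x. (\<phi> (of_nat (Suc n)) x - x) /\<^sub>R of_nat (Suc n)) \<rho> sequentially"
  proof (rule uniform_limitI)
    fix e :: real assume "e > 0"
    have "(\<lambda>n. 2 * B * K / of_nat (Suc n)) \<longlonglongrightarrow> 0"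
      by (intro LIMSEQ_Suc[OF lim_const_over_n])
    then have "\<forall>\<^sub>F n in sequentially. 2 * B * K / of_nat (Suc n) < e"
      using \<open>e > 0\<close> by (rule order_tendstoD)
    then show "\<forall>\<^sub>F n in sequentially. \<forall>x\<in>UNIV. dist ((\<phi> (of_nat (Suc n)) x - x) /\<^sub>R of_nat (Suc n)) (\<rho> x) < e"
    proof eventually_elim
      case (elim n)
      show ?case
      proof
        fix x
        define N :: real where "N = of_nat (Suc n)"
        have N: "N > 0" unfolding N_def by (rule of_nat_0_less_iff[THEN iffD2]) simp
        have "(\<phi> N x - x) /\<^sub>R N - \<rho> x = (\<phi> N x - x - N *\<^sub>R \<rho> x) /\<^sub>R N"
          using N by (simp add: scaleR_diff_right)
        then have "dist ((\<phi> N x - x) /\<^sub>R N) (\<rho> x) = norm (\<phi> N x - x - N *\<^sub>R \<rho> x) / N"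
          using N by (simp add: dist_norm divide_inverse mult.commute)
        also have "\<dots> \<le> 2 * B * K / N"
          using N by (intro divide_right_mono asymp) auto
        also have "\<dots> < e" using elim by (simp add: N_def)
        finally have "dist ((\<phi> N x - x) /\<^sub>R N) (\<rho> x) < e" .
        then show "dist ((\<phi> (of_nat (Suc n)) x - x) /\<^sub>R of_nat (Suc n)) (\<rho> x) < e"
          unfolding N_def .
      qed
    qed
  qed
  have cont\<rho>: "continuous_on UNIV \<rho>"
    by (rule uniform_limit_theorem[OF always_eventually[OF allI[OF contf]] ul]) simp
  have gap: "norm (\<rho> x) \<ge> 1 / K" if "\<rho> x \<noteq> 0" for x
  proof -
    have "norm (h x) \<ge> 1" using that int_vecs_small[OF h[of x]] by (force simp: \<rho>_def)
    then have "1 / K \<le> norm (h x) / \<tau> x"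
      using \<tau>0[of x] by (intro frac_le) auto
    then show ?thesis using \<tau>0[of x] by (simp add: \<rho>_def divide_inverse mult.commute)
  qed
  \<comment> \<open>A connected set with two distinct points is uncountable, so a continuous map
    with countable range is constant. It is applied below to a two-valued function and to the
    direction of \<open>\<rho>\<close>.\<close>
  have const: "g x = g y" if "continuous_on UNIV g" "countable (range g)"
    for g :: "real ^ 'n \<Rightarrow> 'c::metric_space" and x y
    using connected_uncountable[OF connected_continuous_image[OF that(1) connected_UNIV], of "g x" "g y"] that(2)
    by auto
  \<comment> \<open>Because of the gap below \<open>1 / K\<close>, truncation makes this the
    indicator of \<open>\<rho> x \<noteq> 0\<close> while keeping it continuous.\<close>
  define g where "g x = min 1 (K * norm (\<rho> x))" for x
  have g01: "g x = (if \<rho> x = 0 then 0 else 1)" for x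
    using gap[of x] K by (auto simp: g_def min_def field_simps)
  have "continuous_on UNIV g"
    unfolding g_def by (intro continuous_intros cont\<rho>)
  moreover have "countable (range g)"
    by (rule countable_subset[of _ "{0,1}"]) (auto simp: g01)
  ultimately have gc: "g x = g 0" for x by (rule const)
  show ?thesis
  proof (cases "\<rho> 0 = 0")
    case True
    then have \<rho>0: "\<rho> x = 0" for x using gc[of x] by (simp add: g01 split: if_splits)
    then have "h x = 0" for x using \<rho>0[of x] \<tau>0[of x] by (auto simp: \<rho>_def)
    then have "\<phi> (\<tau> x) x = x" for x by (simp add: h_def)
    then show ?thesis using zero \<tau>(1) by blast
  next
    case False
    then have nz: "\<rho> x \<noteq> 0" for x using gc[of x] by (auto simp: g01 split: if_splits)
    have "continuous_on UNIV (\<lambda>x. \<rho> x /\<^sub>R norm (\<rho> x))"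
      using nz by (intro continuous_intros cont\<rho>) auto
    moreover have "\<rho> x /\<^sub>R norm (\<rho> x) = h x /\<^sub>R norm (h x)" for x
      using \<tau>0[of x] by (simp add: \<rho>_def field_simps)
    then have "range (\<lambda>x. \<rho> x /\<^sub>R norm (\<rho> x)) \<subseteq> (\<lambda>n. n /\<^sub>R norm n) ` int_vecs"
      using h by auto
    then have "countable (range (\<lambda>x. \<rho> x /\<^sub>R norm (\<rho> x)))"
      by (rule countable_subset) (intro countable_image countable_int_vecs)
    ultimately have dir: "\<rho> x /\<^sub>R norm (\<rho> x) = \<rho> 0 /\<^sub>R norm (\<rho> 0)" for x by (rule const)
    define a where "a = \<rho> 0 /\<^sub>R norm (\<rho> 0)"
    have na: "norm a = 1" using nz by (simp add: a_def)
    have \<rho>a: "\<rho> x = norm (\<rho> x) *\<^sub>R a" for x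
      unfolding a_def dir[of x, symmetric] using nz by simp
    have "a \<bullet> (\<phi> T x - x) \<ge> T / K - 2 * B * K" if T: "T \<ge> 0" for T x
    proof -
      have "\<bar>a \<bullet> (\<phi> T x - x - T *\<^sub>R \<rho> x)\<bar> \<le> norm a * norm (\<phi> T x - x - T *\<^sub>R \<rho> x)"
        by (rule Cauchy_Schwarz_ineq2)
      also have "\<dots> \<le> 2 * B * K" using asymp[OF T] na by simp
      finally have "a \<bullet> (\<phi> T x - x) \<ge> T * (a \<bullet> \<rho> x) - 2 * B * K"
        by (simp add: inner_diff_right)
      moreover have "a \<bullet> \<rho> x = norm (\<rho> x)"
        by (subst \<rho>a) (simp add: dot_square_norm na)
      moreover have "T * (1 / K) \<le> T * norm (\<rho> x)" using gap[OF nz] T by (rule mult_left_mono)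
      ultimately show ?thesis by simp
    qed
    then show ?thesis using nonzero by blast
  qed
qed

end

text \<open>If all orbits in the covering space are closed, the coordinatewise suprema over the orbits
  define an orbit-invariant Lipschitz map at bounded distance from the identity. It is onto by
  Brouwer's theorem, yet it is determined by its values on a null set met by every orbit.\<close>

lemma not_all_orbits_closed:
  assumes K: "K > 0" and closed: "\<And>x. \<exists>t\<in>{0<..K}. \<phi> t x = x"
  shows False
proof -
  obtain \<tau> where \<tau>: "\<And>x. \<tau> x \<in> {0<..K}" "\<And>x. \<phi> (\<tau> x) x = x"
    using closed by metis
  have \<tau>0: "\<tau> x > 0" "\<tau> x \<le> K" for x using \<tau>(1)[of x] by auto
  have iter: "\<phi> (of_nat n * \<tau> x) x = x" for n x
  proof (induction n)
    case (Suc n)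
    have "\<phi> (of_nat (Suc n) * \<tau> x) x = \<phi> (\<tau> x) (\<phi> (of_nat n * \<tau> x) x)"
      using \<tau>0[of x] by (subst flow_add[symmetric]) (auto simp: algebra_simps)
    then show ?case by (simp add: Suc \<tau>)
  qed auto
  have reduce: "\<exists>r\<in>{0..K}. \<phi> t x = \<phi> r x" if t: "t \<ge> 0" for t x
  proof -
    define n where "n = nat \<lfloor>t / \<tau> x\<rfloor>"
    have n: "of_nat n \<le> t / \<tau> x" "t / \<tau> x < of_nat n + 1"
      using t \<tau>0[of x] by (auto simp: n_def)
    define r where "r = t - of_nat n * \<tau> x"
    have r: "0 \<le> r" "r \<le> K" using n \<tau>0[of x] by (auto simp: r_def field_simps)
    have "\<phi> t x = \<phi> r (\<phi> (of_nat n * \<tau> x) x)"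
      using r \<tau>0[of x] by (subst flow_add[symmetric]) (auto simp: r_def)
    then show ?thesis using r by (auto simp: iter)
  qed
  \<comment> \<open>The suprema are finite since an orbit is exhausted by times up to
    \<open>K\<close>, and so stays within \<open>B * K\<close> of its starting point in each
    coordinate.\<close>
  define m where "m x = (\<chi> i. SUP t\<in>{0..}. \<phi> t x $ i)" for x
  have near: "\<bar>\<phi> t x $ i - x $ i\<bar> \<le> B * K" if t: "t \<ge> 0" for t x i
  proof -
    obtain r where r: "r \<in> {0..K}" "\<phi> t x = \<phi> r x" using reduce[OF t] by blast
    have "\<bar>(\<phi> r x - x) $ i\<bar> \<le> norm (\<phi> r x - x)" by (rule component_le_norm_cart)
    also have "\<dots> \<le> B * r" using r by (intro flow_dist) auto
    also have "\<dots> \<le> B * K" using r B_nonneg by (intro mult_left_mono) auto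
    finally show ?thesis using r by simp
  qed
  have bdd: "bdd_above ((\<lambda>t. \<phi> t x $ i) ` {0..})" for x i
  proof (rule bdd_aboveI2)
    show "\<phi> t x $ i \<le> x $ i + B * K" if "t \<in> {0..}" for t
      using near[of t x i] that by auto
  qed
  have le_m: "\<phi> t x $ i \<le> m x $ i" if "t \<ge> 0" for t x i
    unfolding m_def using that by (auto intro!: cSUP_upper bdd)
  have m_le: "m x $ i \<le> c" if "\<And>t. t \<ge> 0 \<Longrightarrow> \<phi> t x $ i \<le> c" for x i c
    unfolding m_def using that by (auto intro!: cSUP_least)
  have m_near: "\<bar>m x $ i - x $ i\<bar> \<le> B * K" for x i
  proof -
    have "m x $ i \<le> x $ i + B * K"
      by (rule m_le) (use near in \<open>smt (verit)\<close>)
    moreover have "x $ i \<le> m x $ i" using le_m[of 0 x i] by simp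
    ultimately show ?thesis by simp
  qed
  have norm_le: "norm v \<le> of_nat CARD('n) * c" if "\<And>i. \<bar>v $ i\<bar> \<le> c" for v :: "real ^ 'n" and c
    by (rule order_trans[OF norm_le_l1_cart]) (use sum_bounded_above[of UNIV "\<lambda>i. \<bar>v $ i\<bar>" c] that in simp)
  have inv: "m (\<phi> s x) = m x" if s: "s \<ge> 0" for s x
  proof -
    have "m (\<phi> s x) $ i \<le> m x $ i" for i
      by (rule m_le) (use s in \<open>simp add: flow_add[symmetric] le_m\<close>)
    moreover have "m x $ i \<le> m (\<phi> s x) $ i" for i
    proof (rule m_le)
      fix t :: real assume t: "t \<ge> 0"
      \<comment> \<open>Invariance requires going back from \<open>\<phi> s x\<close> to
        \<open>x\<close>. Closedness replaces the backward flow: completing \<open>n\<close> whole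
        periods returns to \<open>x\<close> by flowing forward.\<close>
      obtain n :: nat where "s / \<tau> x \<le> of_nat n" using real_arch_simple by blast
      then have n: "s \<le> of_nat n * \<tau> x" using \<tau>0[of x] by (simp add: field_simps)
      then have "\<phi> t x = \<phi> (t + (of_nat n * \<tau> x - s)) (\<phi> s x)"
        using t s by (subst flow_add[symmetric]) (auto simp: add.assoc flow_add iter)
      then show "\<phi> t x $ i \<le> m (\<phi> s x) $ i" using t n by (simp add: le_m)
    qed
    ultimately show ?thesis by (simp add: vec_eq_iff order_antisym)
  qed
  \<comment> \<open>Every point of the orbit of \<open>x\<close> is already reached by time
    \<open>K\<close>, which replaces the growing factor \<open>exp (L * t)\<close> by a uniform
    one.\<close>
  have m_lip1: "m x $ i \<le> m y $ i + exp (L * K) * norm (x - y)" for x y i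
  proof (rule m_le)
    fix t :: real assume t: "t \<ge> 0"
    obtain r where r: "r \<in> {0..K}" "\<phi> t x = \<phi> r x" using reduce[OF t] by blast
    have "\<bar>(\<phi> r x - \<phi> r y) $ i\<bar> \<le> norm (\<phi> r x - \<phi> r y)" by (rule component_le_norm_cart)
    also have "\<dots> \<le> exp (L * r) * norm (x - y)" using r by (intro flow_lipschitz) auto
    also have "\<dots> \<le> exp (L * K) * norm (x - y)"
      using r L_nonneg by (intro mult_right_mono) (auto intro: mult_left_mono)
    finally have "\<phi> r x $ i \<le> \<phi> r y $ i + exp (L * K) * norm (x - y)" by simp
    also have "\<phi> r y $ i \<le> m y $ i" using r by (intro le_m) auto
    finally show "\<phi> t x $ i \<le> m y $ i + exp (L * K) * norm (x - y)" using r by simp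
  qed
  have m_lip: "norm (m x - m y) \<le> of_nat CARD('n) * exp (L * K) * norm (x - y)" for x y
  proof -
    have "\<bar>(m x - m y) $ i\<bar> \<le> exp (L * K) * norm (x - y)" for i
      using m_lip1[of x i y] m_lip1[of y i x] by (auto simp: norm_minus_commute)
    from norm_le[OF this] show ?thesis by (simp add: mult.assoc)
  qed
  have "(of_nat CARD('n) * exp (L * K))-lipschitz_on UNIV m"
    by (rule lipschitz_onI) (auto simp: dist_norm m_lip)
  then have contm: "continuous_on S m" for S
    using lipschitz_on_continuous_on continuous_on_subset by blast
  \<comment> \<open>The norm of \<open>m x - x\<close> is bounded by the sum of its coordinates,
    each of size at most \<open>B * K\<close>; adding 1 makes the radius positive.\<close>
  define R where "R = of_nat CARD('n) * (B * K) + 1"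
  have R: "R > 0" using B_nonneg K by (auto simp: R_def intro!: add_nonneg_pos)
  \<comment> \<open>A fixed point of \<open>x \<mapsto> y - (m x - x)\<close> is a preimage of
    \<open>y\<close>, and this map preserves the ball of radius \<open>R\<close> about
    \<open>y\<close>.\<close>
  have surj: "y \<in> range m" for y
  proof -
    have "continuous_on (cball y R) (\<lambda>x. y - (m x - x))"
      by (intro continuous_intros contm)
    moreover have "norm (m x - x) \<le> R" for x
      using norm_le[of "m x - x" "B * K"] m_near by (simp add: R_def add_increasing2)
    then have "(\<lambda>x. y - (m x - x)) \<in> cball y R \<rightarrow> cball y R"
      by (auto simp: dist_norm)
    ultimately obtain x where "y - (m x - x) = x"
      using brouwer_ball[OF R] by blast
    then show ?thesis by (intro image_eqI[of _ _ x]) (auto simp: algebra_simps)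
  qed
  \<comment> \<open>Points with some rational coordinate form a countable union of hyperplanes. An
    orbit moves in some coordinate because \<open>X\<close> is nonzero, and that coordinate then
    passes through a rational value.\<close>
  define S where "S = (\<Union>i. \<Union>q\<in>\<rat>. {y :: real ^ 'n. y $ i = q})"
  have "negligible {y :: real ^ 'n. y $ i = q}" for i q
    by (simp add: cart_eq_inner_axis negligible_standard_hyperplane)
  then have "negligible (\<Union>q\<in>\<rat>. {y :: real ^ 'n. y $ i = q})" for i
    by (intro negligible_countable_Union) (auto simp: countable_rat)
  then have "negligible S"
    unfolding S_def by (intro negligible_countable_Union) auto
  then have "negligible (m ` S)"
    using m_lip by (intro negligible_locally_Lipschitz_image) (auto intro!: exI[of _ UNIV])
  moreover have "\<exists>s\<ge>0. \<phi> s x \<in> S" for x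
  proof -
    obtain i where i: "X x $ i \<noteq> 0" using X_nz[of x] by (auto simp: vec_eq_iff)
    define c where "c = \<bar>X x $ i\<bar>"
    \<comment> \<open>With this time the Euler error \<open>L * B * s\<^sup>2\<close> is smaller
      than \<open>s * c\<close>, the change of the coordinate predicted by the velocity.\<close>
    define s where "s = c / (L * B + 1)"
    have LB: "L * B \<ge> 0" using L_nonneg B_nonneg by simp
    have s: "s > 0" using i LB by (auto simp: s_def c_def intro!: divide_pos_pos)
    have "s * (L * B + 1) = c" using LB by (simp add: s_def)
    then have "L * B * s < c" using s by (simp add: algebra_simps)
    then have "L * B * s\<^sup>2 < s * c" using s by (simp add: power2_eq_square)
    have ne: "\<phi> s x $ i \<noteq> x $ i"
    proof
      assume "\<phi> s x $ i = x $ i"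
      then have "\<bar>(\<phi> s x - x - s *\<^sub>R X x) $ i\<bar> = s * c"
        using s by (simp add: c_def abs_mult)
      then show False
        using component_le_norm_cart[of "\<phi> s x - x - s *\<^sub>R X x" i] flow_euler[of s x] s \<open>L * B * s\<^sup>2 < s * c\<close>
        by linarith
    qed
    have cont: "continuous_on {0..s} (\<lambda>t. \<phi> t x $ i)"
      by (intro continuous_intros continuous_on_flow) auto
    have "\<exists>t\<in>{0..s}. \<phi> t x $ i \<in> \<rat>"
    proof (cases "x $ i < \<phi> s x $ i")
      case True
      then obtain q where q: "q \<in> \<rat>" "x $ i < q" "q < \<phi> s x $ i" using Rats_dense_in_real by blast
      then show ?thesis using IVT'[of "\<lambda>t. \<phi> t x $ i" 0 q s] cont s by auto
    next
      case False
      then have "\<phi> s x $ i < x $ i" using ne by simp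
      then obtain q where q: "q \<in> \<rat>" "\<phi> s x $ i < q" "q < x $ i" using Rats_dense_in_real by blast
      then show ?thesis using IVT2'[of "\<lambda>t. \<phi> t x $ i" s q 0] cont s by auto
    qed
    then show ?thesis by (auto simp: S_def)
  qed
  then have "y \<in> m ` S" for y
    using surj[of y] inv by (metis imageE image_eqI)
  then have "m ` S = UNIV" by auto
  ultimately show False by simp
qed

end

section \<open>Divergence-free fields of mean zero\<close>

definition unit_cube :: "(real ^ 'n) set" where
  "unit_cube = {x. \<forall>i. 0 \<le> x $ i \<and> x $ i < 1}"

definition fundamental_domain :: "(real ^ 'n) set \<Rightarrow> bool" where
  "fundamental_domain D \<longleftrightarrow> (\<forall>x. \<exists>!n. n \<in> int_vecs \<and> x + n \<in> D)"

text \<open>The cube is half-open so that representatives are unique; \<open>cbox 0 1\<close> has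
  several on its boundary and differs from it by a null set, so integrals agree.\<close>

lemma fundamental_domain_unit_cube: "fundamental_domain (unit_cube :: (real ^ 'n) set)"
  unfolding fundamental_domain_def
proof
  fix x :: "real ^ 'n"
  obtain n where n: "n \<in> int_vecs" "\<And>i. 0 \<le> (x - n) $ i" "\<And>i. (x - n) $ i < 1"
    using reduce_to_cube by blast
  show "\<exists>!n. n \<in> int_vecs \<and> x + n \<in> unit_cube"
  proof
    show "- n \<in> int_vecs \<and> x + - n \<in> unit_cube"
      using n by (simp add: int_vecs_minus unit_cube_def)
  next
    fix k assume k: "k \<in> int_vecs \<and> x + k \<in> unit_cube"
    have "k $ i = - n $ i" for i
    proof -
      have "k $ i \<in> \<int>" "n $ i \<in> \<int>" using k n by (auto simp: int_vecs_def)
      then have "k $ i + n $ i \<in> \<int>" by simp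
      moreover have "0 \<le> x $ i + k $ i" "x $ i + k $ i < 1" using k by (auto simp: unit_cube_def)
      then have "\<bar>(k $ i + n $ i) - 0\<bar> < 1" using n(2,3)[of i] by simp
      ultimately have "k $ i + n $ i = 0" by (simp add: Ints_eq_abs_less1)
      then show ?thesis by simp
    qed
    then show "k = - n" by (simp add: vec_eq_iff)
  qed
qed

lemma unit_cube_borel [measurable]: "(unit_cube :: (real ^ 'n) set) \<in> sets borel"
proof -
  have "unit_cube = (\<Inter>i. {x :: real ^ 'n. 0 \<le> x $ i} \<inter> {x. x $ i < 1})"
    by (auto simp: unit_cube_def)
  also have "\<dots> \<in> sets borel"
    by (intro sets.countable_INT'' sets.Int borel_closed borel_open closed_Collect_le open_Collect_less continuous_intros) auto
  finally show ?thesis .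
qed

lemma unit_cube_subset_cbox: "unit_cube \<subseteq> cbox 0 (1 :: real ^ 'n)"
  by (auto simp: unit_cube_def mem_box_cart less_imp_le)

lemma negligible_cbox_minus_unit_cube: "negligible (cbox 0 (1 :: real ^ 'n) - unit_cube)"
proof -
  have "cbox 0 1 - unit_cube \<subseteq> cbox 0 (1 :: real ^ 'n) - box 0 1"
    by (auto simp: unit_cube_def mem_box_cart less_imp_le)
  then show ?thesis by (rule negligible_subset[OF negligible_frontier_interval])
qed

lemma has_integral_unit_cube:
  fixes f :: "real ^ 'n \<Rightarrow> real"
  shows "(f has_integral b) unit_cube \<longleftrightarrow> (f has_integral b) (cbox 0 1)"
proof (rule has_integral_spike_set_eq)
  show "negligible {x \<in> cbox 0 1 - unit_cube. f x \<noteq> 0}"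
    by (rule negligible_subset[OF negligible_cbox_minus_unit_cube]) auto
  show "negligible {x \<in> unit_cube - cbox 0 1. f x \<noteq> 0}"
    using unit_cube_subset_cbox by (intro negligible_subset[OF negligible_empty]) auto
qed

lemma integral_unit_cube:
  fixes f :: "real ^ 'n \<Rightarrow> real"
  shows "integral unit_cube f = integral (cbox 0 1) f"
  unfolding integral_def integrable_on_def has_integral_unit_cube ..

lemma infinite_int_vecs: "infinite (int_vecs :: (real ^ 'n) set)"
proof -
  have "inj (\<lambda>k::nat. of_nat k *\<^sub>R axis undefined 1 :: real ^ 'n)"
    by (auto simp: inj_on_def axis_eq_0_iff)
  then have "infinite (range (\<lambda>k::nat. of_nat k *\<^sub>R axis undefined 1 :: real ^ 'n))"
    by (rule range_inj_infinite)
  moreover have "range (\<lambda>k::nat. of_nat k *\<^sub>R axis undefined 1 :: real ^ 'n) \<subseteq> int_vecs"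
    by (auto intro: int_vecs_scale)
  ultimately show ?thesis using finite_subset by blast
qed

text \<open>Cut \<open>D\<close> along the translates of \<open>E\<close>, move each piece into
  \<open>E\<close> by a lattice vector, which leaves \<open>g\<close> unchanged, and reassemble: the
  moved pieces are the cuts of \<open>E\<close> along the translates of \<open>D\<close>.
  Nonnegativity allows interchanging sum and integral.\<close>

lemma nn_integral_fundamental_domain:
  fixes g :: "real ^ 'n \<Rightarrow> ennreal"
  assumes [measurable]: "g \<in> borel_measurable borel" "D \<in> sets borel" "E \<in> sets borel"
    and g: "periodic g" and D: "fundamental_domain D" and E: "fundamental_domain E"
  shows "(\<integral>\<^sup>+x. g x * indicator D x \<partial>lborel) = (\<integral>\<^sup>+x. g x * indicator E x \<partial>lborel)"
proof -
  define e where "e = from_nat_into (int_vecs :: (real ^ 'n) set)"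
  have e: "bij_betw e UNIV int_vecs"
    unfolding e_def by (intro bij_betw_from_nat_into countable_int_vecs infinite_int_vecs)
  have eI: "e i \<in> int_vecs" for i using e by (auto simp: bij_betw_def)
  have sum1: "(\<Sum>i. indicator S (x + e i)) = (1::ennreal)" if S: "fundamental_domain S" for S x
  proof -
    obtain n where n: "n \<in> int_vecs" "x + n \<in> S" "\<And>m. m \<in> int_vecs \<Longrightarrow> x + m \<in> S \<Longrightarrow> m = n"
      using S unfolding fundamental_domain_def by blast
    have "n \<in> range e" using e n(1) by (simp add: bij_betw_def)
    then obtain k where k: "e k = n" by blast
    have "x + e i \<in> S \<longleftrightarrow> i = k" for i
      using n(2) n(3)[OF eI[of i]] k e by (auto simp: bij_betw_def inj_on_def)
    then have "indicator S (x + e i) = (if i = k then 1 else 0 :: ennreal)" for i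
      by (simp add: indicator_def)
    then show ?thesis using sums_single[of k "\<lambda>_. 1::ennreal"] by (simp add: sums_iff)
  qed
  have sum2: "(\<Sum>i. indicator S (x - e i)) = (1::ennreal)" if S: "fundamental_domain S" for S x
  proof -
    obtain n where n: "n \<in> int_vecs" "x + n \<in> S" "\<And>m. m \<in> int_vecs \<Longrightarrow> x + m \<in> S \<Longrightarrow> m = n"
      using S unfolding fundamental_domain_def by blast
    have "- n \<in> range e" using e int_vecs_minus[OF n(1)] by (simp add: bij_betw_def)
    then obtain k where k: "e k = - n" by (metis rangeE)
    have "x - e i \<in> S \<longleftrightarrow> i = k" for i
    proof
      assume "x - e i \<in> S"
      then have "- e i = n" using n(3)[OF int_vecs_minus[OF eI[of i]]] by simp
      then have "e i = e k" unfolding k by (metis minus_minus)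
      then show "i = k" using e by (simp add: bij_betw_def inj_on_def)
    qed (use n(2) k in simp)
    then have "indicator S (x - e i) = (if i = k then 1 else 0 :: ennreal)" for i
      by (simp add: indicator_def)
    then show ?thesis using sums_single[of k "\<lambda>_. 1::ennreal"] by (simp add: sums_iff)
  qed
  have "(\<integral>\<^sup>+x. g x * indicator D x \<partial>lborel) = (\<integral>\<^sup>+x. (\<Sum>i. g x * indicator D x * indicator E (x + e i)) \<partial>lborel)"
    by (simp add: ennreal_suminf_cmult sum1[OF E])
  also have "\<dots> = (\<Sum>i. \<integral>\<^sup>+x. g x * indicator D x * indicator E (x + e i) \<partial>lborel)"
    by (intro nn_integral_suminf) measurable
  also have "\<dots> = (\<Sum>i. \<integral>\<^sup>+x. g x * indicator E x * indicator D (x - e i) \<partial>lborel)"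
  proof (intro suminf_cong)
    fix i
    have ge: "g (x - e i) = g x" for x
      using g int_vecs_minus[OF eI[of i]] unfolding periodic_def by (metis diff_conv_add_uminus)
    have "(\<integral>\<^sup>+x. g x * indicator D x * indicator E (x + e i) \<partial>lborel)
        = (\<integral>\<^sup>+x. g x * indicator D x * indicator E (x + e i) \<partial>distr lborel borel ((+) (- e i)))"
      by (simp add: lborel_distr_plus)
    also have "\<dots> = (\<integral>\<^sup>+x. g (- e i + x) * indicator D (- e i + x) * indicator E (- e i + x + e i) \<partial>lborel)"
      by (intro nn_integral_distr) measurable
    also have "\<dots> = (\<integral>\<^sup>+x. g x * indicator E x * indicator D (x - e i) \<partial>lborel)"
      by (intro nn_integral_cong) (simp add: ge mult_ac)
    finally show "(\<integral>\<^sup>+x. g x * indicator D x * indicator E (x + e i) \<partial>lborel)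
      = (\<integral>\<^sup>+x. g x * indicator E x * indicator D (x - e i) \<partial>lborel)" .
  qed
  also have "\<dots> = (\<integral>\<^sup>+x. (\<Sum>i. g x * indicator E x * indicator D (x - e i)) \<partial>lborel)"
    by (intro nn_integral_suminf[symmetric]) measurable
  also have "\<dots> = (\<integral>\<^sup>+x. g x * indicator E x \<partial>lborel)"
    by (simp add: ennreal_suminf_cmult sum2[OF D])
  finally show ?thesis .
qed

lemma set_integrable_bounded_borel:
  fixes g :: "real ^ 'n \<Rightarrow> real"
  assumes "D \<in> sets borel" "bounded D" "continuous_on UNIV g"
  shows "set_integrable lborel D g"
proof -
  obtain a b where ab: "D \<subseteq> cbox a b" using bounded_subset_cbox_symmetric[OF assms(2)] by blast
  have "set_integrable lborel (cbox a b) g"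
    unfolding set_integrable_def
    by (intro borel_integrable_compact continuous_on_subset[OF assms(3)]) auto
  then show ?thesis by (rule set_integrable_subset) (use assms ab in auto)
qed

lemma integral_fundamental_domain_nonneg:
  fixes g :: "real ^ 'n \<Rightarrow> real"
  assumes D: "D \<in> sets borel" "bounded D" "fundamental_domain D"
    and g: "continuous_on UNIV g" "periodic g" "\<And>x. g x \<ge> 0"
  shows "integral D g = integral (cbox 0 1) g"
proof -
  have gm[measurable]: "g \<in> borel_measurable borel" using g(1) by (rule borel_measurable_continuous_onI)
  have *: "integral S g = enn2real (\<integral>\<^sup>+x. ennreal (g x) * indicator S x \<partial>lborel)"
    if [measurable]: "S \<in> sets borel" and "bounded S" for S
  proof -
    have "integral S g = (LINT x:S|lborel. g x)"
      using set_borel_integral_eq_integral(2)[OF set_integrable_bounded_borel[OF that g(1)]] by simp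
    also have "\<dots> = enn2real (\<integral>\<^sup>+x. ennreal (indicator S x *\<^sub>R g x) \<partial>lborel)"
      unfolding set_lebesgue_integral_def by (intro integral_eq_nn_integral) (auto simp: g(3))
    also have "(\<integral>\<^sup>+x. ennreal (indicator S x *\<^sub>R g x) \<partial>lborel) = (\<integral>\<^sup>+x. ennreal (g x) * indicator S x \<partial>lborel)"
      by (intro nn_integral_cong) (auto simp: indicator_def)
    finally show ?thesis .
  qed
  have b: "bounded (unit_cube :: (real ^ 'n) set)"
    using bounded_subset[OF bounded_cbox unit_cube_subset_cbox] .
  have "(\<integral>\<^sup>+x. ennreal (g x) * indicator D x \<partial>lborel) = (\<integral>\<^sup>+x. ennreal (g x) * indicator unit_cube x \<partial>lborel)"
    using D g(2)
    by (intro nn_integral_fundamental_domain) (auto simp: periodic_def fundamental_domain_unit_cube)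
  then have "integral D g = integral unit_cube g"
    by (simp only: *[OF D(1,2)] *[OF unit_cube_borel b])
  then show ?thesis by (simp add: integral_unit_cube)
qed

text \<open>A continuous periodic function is bounded, so adding a constant reduces to the
  nonnegative case; the constant itself is an instance of that case.\<close>

lemma integral_fundamental_domain:
  fixes g :: "real ^ 'n \<Rightarrow> real"
  assumes D: "D \<in> sets borel" "bounded D" "fundamental_domain D"
    and g: "continuous_on UNIV g" "periodic g"
  shows "integral D g = integral (cbox 0 1) g"
proof -
  obtain C where C: "C > 0" "\<And>x. norm (g x) \<le> C" using periodic_bounded[OF g(2,1)] by blast
  have int: "h integrable_on S" if "continuous_on UNIV h" "S \<in> sets borel" "bounded S"
    for h :: "real ^ 'n \<Rightarrow> real" and S
    using set_borel_integral_eq_integral(1)[OF set_integrable_bounded_borel[OF that(2,3,1)]] .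
  have "g x + C \<ge> 0" for x using C(2)[of x] by simp
  then have "integral D (\<lambda>x. g x + C) = integral (cbox 0 1) (\<lambda>x. g x + C)"
    using D g by (intro integral_fundamental_domain_nonneg continuous_intros) (auto simp: periodic_def)
  moreover have "integral D (\<lambda>x. C) = integral (cbox 0 1) (\<lambda>x :: real ^ 'n. C)"
    using C(1) by (intro integral_fundamental_domain_nonneg D continuous_intros) (auto simp: periodic_def)
  moreover have "integral S (\<lambda>x. g x + C) = integral S g + integral S (\<lambda>x. C)"
    if "S \<in> sets borel" "bounded S" for S
    using that g by (intro integral_add int) auto
  ultimately show ?thesis using D by simp
qed

text \<open>A diffeomorphism commuting with the lattice maps the unit cube onto another bounded
  fundamental domain, over which \<open>g\<close> has the same integral as over the cube. Written as
  a preimage under the continuous inverse, this domain is Borel.\<close>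

lemma periodic_integral_diffeo:
  fixes g :: "real ^ 'n::{finite,wellorder} \<Rightarrow> real"
  assumes g: "continuous_on UNIV g" "periodic g"
    and der: "\<And>x. (\<Psi> has_derivative \<Psi>' x) (at x)"
    and inv: "\<And>x. \<Phi> (\<Psi> x) = x" "\<And>y. \<Psi> (\<Phi> y) = y" "continuous_on UNIV \<Phi>"
    and eq: "\<And>x n. n \<in> int_vecs \<Longrightarrow> \<Psi> (x + n) = \<Psi> x + n"
  shows "((\<lambda>x. \<bar>det (matrix (\<Psi>' x))\<bar> * g (\<Psi> x)) has_integral integral (cbox 0 1) g) (cbox 0 1)"
proof -
  define D where "D = \<Psi> ` unit_cube"
  have D_eq: "D = \<Phi> -` unit_cube" using inv by (auto simp: D_def image_iff) metis
  have "\<Phi> \<in> borel_measurable borel" using inv(3) by (rule borel_measurable_continuous_onI)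
  then have D1: "D \<in> sets borel"
    unfolding D_eq using measurable_sets_borel[OF _ unit_cube_borel, of \<Phi>] by simp
  have cont: "continuous_on S \<Psi>" for S
    using der by (meson continuous_at_imp_continuous_on has_derivative_continuous)
  have "bounded (\<Psi> ` cbox 0 1)" by (intro compact_imp_bounded compact_continuous_image cont compact_cbox)
  then have D2: "bounded D" by (rule bounded_subset) (use unit_cube_subset_cbox in \<open>auto simp: D_def\<close>)
  have \<Phi>n: "\<Phi> (y + n) = \<Phi> y + n" if "n \<in> int_vecs" for y n
    using eq[OF that, of "\<Phi> y"] inv by metis
  have D3: "fundamental_domain D"
    using fundamental_domain_unit_cube \<Phi>n unfolding fundamental_domain_def D_eq by fastforce
  have "(vec \<circ> g :: _ \<Rightarrow> real ^ 1) absolutely_integrable_on \<Psi> ` unit_cube"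
  proof -
    have "set_integrable lborel D g" by (rule set_integrable_bounded_borel[OF D1 D2 g(1)])
    then have "g absolutely_integrable_on D"
      using D1 g(1) borel_measurable_continuous_onI[OF g(1)] unfolding set_integrable_def
      by (subst integrable_completion) auto
    then show ?thesis by (simp add: absolutely_integrable_on_1_iff D_def o_def)
  qed
  moreover have "(\<Psi> has_derivative \<Psi>' x) (at x within unit_cube)" for x
    by (rule has_derivative_at_withinI[OF der])
  moreover have "inj_on \<Psi> unit_cube" by (rule inj_on_inverseI[of _ \<Phi>]) (rule inv)
  moreover have "unit_cube \<in> sets lebesgue" by (simp add: unit_cube_borel)
  ultimately have *: "(\<lambda>x. \<bar>det (matrix (\<Psi>' x))\<bar> *\<^sub>R (vec \<circ> g :: _ \<Rightarrow> real ^ 1) (\<Psi> x)) absolutely_integrable_on unit_cube"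
     "integral unit_cube (\<lambda>x. \<bar>det (matrix (\<Psi>' x))\<bar> *\<^sub>R (vec \<circ> g :: _ \<Rightarrow> real ^ 1) (\<Psi> x)) = integral (\<Psi> ` unit_cube) (vec \<circ> g)"
    using has_absolute_integral_change_of_variables[of unit_cube \<Psi> \<Psi>' "vec \<circ> g :: _ \<Rightarrow> real ^ 1"] by blast+
  have "(\<lambda>x. \<bar>det (matrix (\<Psi>' x))\<bar> * g (\<Psi> x)) integrable_on unit_cube"
    using *(1) by (auto simp: absolutely_integrable_on_1_iff absolutely_integrable_on_def)
  moreover have "integral unit_cube (\<lambda>x. \<bar>det (matrix (\<Psi>' x))\<bar> * g (\<Psi> x)) = integral (cbox 0 1) g"
    using *(2) integral_fundamental_domain[OF D1 D2 D3 g] by (simp add: integral_on_1_eq D_def)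
  ultimately have "((\<lambda>x. \<bar>det (matrix (\<Psi>' x))\<bar> * g (\<Psi> x)) has_integral integral (cbox 0 1) g) unit_cube"
    unfolding has_integral_iff by blast
  then show ?thesis by (rule has_integral_unit_cube[THEN iffD1])
qed

section \<open>Translation invariance and integrals of derivatives\<close>

lemma periodic_integral_translate:
  fixes g :: "real ^ 'n::{finite,wellorder} \<Rightarrow> real"
  assumes "continuous_on UNIV g" "periodic g"
  shows "integral (cbox 0 1) (\<lambda>x. g (x + c)) = integral (cbox 0 1) g"
proof -
  have "((\<lambda>x. \<bar>det (matrix (\<lambda>v::real^'n::_. v))\<bar> * g (x + c)) has_integral integral (cbox 0 1) g) (cbox 0 1)"
    by (rule periodic_integral_diffeo[OF assms, where \<Phi>="\<lambda>y. y - c"])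
       (auto intro!: derivative_eq_intros continuous_intros)
  then show ?thesis using matrix_id_mat_1 by (simp add: id_def has_integral_iff)
qed

lemma integral_cube_bound:
  fixes f :: "real ^ 'n \<Rightarrow> real"
  assumes "continuous_on UNIV f" "\<And>x. \<bar>f x\<bar> \<le> c"
  shows "\<bar>integral (cbox 0 1) f\<bar> \<le> c"
proof -
  have "norm (integral (cbox 0 1) f) \<le> integral (cbox 0 1) (\<lambda>x::real^'n. c)"
    using assms by (intro integral_norm_bound_integral integrable_continuous continuous_on_subset[OF assms(1)]) auto
  also have "\<dots> = c" by (simp add: content_cbox_cart interval_ne_empty_cart)
  finally show ?thesis by simp
qed

text \<open>A difference quotient of \<open>f\<close> has integral 0 by translation invariance, and
  the Lipschitz bound on the derivative keeps it within \<open>C * norm v * s\<close> of the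
  derivative, uniformly in \<open>x\<close>. Hence no iterated integrals occur.\<close>

lemma periodic_integral_partial_derivative:
  fixes f :: "real ^ 'n::{finite,wellorder} \<Rightarrow> real"
  assumes f: "periodic f" and der: "\<And>x. (f has_derivative f' x) (at x)"
    and lip: "\<And>x y. \<bar>f' x v - f' y v\<bar> \<le> C * norm (x - y)"
  shows "integral (cbox 0 1) (\<lambda>x. f' x v) = 0"
proof -
  have cont: "continuous_on UNIV f"
    using der by (meson continuous_at_imp_continuous_on has_derivative_continuous)
  have C0: "C \<ge> 0"
  proof -
    have "0 \<le> C * norm (axis undefined 1 - (0 :: real ^ 'n::_))"
      using lip[of "axis undefined 1" 0] by linarith
    then show ?thesis by simp
  qed
  have "C-lipschitz_on UNIV (\<lambda>x. f' x v)"
    using lip C0 by (intro lipschitz_onI) (auto simp: dist_norm dist_real_def)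
  then have cont': "continuous_on UNIV (\<lambda>x. f' x v)"
    by (rule lipschitz_on_continuous_on)
  have "\<bar>integral (cbox 0 1) (\<lambda>x. f' x v)\<bar> \<le> C * norm v * s" if s: "s > 0" for s
  proof -
    define h where "h x = (f (x + s *\<^sub>R v) - f x) / s - f' x v" for x
    have h: "\<bar>h x\<bar> \<le> C * norm v * s" for x
    proof -
      have "((\<lambda>t. f (x + t *\<^sub>R v)) has_derivative (\<lambda>h. h * f' (x + t *\<^sub>R v) v)) (at t)" for t
      proof -
        have "linear (f' (x + t *\<^sub>R v))" using der has_derivative_linear by blast
        moreover have "((\<lambda>t. f (x + t *\<^sub>R v)) has_derivative (\<lambda>h. f' (x + t *\<^sub>R v) (h *\<^sub>R v))) (at t)"
          by (rule has_derivative_compose[of "\<lambda>t. x + t *\<^sub>R v", OF _ der]) (auto intro!: derivative_eq_intros)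
        ultimately show ?thesis by (simp add: linear_cmul)
      qed
      then have "DERIV (\<lambda>t. f (x + t *\<^sub>R v)) t :> f' (x + t *\<^sub>R v) v" for t
        by (simp add: has_field_derivative_def mult_commute_abs)
      from MVT2[OF s this] obtain \<xi> where \<xi>: "0 < \<xi>" "\<xi> < s" "f (x + s *\<^sub>R v) - f x = s * f' (x + \<xi> *\<^sub>R v) v"
        by auto
      then have "h x = f' (x + \<xi> *\<^sub>R v) v - f' x v" using s by (simp add: h_def)
      also have "\<bar>\<dots>\<bar> \<le> C * norm (\<xi> *\<^sub>R v)" using lip[of "x + \<xi> *\<^sub>R v" x] by simp
      also have "\<dots> \<le> C * (norm v * s)"
        using \<xi> C0 by (intro mult_left_mono) (auto simp: mult.commute intro: mult_right_mono)
      finally show ?thesis by (simp add: mult.assoc)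
    qed
    have conth: "continuous_on UNIV h"
      unfolding h_def using s by (intro continuous_intros continuous_on_compose2[OF cont] cont') auto
    have int: "u integrable_on cbox 0 1" if "continuous_on UNIV u" for u :: "real ^ 'n::_ \<Rightarrow> real"
      using that continuous_on_subset by (intro integrable_continuous) auto
    have "(\<lambda>x. f (x + s *\<^sub>R v)) integrable_on cbox 0 1"
      by (intro int continuous_on_compose2[OF cont] continuous_intros) auto
    then have "integral (cbox 0 1) (\<lambda>x. (f (x + s *\<^sub>R v) - f x) / s) = 0"
      using periodic_integral_translate[OF cont f, of "s *\<^sub>R v"] int[OF cont]
      by (simp add: integral_diff)
    moreover have "(\<lambda>x. (f (x + s *\<^sub>R v) - f x) / s) integrable_on cbox 0 1"
      using s by (intro int continuous_intros continuous_on_compose2[OF cont]) auto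
    ultimately have "integral (cbox 0 1) h = - integral (cbox 0 1) (\<lambda>x. f' x v)"
      unfolding h_def using int[OF cont'] by (simp add: integral_diff)
    then show ?thesis using integral_cube_bound[OF conth h] by simp
  qed
  note bound = this
  have "((\<lambda>s. C * norm v * s) \<longlongrightarrow> C * norm v * 0) (at_right 0)" by (intro tendsto_intros)
  then have "\<bar>integral (cbox 0 1) (\<lambda>x. f' x v)\<bar> \<le> C * norm v * 0"
    by (rule tendsto_lowerbound)
       (auto intro: bound eventually_mono[OF eventually_at_right_less])
  then show ?thesis by simp
qed

section \<open>Euler steps along a divergence-free field\<close>

lemma det_perturbation:
  fixes A :: "real ^ 3 ^ 3"
  assumes A: "\<And>i j. \<bar>A $ i $ j\<bar> \<le> c" and tr: "A $ 1 $ 1 + A $ 2 $ 2 + A $ 3 $ 3 = 0"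
    and s: "0 \<le> s" "s \<le> 1"
  shows "\<bar>det (mat 1 + s *\<^sub>R A) - 1\<bar> \<le> s\<^sup>2 * (6 * c\<^sup>2 + 6 * c ^ 3)"
proof -
  have c: "c \<ge> 0" using A[of 1 1] by linarith
  \<comment> \<open>This is the second elementary symmetric function of the eigenvalues. The linear
    term of the determinant is the trace, hence 0; \<open>e2\<close> and \<open>det A\<close>
    consist of six products each, which explains the two factors 6.\<close>
  define e2 where "e2 = A$1$1 * A$2$2 - A$1$2 * A$2$1 + A$1$1 * A$3$3 - A$1$3 * A$3$1 + A$2$2 * A$3$3 - A$2$3 * A$3$2"
  have "det (mat 1 + s *\<^sub>R A) = 1 + s * (A$1$1 + A$2$2 + A$3$3) + s\<^sup>2 * e2 + s ^ 3 * det A"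
    unfolding det_3 e2_def by (simp add: mat_def power2_eq_square power3_eq_cube algebra_simps)
  then have eq: "det (mat 1 + s *\<^sub>R A) - 1 = s\<^sup>2 * (e2 + s * det A)"
    unfolding tr by (simp add: power2_eq_square power3_eq_cube algebra_simps)
  have p2: "\<bar>A$i$j * A$k$l\<bar> \<le> c\<^sup>2" for i j k l
    using mult_mono[OF A A] c by (simp add: abs_mult power2_eq_square)
  have p3: "\<bar>A$i$j * A$k$l * A$m$n\<bar> \<le> c ^ 3" for i j k l m n
    using mult_mono[OF p2[of i j k l] A[of m n]] c by (simp add: abs_mult power2_eq_square power3_eq_cube)
  have "\<bar>e2\<bar> \<le> 6 * c\<^sup>2"
    using p2[of 1 1 2 2] p2[of 1 2 2 1] p2[of 1 1 3 3] p2[of 1 3 3 1] p2[of 2 2 3 3] p2[of 2 3 3 2]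
    unfolding e2_def by linarith
  moreover have "\<bar>det A\<bar> \<le> 6 * c ^ 3"
    using p3[of 1 1 2 2 3 3] p3[of 1 2 2 3 3 1] p3[of 1 3 2 1 3 2] p3[of 1 1 2 3 3 2] p3[of 1 2 2 1 3 3] p3[of 1 3 2 2 3 1]
    unfolding det_3 by linarith
  moreover have "\<bar>s * det A\<bar> \<le> 1 * \<bar>det A\<bar>"
    unfolding abs_mult using s by (intro mult_right_mono) auto
  ultimately have "\<bar>e2 + s * det A\<bar> \<le> 6 * c\<^sup>2 + 6 * c ^ 3" by linarith
  then show ?thesis unfolding eq abs_mult by (simp add: mult_left_mono)
qed

text \<open>The displacement \<open>s *\<^sub>R X\<close> is a contraction with factor 1/2: the
  preimage of \<open>y\<close> is the fixed point of \<open>y - s *\<^sub>R X x\<close>, and the map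
  shrinks distances by at most a factor 2, so its inverse is 2-Lipschitz.\<close>

lemma lipschitz_perturbation_of_identity:
  fixes X :: "'a::euclidean_space \<Rightarrow> 'a"
  assumes lip: "L-lipschitz_on UNIV X" and s: "0 \<le> s" "s * L \<le> 1 / 2"
  obtains \<Phi> where "\<And>x. \<Phi> (x + s *\<^sub>R X x) = x" "\<And>y. \<Phi> y + s *\<^sub>R X (\<Phi> y) = y" "continuous_on UNIV \<Phi>"
proof -
  have sX: "dist (s *\<^sub>R X x) (s *\<^sub>R X y) \<le> (1/2) * dist x y" for x y
  proof -
    have "dist (s *\<^sub>R X x) (s *\<^sub>R X y) = s * dist (X x) (X y)"
      using s by (simp add: dist_norm scaleR_diff_right[symmetric])
    also have "\<dots> \<le> s * (L * dist x y)"
      using s lipschitz_onD[OF lip, of x y] by (intro mult_left_mono) auto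
    also have "\<dots> \<le> (1/2) * dist x y"
      using s(2) by (metis mult.assoc mult_right_mono zero_le_dist)
    finally show ?thesis .
  qed
  have "\<exists>x. y - s *\<^sub>R X x = x" for y
    using banach_fix_type[of "1/2" "\<lambda>x. y - s *\<^sub>R X x"] sX by (auto simp: dist_norm norm_minus_commute)
  then obtain \<Phi> where "\<And>y. y - s *\<^sub>R X (\<Phi> y) = \<Phi> y" by metis
  then have \<Phi>: "\<Phi> y + s *\<^sub>R X (\<Phi> y) = y" for y by (metis diff_add_cancel)
  have expand: "dist x y \<le> 2 * dist (x + s *\<^sub>R X x) (y + s *\<^sub>R X y)" for x y
  proof -
    have "x - y = (x + s *\<^sub>R X x - (y + s *\<^sub>R X y)) - (s *\<^sub>R X x - s *\<^sub>R X y)" by simp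
    then have "norm (x - y) \<le> norm (x + s *\<^sub>R X x - (y + s *\<^sub>R X y)) + norm (s *\<^sub>R X x - s *\<^sub>R X y)"
      by (metis norm_triangle_ineq4)
    then show ?thesis using sX[of x y] by (simp add: dist_norm)
  qed
  have "\<Phi> (x + s *\<^sub>R X x) = x" for x
    using expand[of "\<Phi> (x + s *\<^sub>R X x)" x] by (simp add: \<Phi>)
  moreover have "2-lipschitz_on UNIV \<Phi>"
    using expand[of "\<Phi> _" "\<Phi> _"] by (intro lipschitz_onI) (auto simp: \<Phi>)
  then have "continuous_on UNIV \<Phi>" by (rule lipschitz_on_continuous_on)
  ultimately show ?thesis using that \<Phi> by blast
qed

text \<open>Preservation of volume up to second order: the change of variables is exact once the
  Jacobian is included, and the Jacobian differs from 1 by a multiple of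
  \<open>s\<^sup>2\<close>.\<close>

lemma divergence_free_euler_map:
  fixes X :: "real ^ 3 \<Rightarrow> real ^ 3" and g :: "real ^ 3 \<Rightarrow> real"
  assumes lip: "L-lipschitz_on UNIV X" and per: "periodic X"
    and der: "\<And>x. (X has_derivative X' x) (at x)" and bd: "\<And>x v. norm (X' x v) \<le> L * norm v"
    and div: "\<And>x. (\<Sum>i\<in>UNIV. X' x (axis i 1) $ i) = 0"
    and g: "continuous_on UNIV g" "periodic g" "\<And>x. \<bar>g x\<bar> \<le> G"
    and s: "0 \<le> s" "s \<le> 1" "s * L \<le> 1 / 2"
  shows "\<bar>integral (cbox 0 1) (\<lambda>x. g (x + s *\<^sub>R X x)) - integral (cbox 0 1) g\<bar> \<le> s\<^sup>2 * (6 * L\<^sup>2 + 6 * L ^ 3) * G"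
proof -
  define C where "C = 6 * L\<^sup>2 + 6 * L ^ 3"
  define \<Psi> where "\<Psi> x = x + s *\<^sub>R X x" for x
  define \<Psi>' where "\<Psi>' x v = v + s *\<^sub>R X' x v" for x v
  have der\<Psi>: "(\<Psi> has_derivative \<Psi>' x) (at x)" for x
    unfolding \<Psi>_def \<Psi>'_def by (auto intro!: derivative_eq_intros der)
  obtain \<Phi> where \<Phi>: "\<And>x. \<Phi> (\<Psi> x) = x" "\<And>y. \<Psi> (\<Phi> y) = y" "continuous_on UNIV \<Phi>"
    unfolding \<Psi>_def using lipschitz_perturbation_of_identity[OF lip s(1,3)] by blast
  have cont\<Psi>: "continuous_on UNIV \<Psi>"
    using der\<Psi> by (meson continuous_at_imp_continuous_on has_derivative_continuous)
  define d where "d x = \<bar>det (matrix (\<Psi>' x))\<bar>" for x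
  have eq: "((\<lambda>x. d x * g (\<Psi> x)) has_integral integral (cbox 0 1) g) (cbox 0 1)"
    unfolding d_def
    by (rule periodic_integral_diffeo[OF g(1,2) der\<Psi> \<Phi>])
       (use per in \<open>simp add: \<Psi>_def periodic_def\<close>)
  have d1: "\<bar>d x - 1\<bar> \<le> s\<^sup>2 * C" for x
  proof -
    define A :: "real ^ 3 ^ 3" where "A = matrix (X' x)"
    have "matrix (\<Psi>' x) = mat 1 + s *\<^sub>R A"
      by (simp add: A_def \<Psi>'_def matrix_def mat_def vec_eq_iff axis_def)
    moreover have "\<bar>A $ i $ j\<bar> \<le> L" for i j
      using component_le_norm_cart[of "X' x (axis j 1)" i] bd[of x "axis j 1"]
      by (simp add: A_def matrix_def)
    moreover have "A $ 1 $ 1 + A $ 2 $ 2 + A $ 3 $ 3 = 0"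
      using div[of x] by (simp add: A_def matrix_def sum_3)
    ultimately have "\<bar>det (matrix (\<Psi>' x)) - 1\<bar> \<le> s\<^sup>2 * C"
      unfolding C_def using det_perturbation[of A L s] s by simp
    then show ?thesis unfolding d_def by linarith
  qed
  have "continuous_on UNIV (\<lambda>x. g (\<Psi> x))"
    by (rule continuous_on_compose2[OF g(1) cont\<Psi>]) simp
  then have int1: "(\<lambda>x. g (\<Psi> x)) integrable_on cbox 0 1"
    using continuous_on_subset by (intro integrable_continuous) auto
  have norm_le: "norm (d x * g (\<Psi> x) - g (\<Psi> x)) \<le> s\<^sup>2 * C * G" for x
  proof -
    have "norm (d x * g (\<Psi> x) - g (\<Psi> x)) = \<bar>d x - 1\<bar> * \<bar>g (\<Psi> x)\<bar>"
      by (simp add: abs_mult[symmetric] algebra_simps)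
    also have "\<dots> \<le> s\<^sup>2 * C * G"
      using d1[of x] g(3)[of "\<Psi> x"] by (intro mult_mono) (auto intro: order_trans[OF abs_ge_zero])
    finally show ?thesis .
  qed
  have int: "(\<lambda>x. d x * g (\<Psi> x)) integrable_on cbox 0 1" using eq by blast
  have "norm (integral (cbox 0 1) (\<lambda>x. d x * g (\<Psi> x) - g (\<Psi> x))) \<le> integral (cbox 0 1) (\<lambda>x::real^3. s\<^sup>2 * C * G)"
    by (intro integral_norm_bound_integral integrable_diff int int1 norm_le integrable_const)
  also have "\<dots> = s\<^sup>2 * C * G" by (simp add: content_cbox_cart interval_ne_empty_cart)
  finally have "\<bar>integral (cbox 0 1) g - integral (cbox 0 1) (\<lambda>x. g (\<Psi> x))\<bar> \<le> s\<^sup>2 * C * G"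
    using int int1 integral_unique[OF eq] by (simp add: integral_diff)
  then show ?thesis by (simp add: \<Psi>_def C_def abs_minus_commute)
qed

text \<open>The time average of a drifting coordinate would be a function increasing along the field,
  whereas a mean-zero divergence-free field has mean-zero derivatives of such functions.\<close>

lemma no_drift:
  fixes X :: "real ^ 3 \<Rightarrow> real ^ 3"
  assumes flow: "periodic_flow X L B \<phi>"
    and der: "\<And>x. (X has_derivative X' x) (at x)" and bdX': "\<And>x v. norm (X' x v) \<le> L * norm v"
    and div: "\<And>x. (\<Sum>i\<in>UNIV. X' x (axis i 1) $ i) = 0"
    and mean: "\<And>i. integral (cbox 0 1) (\<lambda>x. X x $ i) = 0"
    and K: "K > 0" and drift: "\<And>x T. T \<ge> 0 \<Longrightarrow> a \<bullet> (\<phi> T x - x) \<ge> T / K - C"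
  shows False
proof -
  interpret periodic_flow X L B \<phi> by (fact flow)
  \<comment> \<open>Long enough for the additive error \<open>C\<close> to consume at most half of
    the drift.\<close>
  define T where "T = 2 * K * (\<bar>C\<bar> + 1)"
  have T0: "T > 0" using K by (simp add: T_def)
  have "T / K = 2 * (\<bar>C\<bar> + 1)" "T / (2 * K) = \<bar>C\<bar> + 1" using K by (simp_all add: T_def)
  then have TK: "T / K - C \<ge> T / (2 * K)" by linarith
  define \<Lambda> where "\<Lambda> = norm a * exp (L * T)"
  define G where "G = norm a * (B * T)"
  have \<Lambda>: "\<Lambda> \<ge> 0" and G: "G \<ge> 0" using B_nonneg T0 by (auto simp: \<Lambda>_def G_def)
  \<comment> \<open>The left side is the drift per unit time; the right side collects the
    second-order errors of one step of size \<open>s\<close>, divided by \<open>s\<close>. It tends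
    to 0 as the number of steps grows, which is the contradiction.\<close>
  have key: "1 / (2 * K) \<le> s * (\<Lambda> * (L * B) + (6 * L\<^sup>2 + 6 * L ^ 3) * G)"
    if N: "N > 0" and s_def: "s = T / of_nat N" and s: "s \<le> 1" "s * L \<le> 1 / 2" for N :: nat and s
  proof -
    have s0: "s > 0" using N T0 by (simp add: s_def)
    have ks: "0 \<le> of_nat k * s" "of_nat k * s \<le> T" if "k < N" for k
    proof -
      have "real k * s \<le> real N * s" using that s0 by simp
      then show "of_nat k * s \<le> T" using N by (simp add: s_def)
    qed (use s0 in simp)
    \<comment> \<open>A finite average along the orbit suffices: flowing for time \<open>s\<close>
      shifts the sum by one index, so \<open>f\<close> changes by the telescoped difference
      \<open>a \<bullet> (\<phi> T x - x) / N\<close>.\<close>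
    define f where "f x = (\<Sum>k<N. a \<bullet> \<phi> (of_nat k * s) x) / of_nat N" for x
    \<comment> \<open>Subtracting the linear function makes \<open>f\<close> periodic, so that it
      can be integrated over the torus.\<close>
    define g where "g x = f x - a \<bullet> x" for x
    have f_g: "g x = (\<Sum>k<N. a \<bullet> (\<phi> (of_nat k * s) x - x)) / of_nat N" for x
      using N by (simp add: g_def f_def inner_diff_right sum_subtractf diff_divide_distrib)
    have f_lip: "\<bar>f x - f y\<bar> \<le> \<Lambda> * norm (x - y)" for x y
    proof -
      have "\<bar>a \<bullet> (\<phi> (of_nat k * s) x - \<phi> (of_nat k * s) y)\<bar> \<le> \<Lambda> * norm (x - y)" if "k < N" for k
      proof -
        have "\<bar>a \<bullet> (\<phi> (of_nat k * s) x - \<phi> (of_nat k * s) y)\<bar> \<le> norm a * norm (\<phi> (of_nat k * s) x - \<phi> (of_nat k * s) y)"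
          by (rule Cauchy_Schwarz_ineq2)
        also have "\<dots> \<le> norm a * (exp (L * (of_nat k * s)) * norm (x - y))"
          using ks[OF that] by (intro mult_left_mono flow_lipschitz) auto
        also have "\<dots> \<le> norm a * (exp (L * T) * norm (x - y))"
          using ks[OF that] L_nonneg by (intro mult_left_mono mult_right_mono) (auto intro: mult_left_mono)
        finally show ?thesis by (simp add: \<Lambda>_def mult.assoc)
      qed
      then have "(\<Sum>k<N. \<bar>a \<bullet> (\<phi> (of_nat k * s) x - \<phi> (of_nat k * s) y)\<bar>) \<le> of_nat N * (\<Lambda> * norm (x - y))"
        using sum_bounded_above[of "{..<N}" "\<lambda>k. \<bar>a \<bullet> (\<phi> (of_nat k * s) x - \<phi> (of_nat k * s) y)\<bar>"] by simp
      then have "\<bar>\<Sum>k<N. a \<bullet> (\<phi> (of_nat k * s) x - \<phi> (of_nat k * s) y)\<bar> \<le> of_nat N * (\<Lambda> * norm (x - y))"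
        by (rule order_trans[OF sum_abs])
      moreover have "f x - f y = (\<Sum>k<N. a \<bullet> (\<phi> (of_nat k * s) x - \<phi> (of_nat k * s) y)) / of_nat N"
        by (simp add: f_def inner_diff_right sum_subtractf diff_divide_distrib)
      ultimately show ?thesis using N by (simp add: pos_divide_le_eq mult.commute)
    qed
    have g_bd: "\<bar>g x\<bar> \<le> G" for x
    proof -
      have "\<bar>a \<bullet> (\<phi> (of_nat k * s) x - x)\<bar> \<le> G" if "k < N" for k
      proof -
        have "\<bar>a \<bullet> (\<phi> (of_nat k * s) x - x)\<bar> \<le> norm a * norm (\<phi> (of_nat k * s) x - x)"
          by (rule Cauchy_Schwarz_ineq2)
        also have "\<dots> \<le> norm a * (B * (of_nat k * s))"
          using ks[OF that] by (intro mult_left_mono flow_dist) auto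
        also have "\<dots> \<le> G"
          unfolding G_def using ks[OF that] B_nonneg by (intro mult_left_mono) auto
        finally show ?thesis .
      qed
      then have "(\<Sum>k<N. \<bar>a \<bullet> (\<phi> (of_nat k * s) x - x)\<bar>) \<le> of_nat N * G"
        using sum_bounded_above[of "{..<N}" "\<lambda>k. \<bar>a \<bullet> (\<phi> (of_nat k * s) x - x)\<bar>" G] by simp
      then have "\<bar>\<Sum>k<N. a \<bullet> (\<phi> (of_nat k * s) x - x)\<bar> \<le> of_nat N * G"
        by (rule order_trans[OF sum_abs])
      then show ?thesis using N by (simp add: f_g field_simps)
    qed
    have g_per: "periodic g"
      using s0 by (simp add: periodic_def f_g flow_int)
    have "continuous_on UNIV f"
      unfolding f_def using N s0 by (intro continuous_intros continuous_on_flow) auto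
    then have g_cont: "continuous_on UNIV g"
      unfolding g_def by (intro continuous_intros)
    have increase: "f (\<phi> s x) \<ge> f x + s / (2 * K)" for x
    proof -
      have "(\<Sum>k<N. a \<bullet> \<phi> (of_nat k * s) (\<phi> s x)) = (\<Sum>k<N. a \<bullet> \<phi> (of_nat (Suc k) * s) x)"
        using s0 by (intro sum.cong refl) (simp add: flow_add[symmetric] algebra_simps)
      then have "f (\<phi> s x) - f x = (\<Sum>k<N. a \<bullet> \<phi> (of_nat (Suc k) * s) x - a \<bullet> \<phi> (of_nat k * s) x) / of_nat N"
        by (simp only: f_def sum_subtractf diff_divide_distrib)
      also have "\<dots> = (a \<bullet> \<phi> (of_nat N * s) x - a \<bullet> x) / of_nat N"
        by (subst sum_lessThan_telescope) simp
      also have "of_nat N * s = T" using N by (simp add: s_def)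
      finally have "f (\<phi> s x) - f x = (a \<bullet> (\<phi> T x - x)) / of_nat N"
        by (simp add: inner_diff_right)
      also have "\<dots> \<ge> (T / (2 * K)) / of_nat N"
        using drift[of T x] T0 TK by (intro divide_right_mono) auto
      finally show ?thesis by (simp add: s_def mult.commute)
    qed
    \<comment> \<open>The left side is the increase of \<open>f\<close> under one Euler step, and
      the Lipschitz bound on \<open>f\<close> allows replacing the flow by that step. When
      integrated, the term with \<open>a \<bullet> X x\<close> vanishes because \<open>X\<close> has
      mean zero.\<close>
    have lower: "g (x + s *\<^sub>R X x) - g x + s * (a \<bullet> X x) \<ge> s / (2 * K) - \<Lambda> * (L * B * s\<^sup>2)" for x
    proof -
      have "\<bar>f (\<phi> s x) - f (x + s *\<^sub>R X x)\<bar> \<le> \<Lambda> * norm (\<phi> s x - (x + s *\<^sub>R X x))" by (rule f_lip)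
      also have "\<dots> \<le> \<Lambda> * (L * B * s\<^sup>2)"
        using flow_euler[of s x] s0 \<Lambda> by (intro mult_left_mono) (auto simp: algebra_simps)
      finally have "f (x + s *\<^sub>R X x) \<ge> f x + s / (2 * K) - \<Lambda> * (L * B * s\<^sup>2)"
        using increase[of x] by linarith
      then show ?thesis by (simp add: g_def inner_add_right)
    qed
    have int: "u integrable_on cbox 0 1" if "continuous_on UNIV u" for u :: "real ^ 3 \<Rightarrow> real"
      using that continuous_on_subset by (intro integrable_continuous) auto
    have i1: "(\<lambda>x. g (x + s *\<^sub>R X x)) integrable_on cbox 0 1"
      by (intro int continuous_on_compose2[OF g_cont] continuous_intros) auto
    have i2: "(\<lambda>x. s * (a \<bullet> X x)) integrable_on cbox 0 1" by (intro int continuous_intros)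
    have iX: "(\<lambda>x. X x $ i) integrable_on cbox 0 1" for i by (intro int continuous_intros)
    have "integral (cbox 0 1) (\<lambda>x. s * (a \<bullet> X x)) = s * integral (cbox 0 1) (\<lambda>x. \<Sum>i\<in>UNIV. a $ i * X x $ i)"
      by (simp add: inner_vec_def)
    also have "integral (cbox 0 1) (\<lambda>x. \<Sum>i\<in>UNIV. a $ i * X x $ i) = (\<Sum>i\<in>UNIV. integral (cbox 0 1) (\<lambda>x. a $ i * X x $ i))"
      by (intro integral_sum) (auto intro!: int continuous_intros)
    also have "\<dots> = 0" by (simp add: mean)
    finally have z: "integral (cbox 0 1) (\<lambda>x. s * (a \<bullet> X x)) = 0" by simp
    have "s / (2 * K) - \<Lambda> * (L * B * s\<^sup>2) = integral (cbox 0 1) (\<lambda>x::real^3. s / (2 * K) - \<Lambda> * (L * B * s\<^sup>2))"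
      by (simp add: content_cbox_cart interval_ne_empty_cart)
    also have "\<dots> \<le> integral (cbox 0 1) (\<lambda>x. g (x + s *\<^sub>R X x) - g x + s * (a \<bullet> X x))"
      using lower by (intro integral_le integrable_const integrable_add integrable_diff i1 i2 int g_cont) auto
    also have "\<dots> = integral (cbox 0 1) (\<lambda>x. g (x + s *\<^sub>R X x)) - integral (cbox 0 1) g"
      using i1 i2 int[OF g_cont] z by (simp add: integral_add integral_diff integrable_diff)
    also have "\<dots> \<le> s\<^sup>2 * (6 * L\<^sup>2 + 6 * L ^ 3) * G"
      using divergence_free_euler_map[OF lip X_periodic der bdX' div g_cont g_per g_bd _ s] s0 by auto
    finally have "s * (1 / (2 * K)) \<le> s * (s * (\<Lambda> * (L * B) + (6 * L\<^sup>2 + 6 * L ^ 3) * G))"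
      by (simp add: power2_eq_square algebra_simps)
    then show ?thesis using s0 by (rule mult_left_le_imp_le)
  qed
  have lim: "(\<lambda>N. T / of_nat (Suc N)) \<longlonglongrightarrow> 0" by (intro LIMSEQ_Suc[OF lim_const_over_n])
  have "\<forall>\<^sub>F N in sequentially. T / of_nat (Suc N) < 1"
    by (rule order_tendstoD(2)[OF lim]) simp
  moreover have "((\<lambda>N. T / of_nat (Suc N) * L) \<longlonglongrightarrow> 0 * L)" by (intro tendsto_intros lim)
  then have "\<forall>\<^sub>F N in sequentially. T / of_nat (Suc N) * L < 1 / 2"
    by (rule order_tendstoD(2)) simp
  moreover have "((\<lambda>N. T / of_nat (Suc N) * (\<Lambda> * (L * B) + (6 * L\<^sup>2 + 6 * L ^ 3) * G)) \<longlonglongrightarrow> 0 * (\<Lambda> * (L * B) + (6 * L\<^sup>2 + 6 * L ^ 3) * G))"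
    by (intro tendsto_mult_right lim)
  then have "\<forall>\<^sub>F N in sequentially. T / of_nat (Suc N) * (\<Lambda> * (L * B) + (6 * L\<^sup>2 + 6 * L ^ 3) * G) < 1 / (2 * K)"
    by (rule order_tendstoD(2)) (use K in simp)
  ultimately have "\<forall>\<^sub>F N in sequentially. False"
  proof eventually_elim
    case (elim N)
    then show ?case using key[of "Suc N" "T / of_nat (Suc N)"] by auto
  qed
  then show False by simp
qed

section \<open>Calculus of smooth maps\<close>

lemma Ck_on_differentiable:
  assumes "Ck_on (Suc k) S f" "open S" "x \<in> S"
  shows "f differentiable (at x)" "(f has_derivative frechet_derivative f (at x)) (at x)"
  using assms by (auto simp: differentiable_on_eq_differentiable_at frechet_derivative_works)

lemma Ck_on_cong:
  assumes "open S" "\<And>x. x \<in> S \<Longrightarrow> f x = g x"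
  shows "Ck_on k S f = Ck_on k S g"
  using assms(2)
proof (induction k arbitrary: f g)
  case 0 then show ?case by (auto intro: continuous_on_cong)
next
  case (Suc k)
  have "frechet_derivative f (at x) = frechet_derivative g (at x)" if "x \<in> S" for x
    unfolding frechet_derivative_def
    using has_derivative_transform_within_open[OF _ assms(1) that] Suc.prems by (metis (no_types, lifting))
  then have "Ck_on k S (\<lambda>x. frechet_derivative f (at x) v) = Ck_on k S (\<lambda>x. frechet_derivative g (at x) v)" for v
    by (intro Suc.IH) simp
  moreover have "f differentiable_on S \<longleftrightarrow> g differentiable_on S"
    using Suc.prems differentiable_transform_within[of _ _ S 1] unfolding differentiable_on_def by (metis zero_less_one)
  ultimately show ?case by simp
qed

lemma Ck_on_Suc_I:
  assumes "open S" "\<And>x. x \<in> S \<Longrightarrow> (f has_derivative f' x) (at x)" "\<And>v. Ck_on k S (\<lambda>x. f' x v)"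
  shows "Ck_on (Suc k) S f"
proof -
  have "f differentiable_on S"
    using assms(1,2) by (auto simp: differentiable_on_eq_differentiable_at differentiable_def)
  moreover have "Ck_on k S (\<lambda>x. frechet_derivative f (at x) v)" for v
    using assms(3)[of v] frechet_derivative_at[OF assms(2)]
    by (subst Ck_on_cong[OF assms(1), of _ "\<lambda>x. f' x v"]) simp_all
  ultimately show ?thesis by simp
qed

lemma Ck_on_Suc_D:
  assumes "open S" shows "Ck_on (Suc k) S f \<Longrightarrow> Ck_on k S f"
proof (induction k arbitrary: f)
  case 0
  then show ?case by (auto intro: differentiable_imp_continuous_on)
next
  case (Suc k)
  then show ?case by simp
qed

lemma Ck_on_subset:
  assumes "open S" "open T" "T \<subseteq> S" shows "Ck_on k S f \<Longrightarrow> Ck_on k T f"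
proof (induction k arbitrary: f)
  case 0 then show ?case using assms continuous_on_subset by auto
next
  case (Suc k) then show ?case using assms differentiable_on_subset by auto
qed

lemma Ck_on_local:
  assumes "\<And>x. x \<in> S \<Longrightarrow> \<exists>T. open T \<and> x \<in> T \<and> Ck_on k T f" "open S"
  shows "Ck_on k S f"
  using assms(1)
proof (induction k arbitrary: f)
  case 0
  then show ?case
    by (auto simp: continuous_on_eq_continuous_at assms(2)) (metis continuous_on_eq_continuous_at)
next
  case (Suc k)
  have "f differentiable at x" if "x \<in> S" for x
    using Suc.prems[OF that] Ck_on_differentiable by blast
  moreover have "Ck_on k S (\<lambda>x. frechet_derivative f (at x) v)" for v
    using Suc.prems by (intro Suc.IH) (metis Ck_on.simps(2))
  ultimately show ?case by (simp add: differentiable_on_eq_differentiable_at assms(2))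
qed

lemma Ck_on_const: "Ck_on k S (\<lambda>x. c)"
  by (induction k arbitrary: c) (auto simp: frechet_derivative_const)

lemma Ck_on_bounded_linear:
  assumes "open S" "bounded_linear l" shows "Ck_on k S f \<Longrightarrow> Ck_on k S (\<lambda>x. l (f x))"
proof (induction k arbitrary: f)
  case 0 then show ?case using bounded_linear.continuous_on[OF assms(2)] by auto
next
  case (Suc k)
  show ?case
  proof (rule Ck_on_Suc_I[OF assms(1)])
    show "((\<lambda>x. l (f x)) has_derivative (\<lambda>v. l (frechet_derivative f (at x) v))) (at x)" if "x \<in> S" for x
      using Ck_on_differentiable(2)[OF Suc.prems assms(1) that] bounded_linear.has_derivative[OF assms(2)] by blast
    show "Ck_on k S (\<lambda>x. l (frechet_derivative f (at x) v))" for v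
      using Suc by simp
  qed
qed

lemma Ck_on_add:
  assumes "open S" shows "Ck_on k S f \<Longrightarrow> Ck_on k S g \<Longrightarrow> Ck_on k S (\<lambda>x. f x + g x)"
proof (induction k arbitrary: f g)
  case 0 then show ?case by (auto intro: continuous_intros)
next
  case (Suc k)
  show ?case
  proof (rule Ck_on_Suc_I[OF assms])
    show "((\<lambda>x. f x + g x) has_derivative (\<lambda>v. frechet_derivative f (at x) v + frechet_derivative g (at x) v)) (at x)"
      if "x \<in> S" for x
      by (intro has_derivative_add Ck_on_differentiable(2)[OF Suc.prems(1) assms that]
            Ck_on_differentiable(2)[OF Suc.prems(2) assms that])
  qed (use Suc in simp)
qed

lemma Ck_on_scaleR:
  fixes f :: "'a::euclidean_space \<Rightarrow> real" and g :: "'a \<Rightarrow> 'b::real_normed_vector"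
  assumes "open S" shows "Ck_on k S f \<Longrightarrow> Ck_on k S g \<Longrightarrow> Ck_on k S (\<lambda>x. f x *\<^sub>R g x)"
proof (induction k arbitrary: f g)
  case 0 then show ?case by (auto intro: continuous_intros)
next
  case (Suc k)
  show ?case
  proof (rule Ck_on_Suc_I[OF assms])
    show "((\<lambda>x. f x *\<^sub>R g x) has_derivative (\<lambda>v. f x *\<^sub>R frechet_derivative g (at x) v + frechet_derivative f (at x) v *\<^sub>R g x)) (at x)"
      if "x \<in> S" for x
      by (intro has_derivative_scaleR Ck_on_differentiable(2)[OF Suc.prems(1) assms that]
            Ck_on_differentiable(2)[OF Suc.prems(2) assms that])
    show "Ck_on k S (\<lambda>x. f x *\<^sub>R frechet_derivative g (at x) v + frechet_derivative f (at x) v *\<^sub>R g x)" for v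
      using Suc.prems Ck_on_Suc_D[OF assms Suc.prems(1)] Ck_on_Suc_D[OF assms Suc.prems(2)]
      by (intro Ck_on_add[OF assms] Suc.IH) auto
  qed
qed

lemma Ck_on_sum:
  assumes "open S" "\<And>i. i \<in> I \<Longrightarrow> Ck_on k S (f i)"
  shows "Ck_on k S (\<lambda>x. \<Sum>i\<in>I. f i x)"
  using assms(2)
proof (induction I rule: infinite_finite_induct)
  case (insert i I) then show ?case by (simp add: Ck_on_add[OF assms(1)])
qed (auto simp: Ck_on_const)

lemma Ck_on_compose:
  fixes g :: "'a::euclidean_space \<Rightarrow> 'b::euclidean_space" and f :: "'b \<Rightarrow> 'c::real_normed_vector"
  assumes "open S" "open T" "g ` S \<subseteq> T"
  shows "Ck_on k T f \<Longrightarrow> Ck_on k S g \<Longrightarrow> Ck_on k S (\<lambda>x. f (g x))"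
proof (induction k arbitrary: f)
  case 0
  then show ?case using assms by (auto intro: continuous_on_compose2)
next
  case (Suc k)
  \<comment> \<open>\<open>Ck_on\<close> controls derivatives in fixed directions only, whereas the
    chain rule evaluates the derivative of \<open>f\<close> on a vector that varies with
    \<open>x\<close>. Expanding in the basis puts the variation into scalar coefficients.\<close>
  define h where "h x v = (\<Sum>b\<in>Basis. (frechet_derivative g (at x) v \<bullet> b) *\<^sub>R frechet_derivative f (at (g x)) b)" for x v
  show ?case
  proof (rule Ck_on_Suc_I[OF assms(1)])
    fix x assume x: "x \<in> S"
    have df: "(f has_derivative frechet_derivative f (at (g x))) (at (g x))"
      using x assms by (intro Ck_on_differentiable(2)[OF Suc.prems(1)]) auto
    have "((\<lambda>x. f (g x)) has_derivative (\<lambda>v. frechet_derivative f (at (g x)) (frechet_derivative g (at x) v))) (at x)"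
      by (rule has_derivative_compose[OF Ck_on_differentiable(2)[OF Suc.prems(2) assms(1) x] df])
    moreover have "frechet_derivative f (at (g x)) w = (\<Sum>b\<in>Basis. (w \<bullet> b) *\<^sub>R frechet_derivative f (at (g x)) b)" for w
    proof -
      have "linear (frechet_derivative f (at (g x)))" using df by (rule has_derivative_linear)
      then have "frechet_derivative f (at (g x)) (\<Sum>b\<in>Basis. (w \<bullet> b) *\<^sub>R b) = (\<Sum>b\<in>Basis. (w \<bullet> b) *\<^sub>R frechet_derivative f (at (g x)) b)"
        by (simp add: linear_sum linear_cmul)
      then show ?thesis by (simp only: euclidean_representation)
    qed
    then have "(\<lambda>v. frechet_derivative f (at (g x)) (frechet_derivative g (at x) v)) = h x"
      unfolding h_def by blast
    ultimately show "((\<lambda>x. f (g x)) has_derivative h x) (at x)" by simp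
  next
    fix v
    show "Ck_on k S (\<lambda>x. h x v)"
      unfolding h_def
    proof (intro Ck_on_sum[OF assms(1)] Ck_on_scaleR[OF assms(1)])
      fix b :: 'b
      show "Ck_on k S (\<lambda>x. frechet_derivative g (at x) v \<bullet> b)"
        using Suc.prems(2) by (intro Ck_on_bounded_linear[OF assms(1) bounded_linear_inner_left]) auto
      show "Ck_on k S (\<lambda>x. frechet_derivative f (at (g x)) b)"
        using Suc.prems(1) Ck_on_Suc_D[OF assms(1) Suc.prems(2)] by (intro Suc.IH) auto
    qed
  qed
qed

lemma smooth_on_cong: "open S \<Longrightarrow> (\<And>x. x \<in> S \<Longrightarrow> f x = g x) \<Longrightarrow> smooth_on S f = smooth_on S g"
  unfolding smooth_on_def by (simp cong: Ck_on_cong)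

lemma smooth_on_local:
  assumes "\<And>x. x \<in> S \<Longrightarrow> \<exists>T. open T \<and> x \<in> T \<and> smooth_on T f" "open S"
  shows "smooth_on S f"
  unfolding smooth_on_def
proof
  show "Ck_on k S f" for k
    by (rule Ck_on_local[OF _ assms(2)]) (use assms(1) in \<open>unfold smooth_on_def, blast\<close>)
qed

lemma smooth_on_derivative: "smooth_on S f \<Longrightarrow> smooth_on S (\<lambda>x. frechet_derivative f (at x) v)"
  unfolding smooth_on_def by (metis Ck_on.simps(2))

lemma smooth_on_has_derivative:
  "smooth_on S f \<Longrightarrow> open S \<Longrightarrow> x \<in> S \<Longrightarrow> (f has_derivative frechet_derivative f (at x)) (at x)"
  unfolding smooth_on_def using Ck_on_differentiable(2) by blast

lemma smooth_on_continuous_on: "smooth_on S f \<Longrightarrow> continuous_on S f"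
  unfolding smooth_on_def by (metis Ck_on.simps(1))

lemma smooth_on_const: "smooth_on S (\<lambda>x. c)"
  and smooth_on_add: "open S \<Longrightarrow> smooth_on S f \<Longrightarrow> smooth_on S g \<Longrightarrow> smooth_on S (\<lambda>x. f x + g x)"
  and smooth_on_scaleR: "open S \<Longrightarrow> smooth_on S r \<Longrightarrow> smooth_on S f \<Longrightarrow> smooth_on S (\<lambda>x. r x *\<^sub>R f x)"
  and smooth_on_sum: "open S \<Longrightarrow> (\<And>i. i \<in> I \<Longrightarrow> smooth_on S (h i)) \<Longrightarrow> smooth_on S (\<lambda>x. \<Sum>i\<in>I. h i x)"
  and smooth_on_bounded_linear: "open S \<Longrightarrow> bounded_linear l \<Longrightarrow> smooth_on S f \<Longrightarrow> smooth_on S (\<lambda>x. l (f x))"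
  unfolding smooth_on_def
  by (auto intro: Ck_on_const Ck_on_add Ck_on_scaleR Ck_on_sum Ck_on_bounded_linear)

lemma smooth_on_compose:
  fixes g :: "'a::euclidean_space \<Rightarrow> 'b::euclidean_space"
  shows "open S \<Longrightarrow> open T \<Longrightarrow> g ` S \<subseteq> T \<Longrightarrow> smooth_on T f \<Longrightarrow> smooth_on S g \<Longrightarrow> smooth_on S (\<lambda>x. f (g x))"
  unfolding smooth_on_def using Ck_on_compose by blast

lemma smooth_on_diff:
  assumes "open S" "smooth_on S f" "smooth_on S g" shows "smooth_on S (\<lambda>x. f x - g x)"
proof -
  have "smooth_on S (\<lambda>x. f x + - g x)"
    by (intro smooth_on_add assms smooth_on_bounded_linear[of S uminus] bounded_linear_minus bounded_linear_ident)
  then show ?thesis by simp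
qed

lemma smooth_on_vec:
  fixes f :: "'a::euclidean_space \<Rightarrow> real ^ 'n"
  assumes "open S" "\<And>i. smooth_on S (\<lambda>x. f x $ i)"
  shows "smooth_on S f"
proof -
  have "smooth_on S (\<lambda>x. \<Sum>i\<in>UNIV. (f x $ i) *\<^sub>R (axis i 1 :: real ^ 'n))"
    by (intro smooth_on_sum smooth_on_scaleR smooth_on_const assms)
  moreover have "(\<Sum>i\<in>UNIV. (f x $ i) *\<^sub>R axis i 1) = f x" for x
    by (metis basis_expansion scalar_mult_eq_scaleR)
  ultimately show ?thesis by simp
qed

section \<open>Symmetry of second derivatives\<close>

lemma mixed_difference_mvt:
  fixes f :: "'a::euclidean_space \<Rightarrow> real"
  assumes S: "convex S" "open S" and f: "Ck_on 2 S f" and h: "h > 0"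
    and in_S: "x \<in> S" "x + h *\<^sub>R u \<in> S" "x + h *\<^sub>R v \<in> S" "x + h *\<^sub>R u + h *\<^sub>R v \<in> S"
  obtains \<xi> \<eta> where "0 < \<xi>" "\<xi> < h" "0 < \<eta>" "\<eta> < h"
    "f (x + h *\<^sub>R u + h *\<^sub>R v) - f (x + h *\<^sub>R u) - f (x + h *\<^sub>R v) + f x
     = h * h * frechet_derivative (\<lambda>y. frechet_derivative f (at y) u) (at (x + \<xi> *\<^sub>R u + \<eta> *\<^sub>R v)) v"
proof -
  have C: "Ck_on (Suc (Suc 0)) S f" using f by (simp add: numeral_2_eq_2)
  have C': "Ck_on (Suc 0) S (\<lambda>y. frechet_derivative f (at y) u)" using C by simp
  have along: "((\<lambda>t. g (y + t *\<^sub>R w)) has_real_derivative frechet_derivative g (at (y + t *\<^sub>R w)) w) (at t)"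
    if "Ck_on (Suc k) S g" "y + t *\<^sub>R w \<in> S" for g :: "'a \<Rightarrow> real" and y w t k
  proof -
    have d: "(g has_derivative frechet_derivative g (at (y + t *\<^sub>R w))) (at (y + t *\<^sub>R w))"
      by (rule Ck_on_differentiable(2)[OF that(1) S(2) that(2)])
    have "((\<lambda>t. g (y + t *\<^sub>R w)) has_derivative (\<lambda>h. frechet_derivative g (at (y + t *\<^sub>R w)) (h *\<^sub>R w))) (at t)"
      by (rule has_derivative_compose[of "\<lambda>t. y + t *\<^sub>R w", OF _ d]) (auto intro!: derivative_eq_intros)
    then show ?thesis
      using has_derivative_linear[OF d] by (simp add: linear_cmul has_field_derivative_def mult_commute_abs)
  qed
  have mid: "y + t *\<^sub>R w \<in> S" if "y \<in> S" "y + h *\<^sub>R w \<in> S" "0 \<le> t" "t \<le> h" for y w t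
  proof -
    have "(1 - t / h) *\<^sub>R y + (t / h) *\<^sub>R (y + h *\<^sub>R w) \<in> S"
      using h that by (intro convexD[OF S(1)]) auto
    then show ?thesis using h by (simp add: algebra_simps)
  qed
  \<comment> \<open>The second difference is the increment of \<open>g\<close>. The mean value
    theorem along \<open>u\<close> turns it into an increment of the derivative in direction
    \<open>u\<close>, to which the theorem is applied once more along \<open>v\<close>.\<close>
  define g where "g t = f (x + h *\<^sub>R v + t *\<^sub>R u) - f (x + t *\<^sub>R u)" for t
  have in_S': "x + h *\<^sub>R v + h *\<^sub>R u \<in> S" using in_S(4) by (simp add: add_ac)
  define g1 where "g1 t = frechet_derivative f (at (x + h *\<^sub>R v + t *\<^sub>R u)) u - frechet_derivative f (at (x + t *\<^sub>R u)) u" for t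
  have g': "DERIV g t :> g1 t" if "0 \<le> t" "t \<le> h" for t
    unfolding g_def g1_def
    by (intro DERIV_diff along[OF C] mid[OF in_S(3) in_S' that] mid[OF in_S(1,2) that])
  obtain \<xi> where \<xi>: "0 < \<xi>" "\<xi> < h" "g h - g 0 = (h - 0) * g1 \<xi>"
    using MVT2[of 0 h g g1] h g' by blast
  define k where "k t = frechet_derivative f (at (x + \<xi> *\<^sub>R u + t *\<^sub>R v)) u" for t
  define k1 where "k1 t = frechet_derivative (\<lambda>y. frechet_derivative f (at y) u) (at (x + \<xi> *\<^sub>R u + t *\<^sub>R v)) v" for t
  have b1: "x + \<xi> *\<^sub>R u \<in> S" by (rule mid[OF in_S(1,2)]) (use \<xi> in auto)
  have "x + h *\<^sub>R v + \<xi> *\<^sub>R u \<in> S" by (rule mid[OF in_S(3) in_S']) (use \<xi> in auto)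
  then have b2: "x + \<xi> *\<^sub>R u + h *\<^sub>R v \<in> S" by (simp add: add_ac)
  have k': "DERIV k t :> k1 t" if "0 \<le> t" "t \<le> h" for t
    unfolding k_def k1_def by (rule along[OF C' mid[OF b1 b2 that]])
  obtain \<eta> where \<eta>: "0 < \<eta>" "\<eta> < h" "k h - k 0 = (h - 0) * k1 \<eta>"
    using MVT2[of 0 h k k1] h k' by blast
  have "f (x + h *\<^sub>R u + h *\<^sub>R v) - f (x + h *\<^sub>R u) - f (x + h *\<^sub>R v) + f x = g h - g 0"
    by (simp add: g_def add_ac)
  also have "\<dots> = h * (k h - k 0)"
  proof -
    have c: "x + h *\<^sub>R v + \<xi> *\<^sub>R u = x + \<xi> *\<^sub>R u + h *\<^sub>R v" by (simp add: add_ac)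
    show ?thesis using \<xi>(3) unfolding g1_def k_def c by simp
  qed
  also have "\<dots> = h * h * k1 \<eta>" using \<eta>(3) by simp
  finally show ?thesis using that[OF \<xi>(1,2) \<eta>(1,2)] by (simp only: k1_def)
qed

text \<open>The second difference over a small parallelogram is symmetric in \<open>u\<close> and
  \<open>v\<close>. It equals the area factor \<open>h * h\<close> times either mixed derivative at
  a nearby point, and continuity moves both points to \<open>x\<close>.\<close>

lemma symmetric_second_derivative:
  fixes f :: "'a::euclidean_space \<Rightarrow> real"
  assumes S: "open S" "x \<in> S" and f: "Ck_on 2 S f"
  shows "frechet_derivative (\<lambda>y. frechet_derivative f (at y) u) (at x) v
       = frechet_derivative (\<lambda>y. frechet_derivative f (at y) v) (at x) u"
proof -
  obtain r where r: "r > 0" "ball x r \<subseteq> S" using S open_contains_ball by blast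
  have fr: "Ck_on 2 (ball x r) f" using Ck_on_subset[OF S(1) _ r(2) f] by simp
  define D where "D u v y = frechet_derivative (\<lambda>y. frechet_derivative f (at y) u) (at y) v" for u v y
  have contD: "isCont (D u v) x" for u v
  proof -
    have "continuous_on S (D u v)" using f by (simp add: numeral_2_eq_2 D_def)
    then show ?thesis using S by (simp add: continuous_on_eq_continuous_at)
  qed
  \<comment> \<open>The summand 1 puts the parallelogram with sides \<open>h *\<^sub>R u\<close> and
    \<open>h *\<^sub>R v\<close> strictly inside the ball of radius \<open>h * M\<close>.\<close>
  define M where "M = norm u + norm v + 1"
  have M: "M > 0" by (simp add: M_def add_nonneg_pos)
  have small: "x + a *\<^sub>R u + b *\<^sub>R v \<in> ball x (h * M)" if "0 \<le> a" "a \<le> h" "0 \<le> b" "b \<le> h" "h > 0" for a b h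
  proof -
    have "norm (a *\<^sub>R u + b *\<^sub>R v) \<le> a * norm u + b * norm v"
      using norm_triangle_ineq[of "a *\<^sub>R u" "b *\<^sub>R v"] that by simp
    also have "\<dots> \<le> h * norm u + h * norm v" using that by (intro add_mono mult_right_mono) auto
    also have "\<dots> < h * M" using that by (simp add: M_def algebra_simps)
    finally have "norm (a *\<^sub>R u + b *\<^sub>R v) < h * M" .
    moreover have "dist x (x + a *\<^sub>R u + b *\<^sub>R v) = norm (a *\<^sub>R u + b *\<^sub>R v)"
      using norm_minus_cancel[of "a *\<^sub>R u + b *\<^sub>R v"] by (simp add: dist_norm algebra_simps)
    ultimately show ?thesis by simp
  qed
  have "\<bar>D u v x - D v u x\<bar> \<le> e" if e: "e > 0" for e
  proof -
    obtain d1 where d1: "d1 > 0" "\<And>y. dist y x < d1 \<Longrightarrow> dist (D u v y) (D u v x) < e / 2"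
      using contD[of u v] e unfolding continuous_at_eps_delta by (metis half_gt_zero)
    obtain d2 where d2: "d2 > 0" "\<And>y. dist y x < d2 \<Longrightarrow> dist (D v u y) (D v u x) < e / 2"
      using contD[of v u] e unfolding continuous_at_eps_delta by (metis half_gt_zero)
    define h where "h = min r (min d1 d2) / M"
    have h: "h > 0" using r d1 d2 M by (simp add: h_def)
    have "h * M = min r (min d1 d2)" using M by (simp add: h_def)
    then have hM: "h * M \<le> r" "h * M \<le> d1" "h * M \<le> d2" by auto
    have b: "x + a *\<^sub>R u + b *\<^sub>R v \<in> ball x r" "dist (x + a *\<^sub>R u + b *\<^sub>R v) x < d1" "dist (x + a *\<^sub>R u + b *\<^sub>R v) x < d2"
      if "0 \<le> a" "a \<le> h" "0 \<le> b" "b \<le> h" for a b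
      using small[OF that h] hM by (auto simp: dist_commute)
    have corners: "x \<in> ball x r" "x + h *\<^sub>R u \<in> ball x r" "x + h *\<^sub>R v \<in> ball x r" "x + h *\<^sub>R u + h *\<^sub>R v \<in> ball x r" "x + h *\<^sub>R v + h *\<^sub>R u \<in> ball x r"
      using b(1)[of 0 0] b(1)[of h 0] b(1)[of 0 h] b(1)[of h h] h by (auto simp: add_ac)
    obtain \<xi> \<eta> where 1: "0 < \<xi>" "\<xi> < h" "0 < \<eta>" "\<eta> < h"
      "f (x + h *\<^sub>R u + h *\<^sub>R v) - f (x + h *\<^sub>R u) - f (x + h *\<^sub>R v) + f x = h * h * D u v (x + \<xi> *\<^sub>R u + \<eta> *\<^sub>R v)"
      unfolding D_def using mixed_difference_mvt[OF convex_ball open_ball fr h corners(1,2,3,4)] by blast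
    obtain \<xi>' \<eta>' where 2: "0 < \<xi>'" "\<xi>' < h" "0 < \<eta>'" "\<eta>' < h"
      "f (x + h *\<^sub>R v + h *\<^sub>R u) - f (x + h *\<^sub>R v) - f (x + h *\<^sub>R u) + f x = h * h * D v u (x + \<xi>' *\<^sub>R v + \<eta>' *\<^sub>R u)"
      unfolding D_def using mixed_difference_mvt[OF convex_ball open_ball fr h corners(1,3,2,5)] by blast
    have "h * h * D u v (x + \<xi> *\<^sub>R u + \<eta> *\<^sub>R v) = h * h * D v u (x + \<eta>' *\<^sub>R u + \<xi>' *\<^sub>R v)"
    proof -
      have c: "x + h *\<^sub>R v + h *\<^sub>R u = x + h *\<^sub>R u + h *\<^sub>R v"
        "x + \<xi>' *\<^sub>R v + \<eta>' *\<^sub>R u = x + \<eta>' *\<^sub>R u + \<xi>' *\<^sub>R v"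
        by (simp_all add: add_ac)
      show ?thesis using 1(5) 2(5)[unfolded c] by linarith
    qed
    then have eq: "D u v (x + \<xi> *\<^sub>R u + \<eta> *\<^sub>R v) = D v u (x + \<eta>' *\<^sub>R u + \<xi>' *\<^sub>R v)" using h by simp
    have "dist (D u v (x + \<xi> *\<^sub>R u + \<eta> *\<^sub>R v)) (D u v x) < e / 2" using 1 by (intro d1 b) auto
    moreover have "dist (D v u (x + \<eta>' *\<^sub>R u + \<xi>' *\<^sub>R v)) (D v u x) < e / 2" using 2 by (intro d2 b) auto
    ultimately show ?thesis unfolding eq dist_real_def by linarith
  qed
  then have "\<bar>D u v x - D v u x\<bar> \<le> 0" by (rule field_le_epsilon[of _ 0, simplified])
  then show ?thesis by (simp add: D_def)
qed

section \<open>Curl fields on the torus\<close>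

definition pderiv_at :: "3 \<Rightarrow> (real ^ 3 \<Rightarrow> real) \<Rightarrow> real ^ 3 \<Rightarrow> real" where
  "pderiv_at i f x = frechet_derivative f (at x) (axis i 1)"

definition curl :: "(real ^ 3 \<Rightarrow> real ^ 3) \<Rightarrow> real ^ 3 \<Rightarrow> real ^ 3" where
  "curl \<beta> x = vector
    [pderiv_at 2 (\<lambda>y. \<beta> y $ 3) x - pderiv_at 3 (\<lambda>y. \<beta> y $ 2) x,
     pderiv_at 3 (\<lambda>y. \<beta> y $ 1) x - pderiv_at 1 (\<lambda>y. \<beta> y $ 3) x,
     pderiv_at 1 (\<lambda>y. \<beta> y $ 2) x - pderiv_at 2 (\<lambda>y. \<beta> y $ 1) x]"

lemma curl_nth:
  "curl \<beta> x $ 1 = pderiv_at 2 (\<lambda>y. \<beta> y $ 3) x - pderiv_at 3 (\<lambda>y. \<beta> y $ 2) x"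
  "curl \<beta> x $ 2 = pderiv_at 3 (\<lambda>y. \<beta> y $ 1) x - pderiv_at 1 (\<lambda>y. \<beta> y $ 3) x"
  "curl \<beta> x $ 3 = pderiv_at 1 (\<lambda>y. \<beta> y $ 2) x - pderiv_at 2 (\<lambda>y. \<beta> y $ 1) x"
  by (simp_all add: curl_def)

lemma periodic_frechet_derivative:
  fixes f :: "real ^ 'n \<Rightarrow> 'b::real_normed_vector"
  assumes "periodic f" "\<And>x. f differentiable (at x)"
  shows "periodic (\<lambda>x. frechet_derivative f (at x))"
  unfolding periodic_def
proof (intro allI ballI)
  fix x n :: "real ^ 'n" assume n: "n \<in> int_vecs"
  have d: "(f has_derivative frechet_derivative f (at (x + n))) (at (x + n))"
    using assms(2) frechet_derivative_works by blast
  have "((\<lambda>y. f (y + n)) has_derivative (\<lambda>v. frechet_derivative f (at (x + n)) v)) (at x)"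
    by (rule has_derivative_compose[of "\<lambda>y. y + n" "\<lambda>v. v", OF _ d]) (auto intro!: derivative_eq_intros)
  moreover have "(\<lambda>y. f (y + n)) = f" using assms(1) n by (simp add: periodic_def fun_eq_iff)
  ultimately have "(f has_derivative frechet_derivative f (at (x + n))) (at x)" by simp
  then show "frechet_derivative f (at (x + n)) = frechet_derivative f (at x)"
    by (rule frechet_derivative_at)
qed

text \<open>Compactness bounds the derivative for each fixed direction; summing the bounds for the
  finitely many axes gives one for the operator norm.\<close>

lemma periodic_smooth_lipschitz:
  fixes f :: "real ^ 'n \<Rightarrow> 'b::real_normed_vector"
  assumes f: "smooth_on UNIV f" "periodic f"
  obtains L where "L-lipschitz_on UNIV f" "\<And>x v. norm (frechet_derivative f (at x) v) \<le> L * norm v"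
proof -
  define D where "D x = frechet_derivative f (at x)" for x
  have der: "(f has_derivative D x) (at x)" for x
    unfolding D_def using smooth_on_has_derivative[OF f(1)] by simp
  have "periodic D" unfolding D_def
    using der by (intro periodic_frechet_derivative f differentiableI)
  then have "periodic (\<lambda>x. D x v)" for v by (simp add: periodic_def)
  moreover have "continuous_on UNIV (\<lambda>x. D x v)" for v
    unfolding D_def by (intro smooth_on_continuous_on smooth_on_derivative f)
  ultimately have "\<exists>C>0. \<forall>x. norm (D x v) \<le> C" for v
    using periodic_bounded by metis
  then obtain C where C: "\<And>v. C v > 0" "\<And>v x. norm (D x v) \<le> C v" by metis
  define L where "L = (\<Sum>i\<in>UNIV. C (axis i (1::real) :: real ^ 'n))"
  have L0: "L \<ge> 0" unfolding L_def using C(1) by (intro sum_nonneg less_imp_le)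
  have bd: "norm (D x v) \<le> L * norm v" for x v
  proof -
    have lin: "linear (D x)" using der by (rule has_derivative_linear)
    have "D x (\<Sum>i\<in>UNIV. (v $ i) *\<^sub>R axis i 1) = (\<Sum>i\<in>UNIV. (v $ i) *\<^sub>R D x (axis i 1))"
      by (simp only: linear_sum[OF lin] linear_cmul[OF lin])
    moreover have "(\<Sum>i\<in>UNIV. (v $ i) *\<^sub>R axis i 1) = v"
      by (metis basis_expansion scalar_mult_eq_scaleR)
    ultimately have "norm (D x v) = norm (\<Sum>i\<in>UNIV. (v $ i) *\<^sub>R D x (axis i 1))" by metis
    also have "\<dots> \<le> (\<Sum>i\<in>UNIV. norm v * C (axis i 1))"
      by (intro sum_norm_le) (auto intro!: mult_mono component_le_norm_cart C)
    also have "\<dots> = L * norm v" by (simp add: L_def sum_distrib_left mult.commute)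
    finally show ?thesis .
  qed
  have "norm (f x - f y) \<le> L * norm (x - y)" for x y
  proof (rule differentiable_bound[of UNIV f D])
    show "onorm (D z) \<le> L" for z by (rule onorm_bound[OF L0 bd])
  qed (use der in auto)
  then have "L-lipschitz_on UNIV f" using L0 by (intro lipschitz_onI) (auto simp: dist_norm)
  then show ?thesis using that bd unfolding D_def by blast
qed

lemma smooth_on_nth: "open S \<Longrightarrow> smooth_on S f \<Longrightarrow> smooth_on S (\<lambda>x. f x $ i)"
  by (rule smooth_on_bounded_linear[OF _ bounded_linear_vec_nth])

lemma smooth_on_pderiv_at: "smooth_on S f \<Longrightarrow> smooth_on S (pderiv_at i f)"
  using smooth_on_derivative[of S f "axis i 1"] by (simp add: pderiv_at_def[abs_def])

lemma smooth_on_curl: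
  assumes "smooth_on UNIV \<beta>"
  shows "smooth_on UNIV (curl \<beta>)"
proof (rule smooth_on_vec)
  have "smooth_on UNIV (\<lambda>x. pderiv_at i (\<lambda>y. \<beta> y $ j) x - pderiv_at j (\<lambda>y. \<beta> y $ i) x)" for i j
    by (intro smooth_on_diff smooth_on_pderiv_at smooth_on_nth assms) auto
  then show "smooth_on UNIV (\<lambda>x. curl \<beta> x $ i)" for i
    using exhaust_3[of i] by (auto simp: curl_nth)
qed simp

lemma periodic_pderiv_at:
  assumes "smooth_on UNIV f" "periodic f"
  shows "periodic (pderiv_at i f)"
proof -
  have "f differentiable (at x)" for x
    using smooth_on_has_derivative[OF assms(1)] by (auto simp: differentiable_def)
  from periodic_frechet_derivative[OF assms(2) this] show ?thesis
    by (simp add: periodic_def pderiv_at_def)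
qed

lemma periodic_curl:
  assumes "smooth_on UNIV \<beta>" "periodic \<beta>"
  shows "periodic (curl \<beta>)"
proof -
  have "periodic (pderiv_at i (\<lambda>y. \<beta> y $ j))" for i j
    using assms by (intro periodic_pderiv_at smooth_on_nth) (auto simp: periodic_def)
  then show ?thesis by (simp add: periodic_def curl_def)
qed

text \<open>Periodicity of the primitive \<open>\<beta>\<close> is essential: a constant field is
  the curl of a linear \<open>\<beta>\<close>, yet its mean need not vanish.\<close>

lemma integral_curl:
  assumes "smooth_on UNIV \<beta>" "periodic \<beta>"
  shows "integral (cbox 0 1) (\<lambda>x. curl \<beta> x $ k) = 0"
proof -
  have s: "smooth_on UNIV (\<lambda>y. \<beta> y $ j)" for j by (intro smooth_on_nth assms) auto
  have p: "periodic (\<lambda>y. \<beta> y $ j)" for j using assms by (simp add: periodic_def)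
  have zero: "integral (cbox 0 1) (pderiv_at i (\<lambda>y. \<beta> y $ j)) = 0" for i j
  proof -
    obtain L where L: "L-lipschitz_on UNIV (pderiv_at i (\<lambda>y. \<beta> y $ j))"
      using periodic_smooth_lipschitz[OF smooth_on_pderiv_at[OF s] periodic_pderiv_at[OF s p]] by metis
    have "integral (cbox 0 1) (\<lambda>x. frechet_derivative (\<lambda>y. \<beta> y $ j) (at x) (axis i 1)) = 0"
      by (rule periodic_integral_partial_derivative[OF p smooth_on_has_derivative[OF s]])
         (use lipschitz_onD[OF L UNIV_I UNIV_I] in \<open>auto simp: dist_norm pderiv_at_def\<close>)
    then show ?thesis by (simp add: pderiv_at_def[abs_def])
  qed
  have "pderiv_at i (\<lambda>y. \<beta> y $ j) integrable_on cbox 0 1" for i j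
    by (intro integrable_continuous continuous_on_subset[OF smooth_on_continuous_on[OF smooth_on_pderiv_at[OF s]]]) auto
  then have "integral (cbox 0 1) (\<lambda>x. pderiv_at i (\<lambda>y. \<beta> y $ j) x - pderiv_at j (\<lambda>y. \<beta> y $ i) x) = 0" for i j
    by (simp add: integral_diff zero)
  then show ?thesis using exhaust_3[of k] by (auto simp: curl_nth)
qed

lemma divergence_curl:
  assumes "smooth_on UNIV \<beta>"
  shows "(\<Sum>i\<in>UNIV. frechet_derivative (curl \<beta>) (at x) (axis i 1) $ i) = 0"
proof -
  have s: "smooth_on UNIV (\<lambda>y. \<beta> y $ j)" for j by (intro smooth_on_nth assms) auto
  have comp: "frechet_derivative (curl \<beta>) (at x) (axis i 1) $ i = pderiv_at i (\<lambda>y. curl \<beta> y $ i) x" for i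
  proof -
    have "((\<lambda>y. curl \<beta> y $ i) has_derivative (\<lambda>v. frechet_derivative (curl \<beta>) (at x) v $ i)) (at x)"
      using smooth_on_has_derivative[OF smooth_on_curl[OF assms]]
      by (intro bounded_linear.has_derivative[OF bounded_linear_vec_nth]) auto
    from frechet_derivative_at[OF this, symmetric] show ?thesis
      unfolding pderiv_at_def by simp
  qed
  have diff: "pderiv_at i (\<lambda>y. f y - g y) x = pderiv_at i f x - pderiv_at i g x"
    if "smooth_on UNIV f" "smooth_on UNIV g" for i f g
  proof -
    have "((\<lambda>y. f y - g y) has_derivative (\<lambda>v. frechet_derivative f (at x) v - frechet_derivative g (at x) v)) (at x)"
      using that by (intro has_derivative_diff smooth_on_has_derivative) auto
    from frechet_derivative_at[OF this, symmetric] show ?thesis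
      unfolding pderiv_at_def by simp
  qed
  have sym: "pderiv_at i (pderiv_at k (\<lambda>y. \<beta> y $ j)) x = pderiv_at k (pderiv_at i (\<lambda>y. \<beta> y $ j)) x" for i j k
    unfolding pderiv_at_def[abs_def]
    by (rule symmetric_second_derivative[of UNIV]) (use s in \<open>auto simp: smooth_on_def\<close>)
  show ?thesis
    by (simp add: comp sum_3 curl_nth diff smooth_on_pderiv_at s sym[of 2 1] sym[of 3 1] sym[of 3 2])
qed

lemma curl_flow_exists:
  assumes \<beta>: "smooth_on UNIV \<beta>" "periodic \<beta>" and nz: "\<And>x. curl \<beta> x \<noteq> 0"
  obtains L B \<phi> where "periodic_flow (curl \<beta>) L B \<phi>"
    "\<And>x v. norm (frechet_derivative (curl \<beta>) (at x) v) \<le> L * norm v"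
proof -
  have X: "smooth_on UNIV (curl \<beta>)" "periodic (curl \<beta>)"
    by (rule smooth_on_curl[OF \<beta>(1)], rule periodic_curl[OF \<beta>])
  obtain L where L: "L-lipschitz_on UNIV (curl \<beta>)"
    "\<And>x v. norm (frechet_derivative (curl \<beta>) (at x) v) \<le> L * norm v"
    using periodic_smooth_lipschitz[OF X] by blast
  obtain B where B: "\<And>x. norm (curl \<beta> x) \<le> B"
    using periodic_bounded[OF X(2) smooth_on_continuous_on[OF X(1)]] by blast
  have "\<forall>x. \<exists>u. u 0 = x \<and> (\<forall>t\<ge>0. (u has_vector_derivative curl \<beta> (u t)) (at t within {0..}))"
    using lipschitz_ode_exists[OF L(1) B] by blast
  then obtain u where u: "\<And>x. u x 0 = x" "\<And>x t. t \<ge> 0 \<Longrightarrow> (u x has_vector_derivative curl \<beta> (u x t)) (at t within {0..})"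
    by metis
  have "periodic_flow (curl \<beta>) L B (\<lambda>t x. u x t)"
    by unfold_locales (use L B u X nz in auto)
  then show ?thesis using that L(2) by blast
qed

lemma curl_flow_unbounded_period:
  assumes \<beta>: "smooth_on UNIV \<beta>" "periodic \<beta>"
    and flow: "periodic_flow (curl \<beta>) L B \<phi>"
    and L: "\<And>x v. norm (frechet_derivative (curl \<beta>) (at x) v) \<le> L * norm v"
    and K: "K > 0" and per: "\<And>x. \<exists>t\<in>{0<..K}. \<phi> t x - x \<in> int_vecs"
  shows False
proof -
  interpret periodic_flow "curl \<beta>" L B \<phi> by (fact flow)
  show False
  proof (rule rotation_vector_cases[OF K per])
    assume "\<And>x. \<exists>t\<in>{0<..K}. \<phi> t x = x"
    then show False by (rule not_all_orbits_closed[OF K])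
  next
    fix a C assume "\<And>x T. T \<ge> 0 \<Longrightarrow> a \<bullet> (\<phi> T x - x) \<ge> T / K - C"
    then show False
      by (rule no_drift[OF flow smooth_on_has_derivative[OF smooth_on_curl[OF \<beta>(1)] open_UNIV UNIV_I] L
          divergence_curl[OF \<beta>(1)] integral_curl[OF \<beta>] K])
  qed
qed

section \<open>The embedded torus\<close>

lemma torus_cover_nth [simp]: "torus_cover x $ i = cis (2 * pi * x $ i)"
  by (simp add: torus_cover_def)

lemma topspace_torus: "topspace torus = range torus_cover"
proof
  show "topspace torus \<subseteq> (range torus_cover :: (complex ^ 'n) set)"
  proof
    fix z :: "complex ^ 'n" assume "z \<in> topspace torus"
    then have "norm (z $ i) = 1" for i by (simp add: torus_def)
    then have "z $ i = cis (Arg (z $ i))" for i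
      using rcis_cmod_Arg[of "z $ i"] by (simp add: rcis_def)
    then have "z = torus_cover (\<chi> i. Arg (z $ i) / (2 * pi))"
      by (simp add: vec_eq_iff)
    then show "z \<in> range torus_cover" by blast
  qed
  show "range torus_cover \<subseteq> (topspace torus :: (complex ^ 'n) set)"
    by (auto simp: torus_def)
qed

lemma continuous_map_torus_cover: "continuous_map euclidean torus torus_cover"
proof -
  have "continuous_on UNIV torus_cover" by (intro continuous_on_torus_cover continuous_on_id)
  then show ?thesis by (auto simp: torus_def continuous_map_in_subtopology)
qed

lemma inj_on_torus_cover_ball: "inj_on torus_cover (ball x (1 / 2))"
proof (rule inj_onI)
  fix y z assume y: "y \<in> ball x (1 / 2)" and z: "z \<in> ball x (1 / 2)" and eq: "torus_cover y = torus_cover z"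
  then have "norm (y - z) < 1"
    using dist_triangle_half_l[of y x 1 z] by (simp add: dist_norm norm_minus_commute)
  then show "y = z" using eq int_vecs_small[of "y - z"] by (simp add: torus_cover_eq_iff)
qed

text \<open>The curve \<open>\<xi>\<close> is only continuous, so the chain rule does not apply.
  Injectivity of \<open>D\<close> bounds \<open>norm (\<xi> t - x)\<close> by a multiple of
  \<open>t\<close>; hence \<open>D ((\<xi> t - x) /\<^sub>R t)\<close> approaches \<open>w\<close>,
  and the range of \<open>D\<close> is closed.\<close>

lemma velocity_in_range_of_immersion:
  fixes G :: "'a::euclidean_space \<Rightarrow> 'b::euclidean_space" and \<xi> :: "real \<Rightarrow> 'a"
  assumes G: "(G has_derivative D) (at x)" and inj: "inj D"
    and \<xi>: "isCont \<xi> 0" "\<xi> 0 = x"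
    and w: "((\<lambda>t. G (\<xi> t)) has_vector_derivative w) (at 0)"
  shows "w \<in> range D"
proof -
  have lin: "linear D" using G by (rule has_derivative_linear)
  obtain \<kappa> where \<kappa>: "\<kappa> > 0" "\<And>v. \<kappa> * norm v \<le> norm (D v)"
    using linear_inj_bounded_below_pos[OF lin inj] by blast
  have sub: "subspace (range D)"
    using linear_subspace_image[OF lin subspace_UNIV] .
  have "\<exists>y\<in>range D. dist y w < e" if e: "e > 0" for e
  proof -
    define W where "W = norm w + 1"
    have W: "W > 0" by (simp add: W_def add_nonneg_pos)
    \<comment> \<open>The first bound lets half of \<open>\<kappa> * norm h\<close> absorb the
      linearization error, giving \<open>\<kappa> * norm h \<le> 2 * (t * W)\<close>; with this, the
      second makes that error at most \<open>e / 4 * t\<close>.\<close>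
    define \<epsilon> where "\<epsilon> = min (\<kappa> / 2) (e * \<kappa> / (8 * W))"
    have \<epsilon>: "\<epsilon> > 0" using \<kappa> e W by (simp add: \<epsilon>_def)
    have \<epsilon>1: "\<epsilon> \<le> \<kappa> / 2" "\<epsilon> \<le> e * \<kappa> / (8 * W)" by (simp_all add: \<epsilon>_def)
    obtain d where d: "d > 0" "\<And>y. norm (y - x) < d \<Longrightarrow> norm (G y - G x - D (y - x)) \<le> \<epsilon> * norm (y - x)"
      using G[unfolded has_derivative_at_alt] \<epsilon> by blast
    obtain d1 where d1: "d1 > 0" "\<And>t. dist t 0 < d1 \<Longrightarrow> dist (\<xi> t) (\<xi> 0) < d"
      using \<xi>(1) d(1) unfolding continuous_at_eps_delta by blast
    define \<epsilon>2 where "\<epsilon>2 = min 1 (e / 2)"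
    have "\<epsilon>2 > 0" using e by (simp add: \<epsilon>2_def)
    have wd: "((\<lambda>t. G (\<xi> t)) has_derivative (\<lambda>t. t *\<^sub>R w)) (at 0)"
      using w by (simp add: has_vector_derivative_def)
    obtain d2 where d2: "d2 > 0" "\<And>t. norm (t - 0) < d2 \<Longrightarrow> norm (G (\<xi> t) - G (\<xi> 0) - (t - 0) *\<^sub>R w) \<le> \<epsilon>2 * norm (t - 0)"
      using wd[unfolded has_derivative_at_alt] \<open>\<epsilon>2 > 0\<close> by blast
    define t where "t = min d1 d2 / 2"
    have t: "t > 0" "t < d1" "t < d2" using d1 d2 by (auto simp: t_def)
    define h where "h = \<xi> t - x"
    define \<Delta> where "\<Delta> = G (\<xi> t) - G x"
    have h: "norm h < d" using d1(2)[of t] t \<xi>(2) by (simp add: h_def dist_norm)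
    have r: "norm (\<Delta> - D h) \<le> \<epsilon> * norm h"
      using d(2)[of "\<xi> t"] h by (simp add: h_def \<Delta>_def)
    have q: "norm (\<Delta> - t *\<^sub>R w) \<le> \<epsilon>2 * t"
      using d2(2)[of t] t \<xi>(2) by (simp add: \<Delta>_def)
    have "\<epsilon>2 * t \<le> 1 * t" "\<epsilon>2 * t \<le> e / 2 * t"
      using t by (auto simp: \<epsilon>2_def intro!: mult_right_mono)
    then have q1: "norm (\<Delta> - t *\<^sub>R w) \<le> t" and q2: "norm (\<Delta> - t *\<^sub>R w) \<le> e / 2 * t"
      using q by linarith+
    have "norm \<Delta> \<le> norm (\<Delta> - t *\<^sub>R w) + norm (t *\<^sub>R w)"
      using norm_triangle_sub[of \<Delta> "t *\<^sub>R w"] by simp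
    then have \<Delta>: "norm \<Delta> \<le> t * W" using q1 t by (simp add: W_def algebra_simps)
    have "\<kappa> * norm h \<le> norm (D h)" by (rule \<kappa>(2))
    also have "\<dots> \<le> norm \<Delta> + norm (\<Delta> - D h)" by norm
    also have "\<dots> \<le> t * W + \<kappa> / 2 * norm h"
      using \<Delta> r \<epsilon>1(1) mult_right_mono[of \<epsilon> "\<kappa>/2" "norm h"] by simp
    finally have hb: "\<kappa> * norm h \<le> 2 * (t * W)" by simp
    have "\<epsilon> * norm h \<le> e * \<kappa> / (8 * W) * norm h" using \<epsilon>1(2) by (rule mult_right_mono) simp
    also have "\<dots> = e / (8 * W) * (\<kappa> * norm h)" by simp
    also have "\<dots> \<le> e / (8 * W) * (2 * (t * W))" using hb e W by (intro mult_left_mono) auto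
    also have "\<dots> = e / 4 * t" using W by simp
    finally have "norm (\<Delta> - D h) \<le> e / 4 * t" using r by linarith
    moreover have "norm (D h - t *\<^sub>R w) \<le> norm (\<Delta> - t *\<^sub>R w) + norm (\<Delta> - D h)"
      using norm_triangle_ineq4[of "\<Delta> - t *\<^sub>R w" "\<Delta> - D h"] by simp
    moreover have "e * t > 0" using e t by simp
    ultimately have lt: "norm (D h - t *\<^sub>R w) < e * t" using q2 by simp
    have "D (h /\<^sub>R t) - w = (D h - t *\<^sub>R w) /\<^sub>R t"
      using t by (simp add: linear_cmul[OF lin] scaleR_diff_right)
    then have "norm (D (h /\<^sub>R t) - w) = norm (D h - t *\<^sub>R w) / t"
      using t by (simp add: divide_inverse mult.commute)
    also have "\<dots> < e" using lt t by (simp add: pos_divide_less_eq)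
    finally show ?thesis by (auto simp: dist_norm)
  qed
  then have "w \<in> closure (range D)" by (simp add: closure_approachable)
  then show ?thesis using closed_subspace[OF sub] by (simp add: closure_closed)
qed

section \<open>The embedding lifted to Euclidean space and read in charts\<close>

locale embedded_torus =
  fixes M :: "'m topology" and A :: "('m, 'e::euclidean_space) chart set"
    and \<omega> :: "('m, 'e) form2" and \<alpha> :: "('m, 'e) form1" and j :: "complex ^ 3 \<Rightarrow> 'm" and T :: "'m set"
  assumes manifold: "smooth_manifold M A"
    and two_form: "two_form A \<omega>" and primitive: "primitive_of A \<omega> \<alpha>"
    and embedding: "smooth_embedding torus torus_atlas M A j" and T_def: "T = j ` topspace torus"
begin

definition F :: "real ^ 3 \<Rightarrow> 'm" where "F x = j (torus_cover x)"

definition chart_dom :: "('m, 'e) chart \<Rightarrow> (real ^ 3) set" where "chart_dom c = {x. F x \<in> cdom c}"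

definition Fc :: "('m, 'e) chart \<Rightarrow> real ^ 3 \<Rightarrow> 'e" where "Fc c x = cmap c (F x)"

definition DF :: "('m, 'e) chart \<Rightarrow> real ^ 3 \<Rightarrow> real ^ 3 \<Rightarrow> 'e" where
  "DF c x = frechet_derivative (Fc c) (at x)"

lemma T_eq: "T = range F"
  by (auto simp: T_def topspace_torus F_def)

lemma continuous_map_j: "continuous_map torus M j"
  using embedding by (simp add: smooth_embedding_def smooth_immersion_def smooth_map_def)

lemma continuous_map_F: "continuous_map euclidean M F"
  using continuous_map_compose[OF continuous_map_torus_cover continuous_map_j] by (simp add: F_def[abs_def] o_def)

lemma F_in_topspace: "F x \<in> topspace M"
  using continuous_map_image_subset_topspace[OF continuous_map_F] by auto

lemma F_periodic: "n \<in> int_vecs \<Longrightarrow> F (x + n) = F x"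
  by (simp add: F_def torus_cover_add)

lemma embedding_j: "embedding_map torus M j"
  using embedding by (simp add: smooth_embedding_def)

lemma F_eq_iff: "F x = F y \<longleftrightarrow> x - y \<in> int_vecs"
proof -
  have "inj_on j (topspace torus)"
    using embedding_j by (simp add: embedding_map_def homeomorphic_eq_everything_map)
  then show ?thesis
    by (auto simp: F_def torus_cover_eq_iff[symmetric] topspace_torus inj_on_def)
qed

lemma chart_exists: obtains c where "c \<in> A" "x \<in> chart_dom c"
  using manifold F_in_topspace[of x] unfolding smooth_manifold_def chart_dom_def by blast

lemma open_chart_dom: "c \<in> A \<Longrightarrow> open (chart_dom c)"
proof -
  assume "c \<in> A"
  then have "openin M (cdom c)" using manifold by (simp add: smooth_manifold_def)
  then show "open (chart_dom c)"
    using openin_continuous_map_preimage[OF continuous_map_F] by (simp add: chart_dom_def)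
qed

lemma open_cimg: "c \<in> A \<Longrightarrow> open (cimg c)"
  using manifold by (simp add: smooth_manifold_def)

lemma Fc_in_cimg: "x \<in> chart_dom c \<Longrightarrow> Fc c x \<in> cimg c"
  by (simp add: chart_dom_def Fc_def)

lemma chart_dom_add: "n \<in> int_vecs \<Longrightarrow> x + n \<in> chart_dom c \<longleftrightarrow> x \<in> chart_dom c"
  by (simp add: chart_dom_def F_periodic)

text \<open>Smoothness of \<open>j\<close> is stated in torus charts, whereas \<open>F\<close> uses
  one global parameter. The chart that inverts \<open>torus_cover\<close> on the ball of radius 1/2
  about \<open>x\<close> makes the two agree near \<open>x\<close>.\<close>

lemma in_charts_torus:
  assumes "x \<in> chart_dom c" "c \<in> A"
  obtains \<tau> where "\<tau> \<in> torus_atlas" "torus_cover x \<in> cdom \<tau>" "cmap \<tau> (torus_cover x) = x"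
    "open (cmap \<tau> ` {p \<in> cdom \<tau>. j p \<in> cdom c})" "x \<in> cmap \<tau> ` {p \<in> cdom \<tau>. j p \<in> cdom c}"
    "\<And>y. y \<in> cmap \<tau> ` {p \<in> cdom \<tau>. j p \<in> cdom c} \<Longrightarrow> in_charts \<tau> c j y = Fc c y"
proof -
  define V where "V = ball x (1 / 2)"
  have inj: "inj_on torus_cover V" unfolding V_def by (rule inj_on_torus_cover_ball)
  define \<tau> where "\<tau> = (torus_cover ` V, inv_into V torus_cover)"
  have left: "inv_into V torus_cover (torus_cover y) = y" if "y \<in> V" for y
    by (rule inv_into_f_f[OF inj that])
  have xV: "x \<in> V" by (simp add: V_def)
  have img: "cmap \<tau> ` {p \<in> cdom \<tau>. j p \<in> cdom c} = V \<inter> chart_dom c"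
    by (force simp: \<tau>_def left chart_dom_def F_def)
  have inj': "inj_on (inv_into V torus_cover) (torus_cover ` V)"
    by (rule inj_on_inv_into) simp
  have "in_charts \<tau> c j y = Fc c y" if "y \<in> V \<inter> chart_dom c" for y
  proof -
    have "inv_into (torus_cover ` V) (inv_into V torus_cover) y = torus_cover y"
      using inv_into_f_f[OF inj', of "torus_cover y"] that by (simp add: left)
    then show ?thesis by (simp add: in_charts_def \<tau>_def Fc_def F_def)
  qed
  moreover have "\<tau> \<in> torus_atlas"
    unfolding torus_atlas_def \<tau>_def using inj by (auto simp: V_def)
  ultimately show ?thesis
    using that[of \<tau>] img xV assms open_chart_dom[OF assms(2)] left by (auto simp: \<tau>_def V_def)
qed

lemma smooth_Fc: "c \<in> A \<Longrightarrow> smooth_on (chart_dom c) (Fc c)"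
proof (rule smooth_on_local)
  fix x assume c: "c \<in> A" and x: "x \<in> chart_dom c"
  obtain \<tau> where \<tau>: "\<tau> \<in> torus_atlas"
    "open (cmap \<tau> ` {p \<in> cdom \<tau>. j p \<in> cdom c})" "x \<in> cmap \<tau> ` {p \<in> cdom \<tau>. j p \<in> cdom c}"
    "\<And>y. y \<in> cmap \<tau> ` {p \<in> cdom \<tau>. j p \<in> cdom c} \<Longrightarrow> in_charts \<tau> c j y = Fc c y"
    by (rule in_charts_torus[OF x c]) blast
  have "smooth_on (cmap \<tau> ` {p \<in> cdom \<tau>. j p \<in> cdom c}) (in_charts \<tau> c j)"
    using embedding \<tau>(1) c by (simp add: smooth_embedding_def smooth_immersion_def smooth_map_def)
  moreover have "smooth_on (cmap \<tau> ` {p \<in> cdom \<tau>. j p \<in> cdom c}) (in_charts \<tau> c j) =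
      smooth_on (cmap \<tau> ` {p \<in> cdom \<tau>. j p \<in> cdom c}) (Fc c)"
    by (rule smooth_on_cong[OF \<tau>(2)]) (rule \<tau>(4))
  ultimately have "smooth_on (cmap \<tau> ` {p \<in> cdom \<tau>. j p \<in> cdom c}) (Fc c)" by simp
  then show "\<exists>S. open S \<and> x \<in> S \<and> smooth_on S (Fc c)" using \<tau>(2,3) by blast
qed (rule open_chart_dom)

lemma Fc_has_derivative: "c \<in> A \<Longrightarrow> x \<in> chart_dom c \<Longrightarrow> (Fc c has_derivative DF c x) (at x)"
  unfolding DF_def by (rule smooth_on_has_derivative[OF smooth_Fc open_chart_dom])

lemma linear_DF: "c \<in> A \<Longrightarrow> x \<in> chart_dom c \<Longrightarrow> linear (DF c x)"
  using Fc_has_derivative has_derivative_linear by blast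

lemma inj_DF:
  assumes c: "c \<in> A" and x: "x \<in> chart_dom c"
  shows "inj (DF c x)"
proof -
  obtain \<tau> where \<tau>: "\<tau> \<in> torus_atlas" "torus_cover x \<in> cdom \<tau>" "cmap \<tau> (torus_cover x) = x"
    "open (cmap \<tau> ` {p \<in> cdom \<tau>. j p \<in> cdom c})" "x \<in> cmap \<tau> ` {p \<in> cdom \<tau>. j p \<in> cdom c}"
    "\<And>y. y \<in> cmap \<tau> ` {p \<in> cdom \<tau>. j p \<in> cdom c} \<Longrightarrow> in_charts \<tau> c j y = Fc c y"
    using in_charts_torus[OF x c] by blast
  have "inj (frechet_derivative (in_charts \<tau> c j) (at (cmap \<tau> (torus_cover x))))"
    using embedding \<tau>(1,2) c x by (simp add: smooth_embedding_def smooth_immersion_def chart_dom_def F_def)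
  then have "inj (frechet_derivative (in_charts \<tau> c j) (at x))" by (simp only: \<tau>(3))
  moreover have "(in_charts \<tau> c j has_derivative DF c x) (at x)"
    by (rule has_derivative_transform_within_open[OF Fc_has_derivative[OF c x] \<tau>(4,5)]) (simp add: \<tau>(6))
  then have "DF c x = frechet_derivative (in_charts \<tau> c j) (at x)" by (rule frechet_derivative_at)
  ultimately show ?thesis by simp
qed

lemma DF_expand:
  assumes "c \<in> A" "x \<in> chart_dom c"
  shows "DF c x v = (\<Sum>i\<in>UNIV. (v $ i) *\<^sub>R DF c x (axis i 1))"
proof -
  note lin = linear_DF[OF assms]
  have "DF c x (\<Sum>i\<in>UNIV. (v $ i) *\<^sub>R axis i 1) = (\<Sum>i\<in>UNIV. (v $ i) *\<^sub>R DF c x (axis i 1))"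
    by (simp only: linear_sum[OF lin] linear_cmul[OF lin])
  moreover have "(\<Sum>i\<in>UNIV. (v $ i) *\<^sub>R axis i 1) = v"
    by (metis basis_expansion scalar_mult_eq_scaleR)
  ultimately show ?thesis by metis
qed

lemma smooth_DF: "c \<in> A \<Longrightarrow> smooth_on (chart_dom c) (\<lambda>x. DF c x v)"
  unfolding DF_def by (rule smooth_on_derivative[OF smooth_Fc])

lemma DF_add: "n \<in> int_vecs \<Longrightarrow> c \<in> A \<Longrightarrow> x \<in> chart_dom c \<Longrightarrow> DF c (x + n) = DF c x"
proof -
  assume n: "n \<in> int_vecs" and c: "c \<in> A" and x: "x \<in> chart_dom c"
  have d: "(Fc c has_derivative DF c (x + n)) (at (x + n))"
    using n c x by (intro Fc_has_derivative) (auto simp: chart_dom_add)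
  have "((\<lambda>y. Fc c (y + n)) has_derivative (\<lambda>v. DF c (x + n) v)) (at x)"
    by (rule has_derivative_compose[of "\<lambda>y. y + n" "\<lambda>v. v", OF _ d]) (auto intro!: derivative_eq_intros)
  moreover have "(\<lambda>y. Fc c (y + n)) = Fc c" using n by (simp add: fun_eq_iff Fc_def F_periodic)
  ultimately have "(Fc c has_derivative DF c (x + n)) (at x)" by simp
  then show ?thesis unfolding DF_def by (rule frechet_derivative_at)
qed

lemma chart_change:
  assumes c: "c \<in> A" "x \<in> chart_dom c" and d: "d \<in> A" "x \<in> chart_dom d"
  shows "DF d x v = frechet_derivative (in_charts c d id) (at (Fc c x)) (DF c x v)"
proof -
  let ?U = "cmap c ` (cdom c \<inter> cdom d)"
  have homeo: "homeomorphic_map (subtopology M (cdom c)) (top_of_set (cimg c)) (cmap c)"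
    and od: "openin M (cdom c)" "openin M (cdom d)"
    using manifold c d by (auto simp: smooth_manifold_def)
  have "openin (subtopology M (cdom c)) (cdom c \<inter> cdom d)"
    using od by (simp add: openin_subtopology_Int2)
  then have "openin (top_of_set (cimg c)) ?U"
    using homeo by (meson homeomorphic_imp_open_map open_map_def)
  then have U: "open ?U" using openin_open_trans open_cimg[OF c(1)] by blast
  have sm: "smooth_on ?U (in_charts c d id)"
    using manifold c d by (simp add: smooth_manifold_def)
  have "cdom c \<subseteq> topspace M" using od openin_subset by blast
  then have inj: "inj_on (cmap c) (cdom c)"
    using homeo by (simp add: homeomorphic_eq_everything_map Int_absorb1)
  have xU: "Fc c x \<in> ?U" using c d by (simp add: Fc_def chart_dom_def)
  have d': "(in_charts c d id has_derivative frechet_derivative (in_charts c d id) (at (Fc c x))) (at (Fc c x))"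
    by (rule smooth_on_has_derivative[OF sm U xU])
  have comp: "((\<lambda>y. in_charts c d id (Fc c y)) has_derivative
    (\<lambda>v. frechet_derivative (in_charts c d id) (at (Fc c x)) (DF c x v))) (at x)"
    by (rule has_derivative_compose[OF Fc_has_derivative[OF c] d'])
  have "(Fc d has_derivative (\<lambda>v. frechet_derivative (in_charts c d id) (at (Fc c x)) (DF c x v))) (at x)"
  proof (rule has_derivative_transform_within_open[OF comp])
    show "open (chart_dom c \<inter> chart_dom d)" using open_chart_dom c d by blast
    show "x \<in> chart_dom c \<inter> chart_dom d" using c d by blast
    show "in_charts c d id (Fc c y) = Fc d y" if "y \<in> chart_dom c \<inter> chart_dom d" for y
      using that inv_into_f_f[OF inj] by (simp add: in_charts_def Fc_def chart_dom_def)
  qed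
  from fun_cong[OF frechet_derivative_at[OF this], of v] show ?thesis by (simp only: DF_def)
qed

section \<open>The pulled-back primitive and its exterior derivative\<close>

definition chart_at :: "real ^ 3 \<Rightarrow> ('m, 'e) chart" where
  "chart_at x = (SOME c. c \<in> A \<and> F x \<in> cdom c)"

text \<open>The components of the pull-back of \<open>\<alpha>\<close> along \<open>F\<close>. The
  chosen chart may jump from point to point, but the transformation rule in \<open>one_form\<close>
  makes the value independent of it.\<close>

definition \<beta> :: "real ^ 3 \<Rightarrow> real ^ 3" where
  "\<beta> x = (\<chi> i. \<alpha> (chart_at x) (Fc (chart_at x) x) (DF (chart_at x) x (axis i 1)))"

lemma chart_at: "chart_at x \<in> A" "x \<in> chart_dom (chart_at x)"
proof -
  have "\<exists>c. c \<in> A \<and> F x \<in> cdom c" using chart_exists[of x] unfolding chart_dom_def by blast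
  from someI_ex[OF this] show "chart_at x \<in> A" "x \<in> chart_dom (chart_at x)"
    by (simp_all add: chart_at_def chart_dom_def)
qed

lemma one_form: "one_form A \<alpha>"
  using primitive by (simp add: primitive_of_def)

lemma \<beta>_chart:
  assumes c: "c \<in> A" "x \<in> chart_dom c"
  shows "\<beta> x $ i = \<alpha> c (Fc c x) (DF c x (axis i 1))"
proof -
  let ?d = "chart_at x"
  have "\<alpha> c (cmap c (F x)) (DF c x (axis i 1)) =
      \<alpha> ?d (cmap ?d (F x)) (frechet_derivative (in_charts c ?d id) (at (cmap c (F x))) (DF c x (axis i 1)))"
    using one_form c chart_at[of x] unfolding one_form_def chart_dom_def by blast
  then show ?thesis
    using chart_change[OF c chart_at, of "axis i 1"] by (simp add: \<beta>_def Fc_def)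
qed

lemma \<alpha>_expand:
  assumes c: "c \<in> A" and y: "y \<in> cimg c"
  shows "\<alpha> c y v = (\<Sum>b\<in>Basis. (v \<bullet> b) * \<alpha> c y b)"
proof -
  have lin: "linear (\<alpha> c y)" using one_form c y unfolding one_form_def by blast
  have "\<alpha> c y (\<Sum>b\<in>Basis. (v \<bullet> b) *\<^sub>R b) = (\<Sum>b\<in>Basis. (v \<bullet> b) * \<alpha> c y b)"
    by (simp add: linear_sum[OF lin] linear_cmul[OF lin])
  then show ?thesis by (simp only: euclidean_representation)
qed

lemma smooth_\<alpha>: "c \<in> A \<Longrightarrow> smooth_on (cimg c) (\<lambda>y. \<alpha> c y v)"
  using one_form unfolding one_form_def by blast

text \<open>Smoothness of \<open>\<alpha>\<close> is given for constant vectors only, so the moving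
  vector \<open>DF c x (axis i 1)\<close> is expanded in the basis.\<close>

lemma \<beta>_local:
  assumes "c \<in> A" "x \<in> chart_dom c"
  shows "\<beta> x $ i = (\<Sum>b\<in>Basis. (DF c x (axis i 1) \<bullet> b) *\<^sub>R \<alpha> c (Fc c x) b)"
proof -
  have "\<alpha> c (Fc c x) (DF c x (axis i 1)) = (\<Sum>b\<in>Basis. (DF c x (axis i 1) \<bullet> b) * \<alpha> c (Fc c x) b)"
    by (rule \<alpha>_expand[OF assms(1) Fc_in_cimg[OF assms(2)]])
  then show ?thesis by (simp only: \<beta>_chart[OF assms] real_scaleR_def)
qed

lemma smooth_\<alpha>_Fc: "c \<in> A \<Longrightarrow> smooth_on (chart_dom c) (\<lambda>x. \<alpha> c (Fc c x) v)"
  by (rule smooth_on_compose[OF open_chart_dom open_cimg _ smooth_\<alpha> smooth_Fc]) (auto simp: Fc_in_cimg)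

lemma smooth_\<beta>: "smooth_on UNIV \<beta>"
proof (rule smooth_on_vec)
  fix i
  show "smooth_on UNIV (\<lambda>x. \<beta> x $ i)"
  proof (rule smooth_on_local)
    fix x
    obtain c where c: "c \<in> A" "x \<in> chart_dom c" by (rule chart_exists)
    have "smooth_on (chart_dom c) (\<lambda>x. \<Sum>b\<in>Basis. (DF c x (axis i 1) \<bullet> b) *\<^sub>R \<alpha> c (Fc c x) b)"
      by (intro smooth_on_sum smooth_on_scaleR open_chart_dom c smooth_\<alpha>_Fc
          smooth_on_bounded_linear[OF _ bounded_linear_inner_left] smooth_DF)
    then have "smooth_on (chart_dom c) (\<lambda>x. \<beta> x $ i)"
      by (subst smooth_on_cong[OF open_chart_dom[OF c(1)]]) (simp_all only: \<beta>_local[OF c(1)])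
    then show "\<exists>S. open S \<and> x \<in> S \<and> smooth_on S (\<lambda>x. \<beta> x $ i)" using c open_chart_dom by blast
  qed simp
qed simp

lemma periodic_\<beta>: "periodic \<beta>"
  unfolding periodic_def
proof (intro allI ballI)
  fix x n :: "real ^ 3" assume n: "n \<in> int_vecs"
  obtain c where c: "c \<in> A" "x \<in> chart_dom c" by (rule chart_exists)
  have "x + n \<in> chart_dom c" using c n by (simp add: chart_dom_add)
  then have "\<beta> (x + n) $ i = \<beta> x $ i" for i
    using c n by (simp add: \<beta>_chart[OF c(1)] DF_add) (simp add: Fc_def F_periodic)
  then show "\<beta> (x + n) = \<beta> x" by (simp add: vec_eq_iff)
qed

text \<open>The product rule, arranged for antisymmetrization: the sum carries the second
  derivatives of \<open>F\<close>, symmetric in \<open>i\<close> and \<open>k\<close>, and the last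
  term is half of \<open>ext_deriv1 \<alpha>\<close> on the two image vectors. Subtracting the
  expression with \<open>i\<close> and \<open>k\<close> exchanged thus shows that pull-back commutes
  with the exterior derivative.\<close>

lemma pderiv_\<beta>:
  assumes c: "c \<in> A" "x \<in> chart_dom c"
  shows "pderiv_at i (\<lambda>y. \<beta> y $ k) x =
    (\<Sum>b\<in>Basis. frechet_derivative (\<lambda>y. frechet_derivative (\<lambda>y. Fc c y \<bullet> b) (at y) (axis k 1)) (at x) (axis i 1) * \<alpha> c (Fc c x) b)
    + frechet_derivative (\<lambda>z. \<alpha> c z (DF c x (axis k 1))) (at (Fc c x)) (DF c x (axis i 1))"
proof -
  define a where "a b y = \<alpha> c (Fc c y) b" for b y
  define D\<alpha> where "D\<alpha> b = frechet_derivative (\<lambda>z. \<alpha> c z b) (at (Fc c x))" for b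
  define H where "H b = frechet_derivative (\<lambda>y. DF c y (axis k 1) \<bullet> b) (at x)" for b
  have dH: "((\<lambda>y. DF c y (axis k 1) \<bullet> b) has_derivative H b) (at x)" for b
    unfolding H_def using c open_chart_dom
    by (intro smooth_on_has_derivative[of "chart_dom c"] smooth_on_bounded_linear[OF _ bounded_linear_inner_left] smooth_DF) auto
  have d\<alpha>: "((\<lambda>z. \<alpha> c z b) has_derivative D\<alpha> b) (at (Fc c x))" for b
    unfolding D\<alpha>_def using c open_cimg Fc_in_cimg
    by (intro smooth_on_has_derivative[of "cimg c"] smooth_\<alpha>) auto
  have da: "(a b has_derivative (\<lambda>v. D\<alpha> b (DF c x v))) (at x)" for b
    unfolding a_def by (rule has_derivative_compose[OF Fc_has_derivative[OF c] d\<alpha>])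
  have "((\<lambda>y. \<Sum>b\<in>Basis. (DF c y (axis k 1) \<bullet> b) * a b y) has_derivative
     (\<lambda>v. \<Sum>b\<in>Basis. (DF c x (axis k 1) \<bullet> b) * D\<alpha> b (DF c x v) + H b v * a b x)) (at x)"
    by (intro has_derivative_sum has_derivative_mult dH da)
  then have "((\<lambda>y. \<beta> y $ k) has_derivative
     (\<lambda>v. \<Sum>b\<in>Basis. (DF c x (axis k 1) \<bullet> b) * D\<alpha> b (DF c x v) + H b v * a b x)) (at x)"
    by (rule has_derivative_transform_within_open[OF _ open_chart_dom[OF c(1)] c(2)]) (simp add: \<beta>_local[OF c(1)] a_def)
  from frechet_derivative_at[OF this, symmetric]
  have 1: "pderiv_at i (\<lambda>y. \<beta> y $ k) x =
     (\<Sum>b\<in>Basis. (DF c x (axis k 1) \<bullet> b) * D\<alpha> b (DF c x (axis i 1)) + H b (axis i 1) * a b x)"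
    by (simp add: pderiv_at_def)
  have "((\<lambda>z. \<Sum>b\<in>Basis. (v \<bullet> b) * \<alpha> c z b) has_derivative (\<lambda>w. \<Sum>b\<in>Basis. (v \<bullet> b) * D\<alpha> b w)) (at (Fc c x))" for v
    by (intro has_derivative_sum has_derivative_mult_right d\<alpha>)
  then have "((\<lambda>z. \<alpha> c z v) has_derivative (\<lambda>w. \<Sum>b\<in>Basis. (v \<bullet> b) * D\<alpha> b w)) (at (Fc c x))" for v
    by (rule has_derivative_transform_within_open[OF _ open_cimg[OF c(1)] Fc_in_cimg[OF c(2)]])
       (simp add: \<alpha>_expand[OF c(1), of _ v])
  from frechet_derivative_at[OF this, symmetric]
  have 2: "frechet_derivative (\<lambda>z. \<alpha> c z v) (at (Fc c x)) w = (\<Sum>b\<in>Basis. (v \<bullet> b) * D\<alpha> b w)" for v w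
    by simp
  have 3: "H b = frechet_derivative (\<lambda>y. frechet_derivative (\<lambda>y. Fc c y \<bullet> b) (at y) (axis k 1)) (at x)" for b
  proof -
    have "DF c y v \<bullet> b = frechet_derivative (\<lambda>y. Fc c y \<bullet> b) (at y) v" if "y \<in> chart_dom c" for y v
    proof -
      have "((\<lambda>y. Fc c y \<bullet> b) has_derivative (\<lambda>w. DF c y w \<bullet> b)) (at y)"
        by (rule bounded_linear.has_derivative[OF bounded_linear_inner_left Fc_has_derivative[OF c(1) that]])
      from frechet_derivative_at[OF this, symmetric] show ?thesis by simp
    qed
    then have "((\<lambda>y. frechet_derivative (\<lambda>y. Fc c y \<bullet> b) (at y) (axis k 1)) has_derivative H b) (at x)"
      by (intro has_derivative_transform_within_open[OF dH open_chart_dom[OF c(1)] c(2)]) simp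
    then show ?thesis by (rule frechet_derivative_at)
  qed
  show ?thesis unfolding 1 2 3[symmetric] by (simp add: sum.distrib a_def add.commute)
qed

lemma \<omega>_DF_axis:
  assumes c: "c \<in> A" "x \<in> chart_dom c"
  shows "\<omega> c (Fc c x) (DF c x (axis i 1)) (DF c x (axis k 1)) =
    pderiv_at i (\<lambda>y. \<beta> y $ k) x - pderiv_at k (\<lambda>y. \<beta> y $ i) x"
proof -
  have "smooth_on (chart_dom c) (\<lambda>y. Fc c y \<bullet> b)" for b
    by (intro smooth_on_bounded_linear[OF _ bounded_linear_inner_left] smooth_Fc open_chart_dom c)
  then have "Ck_on 2 (chart_dom c) (\<lambda>y. Fc c y \<bullet> b)" for b by (simp add: smooth_on_def)
  note sym = symmetric_second_derivative[OF open_chart_dom[OF c(1)] c(2) this]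
  have "\<omega> c (Fc c x) (DF c x (axis i 1)) (DF c x (axis k 1)) = ext_deriv1 \<alpha> c (Fc c x) (DF c x (axis i 1)) (DF c x (axis k 1))"
    using primitive c Fc_in_cimg[OF c(2)] unfolding primitive_of_def by blast
  then show ?thesis
    unfolding pderiv_\<beta>[OF c] ext_deriv1_def
    by (simp add: sym[of _ "axis i 1" "axis k 1"])
qed

text \<open>The pull-back of \<open>\<omega>\<close> is the standard volume form contracted with
  \<open>curl \<beta>\<close>, so \<open>curl \<beta>\<close> spans its kernel wherever it is
  nonzero.\<close>

lemma \<omega>_DF:
  assumes c: "c \<in> A" "x \<in> chart_dom c"
  shows "\<omega> c (Fc c x) (DF c x u) (DF c x v) = curl \<beta> x \<bullet> cross3 u v"
proof -
  have bil: "bilinear (\<omega> c (Fc c x))"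
    using two_form c Fc_in_cimg[OF c(2)] unfolding two_form_def by blast
  have "\<omega> c (Fc c x) (DF c x u) (DF c x v) =
     (\<Sum>i\<in>UNIV. \<Sum>k\<in>UNIV. u $ i * v $ k * \<omega> c (Fc c x) (DF c x (axis i 1)) (DF c x (axis k 1)))"
    unfolding DF_expand[OF c, of u] DF_expand[OF c, of v]
    by (simp add: bilinear_sum[OF bil] bilinear_lmul[OF bil] bilinear_rmul[OF bil] sum.cartesian_product mult_ac)
  then show ?thesis
    by (simp add: \<omega>_DF_axis[OF c] sum_3 curl_nth cross3_def inner_vec_def algebra_simps)
qed

section \<open>Curves in the torus and its tangent spaces\<close>

lemma T_subset: "T \<subseteq> topspace M"
  using F_in_topspace by (auto simp: T_eq)

lemma F_curve_has_vector_derivative: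
  assumes \<xi>: "(\<xi> has_vector_derivative v) (at t)" and c: "c \<in> A" "\<xi> t \<in> chart_dom c"
  shows "((cmap c \<circ> (\<lambda>t. F (\<xi> t))) has_vector_derivative DF c (\<xi> t) v) (at t)"
proof -
  have "((\<lambda>t. Fc c (\<xi> t)) has_derivative (\<lambda>h. DF c (\<xi> t) (h *\<^sub>R v))) (at t)"
    by (rule has_derivative_compose[where f=\<xi>, OF _ Fc_has_derivative[OF c]])
       (use \<xi> in \<open>simp add: has_vector_derivative_def\<close>)
  moreover have "cmap c \<circ> (\<lambda>t. F (\<xi> t)) = (\<lambda>t. Fc c (\<xi> t))" by (auto simp: Fc_def)
  ultimately show ?thesis
    by (simp add: has_vector_derivative_def linear_cmul[OF linear_DF[OF c]])
qed

lemma F_curve: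
  assumes \<xi>: "\<And>t. (\<xi> has_vector_derivative \<xi>' t) (at t)" and \<xi>': "continuous_on UNIV \<xi>'"
  shows "C1_curve_in M A T (\<lambda>t. F (\<xi> t))"
    and "c \<in> A \<Longrightarrow> \<xi> t \<in> chart_dom c \<Longrightarrow> velocity c (\<lambda>t. F (\<xi> t)) t = DF c (\<xi> t) (\<xi>' t)"
proof -
  have cont: "continuous_on S \<xi>" for S
    using \<xi> by (meson continuous_at_imp_continuous_on has_vector_derivative_continuous)
  then have "continuous_map euclideanreal M (\<lambda>t. F (\<xi> t))"
    using continuous_map_compose[of euclideanreal euclidean \<xi>, OF _ continuous_map_F] by (simp add: o_def)
  moreover have "(cmap c \<circ> (\<lambda>t. F (\<xi> t))) C1_differentiable_on {t. F (\<xi> t) \<in> cdom c}" if c: "c \<in> A" for c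
  proof -
    have "continuous_on {t. \<xi> t \<in> chart_dom c} (\<lambda>t. \<Sum>i\<in>UNIV. (\<xi>' t $ i) *\<^sub>R DF c (\<xi> t) (axis i 1))"
      by (intro continuous_intros continuous_on_subset[OF \<xi>']
          continuous_on_compose2[OF smooth_on_continuous_on[OF smooth_DF[OF c]] cont]) auto
    then have "continuous_on {t. \<xi> t \<in> chart_dom c} (\<lambda>t. DF c (\<xi> t) (\<xi>' t))"
      by (rule iffD1[OF continuous_on_cong, rotated 2]) (simp_all add: DF_expand[OF c, of _ "\<xi>' _"])
    then show ?thesis
      unfolding C1_differentiable_on_def
      using F_curve_has_vector_derivative[OF \<xi> c] by (intro exI[of _ "\<lambda>t. DF c (\<xi> t) (\<xi>' t)"]) (simp add: chart_dom_def)
  qed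
  ultimately show "C1_curve_in M A T (\<lambda>t. F (\<xi> t))"
    by (auto simp: C1_curve_in_def T_eq)
  show "velocity c (\<lambda>t. F (\<xi> t)) t = DF c (\<xi> t) (\<xi>' t)" if "c \<in> A" "\<xi> t \<in> chart_dom c"
    unfolding velocity_def by (rule vector_derivative_at[OF F_curve_has_vector_derivative[OF \<xi> that]])
qed

lemma embedding_inverse:
  obtains k where "continuous_map (subtopology M T) torus k" "\<And>z. z \<in> topspace torus \<Longrightarrow> k (j z) = z"
    "\<And>x. x \<in> T \<Longrightarrow> j (k x) = x" "\<And>x. x \<in> T \<Longrightarrow> k x \<in> topspace torus"
proof -
  obtain k where k: "homeomorphic_maps torus (subtopology M (j ` topspace torus)) j k"
    using embedding_j by (auto simp: embedding_map_def homeomorphic_map_maps)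
  have T: "topspace (subtopology M (j ` topspace torus)) = T"
    using T_subset by (auto simp: T_def)
  have kc: "continuous_map (subtopology M T) torus k"
    using k by (simp add: homeomorphic_maps_def T_def)
  show ?thesis
  proof (rule that[OF kc])
    show "k (j z) = z" if "z \<in> topspace torus" for z
      using k that by (simp add: homeomorphic_maps_def)
    show "j (k x) = x" if "x \<in> T" for x
      using k that T by (simp add: homeomorphic_maps_def)
    show "k x \<in> topspace torus" if "x \<in> T" for x
      using continuous_map_image_subset_topspace[OF kc] that T by (auto simp: T_def)
  qed
qed

text \<open>Continuity of the lift at 0 is enough to find a velocity there, so a principal logarithm
  can be used globally although it may jump at other times.\<close>

lemma lift_curve:
  assumes \<gamma>: "continuous_map euclideanreal M \<gamma>" "range \<gamma> \<subseteq> T" "\<gamma> 0 = F x"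
  obtains \<xi> where "isCont \<xi> 0" "\<xi> 0 = x" "\<And>t. F (\<xi> t) = \<gamma> t"
proof -
  obtain k where k: "continuous_map (subtopology M T) torus k" "\<And>z. z \<in> topspace torus \<Longrightarrow> k (j z) = z"
    "\<And>x. x \<in> T \<Longrightarrow> j (k x) = x" "\<And>x. x \<in> T \<Longrightarrow> k x \<in> topspace torus"
    using embedding_inverse by metis
  define \<zeta> where "\<zeta> t = k (\<gamma> t)" for t
  have "continuous_map euclideanreal (subtopology M T) \<gamma>"
    using \<gamma> by (auto simp: continuous_map_in_subtopology)
  from continuous_map_compose[OF this k(1)] have "continuous_on UNIV \<zeta>"
    by (simp add: torus_def continuous_map_in_subtopology o_def \<zeta>_def[abs_def])
  then have cont: "isCont \<zeta> 0" by (simp add: continuous_on_eq_continuous_at)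
  have \<zeta>0: "\<zeta> 0 = torus_cover x"
    using k(2)[of "torus_cover x"] \<gamma>(3) by (simp add: \<zeta>_def F_def topspace_torus)
  \<comment> \<open>Dividing by the starting point places the curve at 1 for time 0, where the
    principal logarithm is continuous.\<close>
  define r where "r t i = \<zeta> t $ i / cis (2 * pi * x $ i)" for t i
  have r0: "r 0 i = 1" for i by (simp add: r_def \<zeta>0)
  have norm_r: "norm (r t i) = 1" for t i
  proof -
    have "\<zeta> t \<in> topspace torus" using k(4) \<gamma>(2) by (auto simp: \<zeta>_def)
    then show ?thesis by (simp add: torus_def r_def norm_divide)
  qed
  define \<xi> :: "real \<Rightarrow> real ^ 3" where "\<xi> t = (\<chi> i. x $ i + Im (Ln (r t i)) / (2 * pi))" for t
  have "isCont (\<lambda>t. r t i) 0" for i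
    unfolding r_def using cont by (intro continuous_intros) auto
  then have "isCont (\<lambda>t. Ln (r t i)) 0" for i
    by (rule isCont_Ln') (simp add: r0)
  note lim = isContD[OF this]
  have "isCont \<xi> 0"
    unfolding isCont_def by (rule vec_tendstoI) (auto simp: \<xi>_def intro!: tendsto_intros lim)
  moreover have "\<xi> 0 = x" by (simp add: \<xi>_def r0 vec_eq_iff)
  moreover have "F (\<xi> t) = \<gamma> t" for t
  proof -
    have "torus_cover (\<xi> t) $ i = \<zeta> t $ i" for i
    proof -
      have nz: "r t i \<noteq> 0" using norm_r[of t i] by force
      have "cis (Im (Ln (r t i))) = r t i"
        using norm_r[of t i] nz rcis_cmod_Arg[of "r t i"] by (simp add: rcis_def Arg_eq_Im_Ln)
      moreover have "2 * pi * (x $ i + Im (Ln (r t i)) / (2 * pi)) = 2 * pi * x $ i + Im (Ln (r t i))"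
        by (simp add: distrib_left)
      ultimately show ?thesis
        by (simp add: \<xi>_def cis_mult[symmetric]) (simp add: r_def)
    qed
    then have "torus_cover (\<xi> t) = \<zeta> t" by (simp add: vec_eq_iff)
    then show ?thesis using k(3)[of "\<gamma> t"] \<gamma>(2) by (auto simp: F_def \<zeta>_def)
  qed
  ultimately show ?thesis using that by blast
qed

lemma tangent_space_eq:
  assumes c: "c \<in> A" "x \<in> chart_dom c"
  shows "tangent_space M A T c (F x) = range (DF c x)"
proof
  show "tangent_space M A T c (F x) \<subseteq> range (DF c x)"
  proof
    fix w assume "w \<in> tangent_space M A T c (F x)"
    then obtain \<gamma> where \<gamma>: "w = velocity c \<gamma> 0" "C1_curve_in M A T \<gamma>" "\<gamma> 0 = F x"
      by (auto simp: tangent_space_def)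
    then obtain \<xi> where \<xi>: "isCont \<xi> 0" "\<xi> 0 = x" "\<And>t. F (\<xi> t) = \<gamma> t"
      using lift_curve[of \<gamma> x] by (auto simp: C1_curve_in_def)
    have "0 \<in> {t. \<gamma> t \<in> cdom c}" using c \<gamma>(3) by (simp add: chart_dom_def)
    then obtain u where u: "((cmap c \<circ> \<gamma>) has_vector_derivative u) (at 0)"
      using \<gamma>(2) c(1) unfolding C1_curve_in_def C1_differentiable_on_def by blast
    then have "w = u" using \<gamma>(1) by (simp add: velocity_def vector_derivative_at)
    moreover have "cmap c \<circ> \<gamma> = (\<lambda>t. Fc c (\<xi> t))" by (auto simp: Fc_def \<xi>(3))
    ultimately show "w \<in> range (DF c x)"
      using velocity_in_range_of_immersion[OF Fc_has_derivative[OF c] inj_DF[OF c] \<xi>(1,2)] u by simp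
  qed
  show "range (DF c x) \<subseteq> tangent_space M A T c (F x)"
  proof
    fix w assume "w \<in> range (DF c x)"
    then obtain v where v: "w = DF c x v" by blast
    have d: "((\<lambda>t. x + t *\<^sub>R v) has_vector_derivative v) (at t)" for t
      by (auto intro!: derivative_eq_intros)
    have "C1_curve_in M A T (\<lambda>t. F (x + t *\<^sub>R v))"
      by (rule F_curve(1)[OF d]) (rule continuous_on_const)
    moreover have "velocity c (\<lambda>t. F (x + t *\<^sub>R v)) 0 = w"
      using F_curve(2)[of "\<lambda>t. x + t *\<^sub>R v" "\<lambda>_. v", OF d continuous_on_const c(1), of 0] c v by simp
    ultimately show "w \<in> tangent_space M A T c (F x)"
      unfolding tangent_space_def by (intro CollectI exI[of _ "\<lambda>t. F (x + t *\<^sub>R v)"]) simp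
  qed
qed

section \<open>Characteristic directions, leaves and fibres\<close>

lemma char_kernel_eq:
  assumes c: "c \<in> A" "x \<in> chart_dom c"
  shows "char_kernel M A \<omega> T c (F x) = DF c x ` {u. \<forall>v. curl \<beta> x \<bullet> cross3 u v = 0}"
  unfolding char_kernel_def tangent_space_eq[OF c]
  using \<omega>_DF[OF c] by (auto simp: Fc_def)

text \<open>At a zero of the curl the restricted form would vanish, and the kernel would be the
  whole three-dimensional tangent space.\<close>

lemma curl_nonzero:
  assumes "char_kernel_line_field M A \<omega> T"
  shows "curl \<beta> x \<noteq> 0"
proof
  assume z: "curl \<beta> x = 0"
  obtain c where c: "c \<in> A" "x \<in> chart_dom c" by (rule chart_exists)
  have "dim (char_kernel M A \<omega> T c (F x)) = 1"
    using assms c unfolding char_kernel_line_field_def by (auto simp: T_eq chart_dom_def)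
  moreover have "char_kernel M A \<omega> T c (F x) = range (DF c x)"
    unfolding char_kernel_eq[OF c] by (simp add: z)
  moreover have "dim (range (DF c x)) = dim (UNIV :: (real ^ 3) set)"
    using linear_DF[OF c] inj_DF[OF c] by (intro dim_image_eq) auto
  ultimately show False by (simp add: dim_UNIV)
qed

text \<open>The flow is only defined for nonnegative times, whereas the curves in a leaf are defined on
  the whole line; hence the reparametrization by \<open>s\<^sup>2\<close>.\<close>

lemma flow_in_leaf:
  assumes flow: "periodic_flow (curl \<beta>) L B \<phi>" and t: "t \<ge> 0"
  shows "F (\<phi> t x) \<in> char_leaf M A \<omega> T (F x)"
proof -
  interpret periodic_flow "curl \<beta>" L B \<phi> by (fact flow)
  define \<xi> where "\<xi> s = \<phi> (t * s\<^sup>2) x" for s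
  define \<xi>' where "\<xi>' s = (2 * t * s) *\<^sub>R curl \<beta> (\<xi> s)" for s
  have d: "(\<xi> has_vector_derivative \<xi>' s) (at s)" for s
  proof -
    have "((\<lambda>s. t * s\<^sup>2) has_real_derivative 2 * t * s) (at s)"
      by (auto intro!: derivative_eq_intros)
    then have "((\<lambda>s. t * s\<^sup>2) has_vector_derivative 2 * t * s) (at s within UNIV)"
      by (simp add: has_real_derivative_iff_has_vector_derivative)
    moreover have "((\<lambda>u. \<phi> u x) has_vector_derivative curl \<beta> (\<xi> s)) (at (t * s\<^sup>2) within (\<lambda>s. t * s\<^sup>2) ` UNIV)"
      unfolding \<xi>_def using t by (intro has_vector_derivative_within_subset[OF flow_deriv]) auto
    ultimately have "((\<lambda>u. \<phi> u x) \<circ> (\<lambda>s. t * s\<^sup>2) has_vector_derivative \<xi>' s) (at s within UNIV)"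
      unfolding \<xi>'_def by (rule vector_diff_chain_within)
    then show ?thesis by (simp add: o_def \<xi>_def[abs_def])
  qed
  have "continuous_on UNIV \<xi>"
    using d by (meson continuous_at_imp_continuous_on has_vector_derivative_continuous)
  then have "continuous_on UNIV \<xi>'"
    unfolding \<xi>'_def by (intro continuous_intros continuous_on_compose2[OF continuous_on_X]) auto
  note curve = F_curve[OF d this]
  have "char_curve M A \<omega> T (\<lambda>s. F (\<xi> s))"
    unfolding char_curve_def
  proof (intro conjI allI ballI impI curve(1))
    fix s c assume c: "c \<in> A" "F (\<xi> s) \<in> cdom c"
    then have c': "\<xi> s \<in> chart_dom c" by (simp add: chart_dom_def)
    have "curl \<beta> (\<xi> s) \<bullet> cross3 (\<xi>' s) v = 0" for v
      by (simp add: \<xi>'_def cross_mult_left dot_cross_self)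
    then show "velocity c (\<lambda>s. F (\<xi> s)) s \<in> char_kernel M A \<omega> T c (F (\<xi> s))"
      unfolding curve(2)[OF c(1) c'] char_kernel_eq[OF c(1) c'] by blast
  qed
  moreover have "F (\<xi> 1) = F (\<phi> t x)" "F (\<xi> 0) = F x" by (simp_all add: \<xi>_def)
  ultimately show ?thesis
    unfolding char_leaf_def by (intro CollectI exI[of _ "\<lambda>s. F (\<xi> s)"]) simp
qed

text \<open>A forward orbit stays in a leaf, hence in a fibre, so the projection is constant along
  the flow. Over a trivializing set the circle coordinate therefore determines the position of a
  point of the orbit in the torus, which is the input for bounding return times.\<close>

lemma no_circle_bundle:
  assumes line: "char_kernel_line_field M A \<omega> T"
    and circle: "circle_bundle (subtopology M T) (B :: 'b topology) p"
    and fibers: "bundle_fibers (subtopology M T) B p = char_leaf M A \<omega> T ` T"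
  shows False
proof -
  obtain L b \<phi> where flow: "periodic_flow (curl \<beta>) L b \<phi>"
    and L: "\<And>x v. norm (frechet_derivative (curl \<beta>) (at x) v) \<le> L * norm v"
    using curl_flow_exists[OF smooth_\<beta> periodic_\<beta> curl_nonzero[OF line]] by metis
  interpret periodic_flow "curl \<beta>" L b \<phi> by (fact flow)
  have top: "topspace (subtopology M T) = T" using T_subset by auto
  have FT: "F x \<in> T" for x by (simp add: T_eq)
  have contF: "continuous_map euclidean (subtopology M T) F"
    using continuous_map_F FT by (auto simp: continuous_map_in_subtopology)
  define q where "q x = p (F x)" for x
  have contp: "continuous_map (subtopology M T) B p" using circle by (simp add: circle_bundle_def)
  have contq: "continuous_map euclidean B q"
    using continuous_map_compose[OF contF contp] by (simp add: q_def[abs_def] o_def)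
  have q_flow: "q (\<phi> t x) = q x" if "t \<ge> 0" for t x
  proof -
    have "char_leaf M A \<omega> T (F x) \<in> bundle_fibers (subtopology M T) B p"
      using FT fibers by auto
    then obtain y where y: "char_leaf M A \<omega> T (F x) = {w \<in> T. p w = y}"
      by (auto simp: bundle_fibers_def top simp del: topspace_subtopology)
    have "F (\<phi> t x) \<in> char_leaf M A \<omega> T (F x)" by (rule flow_in_leaf[OF flow that])
    moreover have "F (\<phi> 0 x) \<in> char_leaf M A \<omega> T (F x)" by (rule flow_in_leaf[OF flow]) simp
    ultimately show ?thesis unfolding y q_def by simp
  qed
  obtain ji where ji: "continuous_map (subtopology M T) torus ji"
    "\<And>z. z \<in> topspace torus \<Longrightarrow> ji (j z) = z" "\<And>x. x \<in> T \<Longrightarrow> j (ji x) = x"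
    using embedding_inverse by metis
  have jiF: "ji (F x) = torus_cover x" for x
    using ji(2)[of "torus_cover x"] by (simp add: F_def topspace_torus)
  have "\<exists>r>0. \<exists>K>0. \<forall>x\<in>ball x0 r. \<exists>t\<in>{0<..K}. \<phi> t x - x \<in> int_vecs" for x0
  proof -
    have "q x0 \<in> topspace B"
      using continuous_map_image_subset_topspace[OF contq] by auto
    then have "\<exists>U h. openin B U \<and> q x0 \<in> U \<and>
        homeomorphic_map (prod_topology (subtopology B U) (top_of_set (sphere (0::complex) 1)))
          (subtopology (subtopology M T) {x \<in> T. p x \<in> U}) h \<and>
        (\<forall>y\<in>U. \<forall>z\<in>sphere 0 1. p (h (y, z)) = y)"
      using circle unfolding circle_bundle_def top by blast
    then obtain U h where U: "openin B U" "q x0 \<in> U"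
      and h: "homeomorphic_map (prod_topology (subtopology B U) (top_of_set (sphere (0::complex) 1)))
          (subtopology (subtopology M T) {x \<in> T. p x \<in> U}) h"
      and ph: "\<And>y z. y \<in> U \<Longrightarrow> z \<in> sphere 0 1 \<Longrightarrow> p (h (y, z)) = y"
      by blast
    define P where "P = prod_topology (subtopology B U) (top_of_set (sphere (0::complex) 1))"
    define E where "E = subtopology (subtopology M T) {x \<in> T. p x \<in> U}"
    have tP: "topspace P = U \<times> sphere 0 1"
      using openin_subset[OF U(1)] by (auto simp: P_def)
    have tE: "topspace E = {x \<in> T. p x \<in> U}"
      using T_subset by (auto simp: E_def)
    obtain g where g: "homeomorphic_maps P E h g"
      using h by (auto simp: homeomorphic_map_maps P_def E_def)
    have gh: "\<And>w. w \<in> topspace P \<Longrightarrow> g (h w) = w" and hg: "\<And>x. x \<in> topspace E \<Longrightarrow> h (g x) = x"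
      and conth: "continuous_map P E h" and contg: "continuous_map E P g"
      using g by (auto simp: homeomorphic_maps_def)
    have gP: "g x \<in> U \<times> sphere 0 1" if "x \<in> topspace E" for x
      using continuous_map_image_subset_topspace[OF contg] that tP by blast
    have fst_g: "fst (g x) = p x" if "x \<in> topspace E" for x
      using ph[of "fst (g x)" "snd (g x)"] gP[OF that] hg[OF that] by (auto simp: mem_Times_iff)
    define V where "V = {x. q x \<in> U}"
    have FV: "F x \<in> topspace E" if "x \<in> V" for x
      using that FT by (simp add: tE V_def q_def)
    \<comment> \<open>\<open>z\<close> is the circle coordinate in the trivialization, and
      \<open>k\<close> parametrizes the fibre through \<open>F x0\<close> by the circle, with values
      in the standard torus. Together they recover a point of this orbit from its angle.\<close>
    define z where "z x = snd (g (F x))" for x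
    define k where "k w = ji (h (q x0, w))" for w
    have V: "open V"
      using openin_continuous_map_preimage[OF contq U(1)] by (simp add: V_def)
    have x0: "x0 \<in> V" using U(2) by (simp add: V_def)
    have inv: "\<phi> t x \<in> V" if "x \<in> V" "t \<ge> 0" for t x
      using that by (simp add: V_def q_flow)
    have "continuous_map (top_of_set V) (subtopology M T) F"
      by (rule continuous_map_from_subtopology[OF contF])
    then have "continuous_map (top_of_set V) E F"
      unfolding E_def by (rule continuous_map_into_subtopology) (use FV in \<open>auto simp: tE\<close>)
    from continuous_map_compose[OF this contg] have "continuous_map (top_of_set V) P (g \<circ> F)" .
    then have "continuous_map (top_of_set V) (top_of_set (sphere (0::complex) 1)) (snd \<circ> (g \<circ> F))"
      unfolding P_def by (rule continuous_map_compose[OF _ continuous_map_snd])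
    then have zcont: "continuous_on V z"
      by (simp add: continuous_map_in_subtopology z_def[abs_def] o_def)
    have znorm: "norm (z x) = 1" if "x \<in> V" for x
      using gP[OF FV[OF that]] by (simp add: z_def mem_Times_iff)
    have gF: "g (F x) = (q x, z x)" if "x \<in> V" for x
      using fst_g[OF FV[OF that]] by (simp add: z_def q_def prod_eq_iff)
    have zinj: "\<phi> s x - \<phi> t x \<in> int_vecs"
      if "x \<in> V" "s \<ge> 0" "t \<ge> 0" "z (\<phi> s x) = z (\<phi> t x)" for x s t
    proof -
      have "g (F (\<phi> s x)) = g (F (\<phi> t x))"
        using that by (simp add: gF inv q_flow)
      then have "h (g (F (\<phi> s x))) = h (g (F (\<phi> t x)))" by (rule arg_cong)
      then have "F (\<phi> s x) = F (\<phi> t x)"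
        unfolding hg[OF FV[OF inv[OF that(1,2)]]] hg[OF FV[OF inv[OF that(1,3)]]] .
      then show ?thesis by (simp add: F_eq_iff)
    qed
    have "continuous_map (top_of_set (sphere (0::complex) 1)) P (\<lambda>w. (q x0, w))"
      unfolding P_def continuous_map_pairwise o_def using U openin_subset[OF U(1)] by (auto simp: continuous_map_const)
    from continuous_map_compose[OF this conth]
    have "continuous_map (top_of_set (sphere (0::complex) 1)) (subtopology M T) (h \<circ> (\<lambda>w. (q x0, w)))"
      unfolding E_def by (rule continuous_map_into_fulltopology)
    from continuous_map_compose[OF this ji(1)]
    have kcont: "continuous_on (sphere 0 1) k"
      by (simp add: torus_def continuous_map_in_subtopology k_def[abs_def] o_def)
    have kz: "k (z (\<phi> t x0)) = torus_cover (\<phi> t x0)" if "t \<ge> 0" for t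
    proof -
      have v: "\<phi> t x0 \<in> V" using inv[OF x0 that] .
      have "(q x0, z (\<phi> t x0)) = g (F (\<phi> t x0))"
        using that by (simp add: gF[OF v] q_flow)
      then show ?thesis by (simp add: k_def hg[OF FV[OF v]] jiF)
    qed
    show ?thesis
    proof (rule locally_bounded_period[of V x0 z k])
      fix r K :: real
      assume "r > 0" "K > 0" "\<And>x. x \<in> ball x0 r \<Longrightarrow> \<exists>t\<in>{0<..K}. \<phi> t x - x \<in> int_vecs"
      then show ?thesis by blast
    qed (rule V x0 zcont kcont inv znorm zinj kz; assumption)+
  qed
  then obtain K where K: "K > 0" "\<And>x. \<exists>t\<in>{0<..K}. \<phi> t x - x \<in> int_vecs"
    using globally_bounded_period by blast
  show False
    by (rule curl_flow_unbounded_period[OF smooth_\<beta> periodic_\<beta> flow L K])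
qed

end

theorem corollary1:
  fixes M :: "'m topology"
    and A :: "('m, real ^ 6) chart set"
    and \<omega> :: "('m, real ^ 6) form2"
    and \<alpha> :: "('m, real ^ 6) form1"
    and T :: "'m set"
  assumes "smooth_manifold M A"
    and "symplectic_form A \<omega>"
    and "primitive_of A \<omega> \<alpha>"
    and "embedded_3_torus M A T"
  shows "\<not> (char_kernel_line_field M A \<omega> T \<and>
            (\<exists>(B :: 'b topology) p.
               circle_bundle (subtopology M T) B p \<and>
               bundle_fibers (subtopology M T) B p = char_leaf M A \<omega> T ` T))"
proof -
  obtain j :: "complex ^ 3 \<Rightarrow> 'm" where j: "smooth_embedding torus torus_atlas M A j" "j ` topspace torus = T"
    using assms(4) by (auto simp: embedded_3_torus_def)
  interpret embedded_torus M A \<omega> \<alpha> j T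
    by unfold_locales (use assms j in \<open>auto simp: symplectic_form_def\<close>)
  show ?thesis using no_circle_bundle by blast
qed

end
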